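(* Let $\epsilon\in(0,1)$ and let $\sigma\in\,]0,s_4^2]$ be some energy level. With probability at least $1-2\epsilon$, for any $\theta\in\mathbb R^d\setminus\{0\}$, $$\left|\frac{\max\{N(\theta),\sigma\|\theta\|^2\}}{\max\{\widehat N(\theta),\sigma\|\theta\|^2\}}-1\right|\le B_*\big[\|\theta\|^{-2}N(\theta)\big],$$ where $$B_*(t)=\begin{cases}\dfrac{n^{-1/2}\zeta_*(\max\{t,\sigma\})}{1-4\,n^{-1/2}\zeta_*(\max\{t,\sigma\})},&\big[6+(\kappa-1)^{-1}\big]\zeta_*(\max\{t,\sigma\})\le\sqrt n,\\ +\infty,&\text{otherwise,}\end{cases}$$ and $$\zeta_*(t)=\sqrt{2.032(\kappa-1)\Big(\frac{0.73\,\mathbb E[\mathbf{Tr}(A^2)]}{\kappa^{1/2}\,\mathbb E[\|A\|_\infty^2]^{1/2}\,t}+\log(K)+\log(\epsilon^{-1})\Big)}+\sqrt{\frac{98.5\,\kappa^{1/2}\,\mathbb E[\|A\|_\infty^2]^{1/2}}{t}}.$$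
   Context: $A$ is a random symmetric positive semi-definite $d\times d$ real matrix and $A_1,\dots,A_n$ is an i.i.d. sample of copies of $A$; $N(\theta)=\mathbb E[\theta^\top A\theta]=\mathbb E[\|A^{1/2}\theta\|^2]$ and $\|A\|_\infty$ is the operator norm (largest eigenvalue). The quantities $$s_4=\mathbb E[\|A\|_\infty^2]^{1/4},\qquad\kappa=\sup_{\theta\in\mathbb R^d,\ \mathbb E[\|A^{1/2}\theta\|^2]>0}\frac{\mathbb E[\|A^{1/2}\theta\|^4]}{\mathbb E[\|A^{1/2}\theta\|^2]^2}$$ are assumed finite, with $\kappa>1$. Let $\psi:\mathbb R\to\mathbb R$ be the odd function with $\psi(t)=-\log(1-t+t^2/2)$ for $0\le t\le1$ and $\psi(t)=\log2$ for $t\ge1$. For $\lambda>0$ let $r_\lambda(\theta)=\frac1n\sum_{i=1}^n\psi(\|A_i^{1/2}\theta\|^2-\lambda)$, $\widehat\alpha_\lambda(\theta)=\sup\{\alpha\in\mathbb R_+:r_\lambda(\alpha\theta)\le0\}\in(0,+\infty]$ and $\widetilde N_\lambda(\theta)=\lambda/\widehat\alpha_\lambda(\theta)^2$ (equal to $0$ if $\widehat\alpha_\lambda(\theta)=+\infty$). Let $c=\frac{15}{8\log(2)(\sqrt2-1)}\exp\big(\frac{1+2\sqrt2}{2}\big)$, $a=1/2$, $K=1+\big\lceil a^{-1}\log\big(\frac{n}{72(2+c)\kappa^{1/2}}\big)\big\rceil$, assumed $\ge1$, and $\Lambda=\{(\lambda_j,\beta_j):0\le j<K\}$ with $$\lambda_j=\sqrt{\frac{2}{(\kappa-1)n}\Big(\frac{(2+3c)\,\mathbb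 E[\mathbf{Tr}(A^2)]}{4(2+c)\kappa^{1/2}\,\mathbb E[\|A\|_\infty^2]}\exp(ja)+\log(K/\epsilon)\Big)},\qquad\beta_j=\sqrt{2(2+c)\kappa^{1/2}\,\mathbb E[\|A\|_\infty^2]\,n\exp[-(j-1/2)a]}.$$ For $(\lambda,\beta)\in\Lambda$ put $$\xi=\frac{\kappa\lambda}{2},\quad\mu=\lambda(\kappa-1)+\frac{(2+c)\kappa^{1/2}s_4^2}{\beta},\quad\gamma=\frac\lambda2(\kappa-1)+\frac{(2+c)\kappa^{1/2}s_4^2}{\beta}+\frac{(2+3c)\,\mathbb E[\mathbf{Tr}(A^2)]}{2\beta^2\lambda}+\frac{\log(|\Lambda|/\epsilon)}{n\lambda},\quad\delta=\frac{\beta}{2n\lambda},$$ $$B_{\lambda,\beta}(t)=\frac{\gamma+\lambda\delta/\max\{t,\sigma\}}{1-\mu-\gamma-2\lambda\delta/\max\{t,\sigma\}}\ \text{ if }\xi+\mu+\gamma+\frac{2\delta\lambda}{\max\{t,\sigma\}}<1,\qquad B_{\lambda,\beta}(t)=+\infty\text{ otherwise.}$$ For $\theta\ne0$ let $(\widehat\lambda,\widehat\beta)\in\arg\min_{(\lambda,\beta)\in\Lambda}B_{\lambda,\beta}[\|\theta\|^{-2}\widetilde N_\lambda(\theta)]$ and $\widehat N(\theta)=\widetilde N_{\widehat\lambda}(\theta)$. An inequality with right-hand side $+\infty$ is void. "With probability at least $p$" means that the event contains a measurable event of probability at least $p$. *)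

theory Defs
  imports "HOL-Probability.Probability"
begin

definition psd :: "real^'d^'d \<Rightarrow> bool" where
  "psd S \<longleftrightarrow> transpose S = S \<and> (\<forall>x. 0 \<le> x \<bullet> (S *v x))"

text \<open>The square root \<open>S\<^sup>1\<^sup>/\<^sup>2\<close>: a positive semi-definite matrix has exactly one positive
  semi-definite square root.\<close>

definition psd_sqrt :: "real^'d^'d \<Rightarrow> real^'d^'d" where
  "psd_sqrt S = (THE R. psd R \<and> R ** R = S)"

definition random_psd_matrix :: "'w measure \<Rightarrow> ('w \<Rightarrow> real^'d^'d) \<Rightarrow> bool" where
  "random_psd_matrix M A \<longleftrightarrow> A \<in> borel_measurable M \<and> (\<forall>\<omega>\<in>space M. psd (A \<omega>))"

definition op_norm :: "real^'d^'d \<Rightarrow> real" where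
  "op_norm S = onorm (\<lambda>x. S *v x)"

definition N :: "'w measure \<Rightarrow> ('w \<Rightarrow> real^'d^'d) \<Rightarrow> real^'d \<Rightarrow> real" where
  "N M A \<theta> = (\<integral>\<omega>. \<theta> \<bullet> (A \<omega> *v \<theta>) \<partial>M)"

definition E_op2 :: "'w measure \<Rightarrow> ('w \<Rightarrow> real^'d^'d) \<Rightarrow> real" where
  "E_op2 M A = (\<integral>\<omega>. (op_norm (A \<omega>))^2 \<partial>M)"

definition E_tr2 :: "'w measure \<Rightarrow> ('w \<Rightarrow> real^'d^'d) \<Rightarrow> real" where
  "E_tr2 M A = (\<integral>\<omega>. trace (A \<omega> ** A \<omega>) \<partial>M)"

definition s4 :: "'w measure \<Rightarrow> ('w \<Rightarrow> real^'d^'d) \<Rightarrow> real" where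
  "s4 M A = root 4 (E_op2 M A)"

text \<open>The set of ratios whose supremum is \<open>\<kappa>\<close>. As \<open>Sup\<close> on the reals is only meaningful for
  bounded sets, finiteness of \<open>\<kappa>\<close> has to be stated as \<open>bdd_above\<close>.\<close>

definition kappa_ratios :: "'w measure \<Rightarrow> ('w \<Rightarrow> real^'d^'d) \<Rightarrow> real set" where
  "kappa_ratios M A =
    (\<lambda>\<theta>. (\<integral>\<omega>. norm (psd_sqrt (A \<omega>) *v \<theta>) ^ 4 \<partial>M)
          / (\<integral>\<omega>. norm (psd_sqrt (A \<omega>) *v \<theta>) ^ 2 \<partial>M) ^ 2)
      ` {\<theta>. (\<integral>\<omega>. norm (psd_sqrt (A \<omega>) *v \<theta>) ^ 2 \<partial>M) > 0}"

definition kappa :: "'w measure \<Rightarrow> ('w \<Rightarrow> real^'d^'d) \<Rightarrow> real" where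
  "kappa M A = Sup (kappa_ratios M A)"

definition psi_nonneg :: "real \<Rightarrow> real" where
  "psi_nonneg t = (if t \<le> 1 then - ln (1 - t + t^2 / 2) else ln 2)"

definition psi :: "real \<Rightarrow> real" where
  "psi t = (if 0 \<le> t then psi_nonneg t else - psi_nonneg (- t))"

text \<open>The empirical quantities take the observed sample \<open>S 0, \<dots>, S (n - 1)\<close> as an argument.\<close>

definition r_crit :: "nat \<Rightarrow> (nat \<Rightarrow> real^'d^'d) \<Rightarrow> real \<Rightarrow> real^'d \<Rightarrow> real" where
  "r_crit n S l \<theta> = (1 / real n) * (\<Sum>i<n. psi (norm (psd_sqrt (S i) *v \<theta>) ^ 2 - l))"

definition alpha_hat :: "nat \<Rightarrow> (nat \<Rightarrow> real^'d^'d) \<Rightarrow> real \<Rightarrow> real^'d \<Rightarrow> ereal" where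
  "alpha_hat n S l \<theta> = Sup (ereal ` {\<alpha>. 0 \<le> \<alpha> \<and> r_crit n S l (\<alpha> *\<^sub>R \<theta>) \<le> 0})"

definition N_tilde :: "nat \<Rightarrow> (nat \<Rightarrow> real^'d^'d) \<Rightarrow> real \<Rightarrow> real^'d \<Rightarrow> real" where
  "N_tilde n S l \<theta> =
    (if alpha_hat n S l \<theta> = \<infinity> then 0 else l / (real_of_ereal (alpha_hat n S l \<theta>)) ^ 2)"

definition c_const :: real where
  "c_const = 15 / (8 * ln 2 * (sqrt 2 - 1)) * exp ((1 + 2 * sqrt 2) / 2)"

definition a_step :: real where
  "a_step = 1 / 2"

definition K_grid :: "'w measure \<Rightarrow> ('w \<Rightarrow> real^'d^'d) \<Rightarrow> nat \<Rightarrow> int" where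
  "K_grid M A n = 1 + \<lceil>(1 / a_step) * ln (real n / (72 * (2 + c_const) * sqrt (kappa M A)))\<rceil>"

definition lambda_grid ::
  "'w measure \<Rightarrow> ('w \<Rightarrow> real^'d^'d) \<Rightarrow> nat \<Rightarrow> real \<Rightarrow> nat \<Rightarrow> real" where
  "lambda_grid M A n \<epsilon> j =
    sqrt (2 / ((kappa M A - 1) * real n)
      * ((2 + 3 * c_const) * E_tr2 M A / (4 * (2 + c_const) * sqrt (kappa M A) * E_op2 M A) * exp (real j * a_step)
         + ln (real_of_int (K_grid M A n) / \<epsilon>)))"

definition beta_grid ::
  "'w measure \<Rightarrow> ('w \<Rightarrow> real^'d^'d) \<Rightarrow> nat \<Rightarrow> nat \<Rightarrow> real" where
  "beta_grid M A n j =
    sqrt (2 * (2 + c_const) * sqrt (kappa M A) * E_op2 M A * real n * exp (- ((real j - 1 / 2) * a_step)))"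

definition Lambda ::
  "'w measure \<Rightarrow> ('w \<Rightarrow> real^'d^'d) \<Rightarrow> nat \<Rightarrow> real \<Rightarrow> (real \<times> real) set" where
  "Lambda M A n \<epsilon> =
    {(lambda_grid M A n \<epsilon> j, beta_grid M A n j) |j. int j < K_grid M A n}"

definition xi :: "'w measure \<Rightarrow> ('w \<Rightarrow> real^'d^'d) \<Rightarrow> real \<Rightarrow> real" where
  "xi M A l = kappa M A * l / 2"

definition mu :: "'w measure \<Rightarrow> ('w \<Rightarrow> real^'d^'d) \<Rightarrow> real \<Rightarrow> real \<Rightarrow> real" where
  "mu M A l b = l * (kappa M A - 1) + (2 + c_const) * sqrt (kappa M A) * (s4 M A)^2 / b"

definition gam ::
  "'w measure \<Rightarrow> ('w \<Rightarrow> real^'d^'d) \<Rightarrow> nat \<Rightarrow> real \<Rightarrow> real \<Rightarrow> real \<Rightarrow> real" where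
  "gam M A n \<epsilon> l b =
    l / 2 * (kappa M A - 1)
    + (2 + c_const) * sqrt (kappa M A) * (s4 M A)^2 / b
    + (2 + 3 * c_const) * E_tr2 M A / (2 * b^2 * l)
    + ln (real (card (Lambda M A n \<epsilon>)) / \<epsilon>) / (real n * l)"

definition delta :: "nat \<Rightarrow> real \<Rightarrow> real \<Rightarrow> real" where
  "delta n l b = b / (2 * real n * l)"

definition B_bound ::
  "'w measure \<Rightarrow> ('w \<Rightarrow> real^'d^'d) \<Rightarrow> nat \<Rightarrow> real \<Rightarrow> real \<Rightarrow> real \<times> real \<Rightarrow> real \<Rightarrow> ereal" where
  "B_bound M A n \<epsilon> \<sigma> = (\<lambda>(l, b) t.
    if xi M A l + mu M A l b + gam M A n \<epsilon> l b + 2 * delta n l b * l / max t \<sigma> < 1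
    then ereal ((gam M A n \<epsilon> l b + l * delta n l b / max t \<sigma>)
           / (1 - mu M A l b - gam M A n \<epsilon> l b - 2 * l * delta n l b / max t \<sigma>))
    else \<infinity>)"

definition zeta_star ::
  "'w measure \<Rightarrow> ('w \<Rightarrow> real^'d^'d) \<Rightarrow> nat \<Rightarrow> real \<Rightarrow> real \<Rightarrow> real" where
  "zeta_star M A n \<epsilon> t =
    sqrt (2.032 * (kappa M A - 1)
      * (0.73 * E_tr2 M A / (sqrt (kappa M A) * sqrt (E_op2 M A) * t)
         + ln (real_of_int (K_grid M A n)) + ln (1 / \<epsilon>)))
    + sqrt (98.5 * sqrt (kappa M A) * sqrt (E_op2 M A) / t)"

definition B_star ::
  "'w measure \<Rightarrow> ('w \<Rightarrow> real^'d^'d) \<Rightarrow> nat \<Rightarrow> real \<Rightarrow> real \<Rightarrow> real \<Rightarrow> ereal" where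
  "B_star M A n \<epsilon> \<sigma> t =
    (if (6 + 1 / (kappa M A - 1)) * zeta_star M A n \<epsilon> (max t \<sigma>) \<le> sqrt (real n)
     then ereal ((zeta_star M A n \<epsilon> (max t \<sigma>) / sqrt (real n))
            / (1 - 4 * (zeta_star M A n \<epsilon> (max t \<sigma>) / sqrt (real n))))
     else \<infinity>)"

end

theory Submission
  imports Defs
begin

text \<open>Write \<open>\<lambda>\<close> and \<open>\<beta>\<close> for the two parameters of a grid point and \<open>N\<close> for the energy
\<open>\<theta> \<mapsto> \<^bold>E[\<theta>\<^sup>T A \<theta>]\<close>. The estimator only looks at the signs of the criterion \<open>r\<^sub>\<lambda>(\<alpha>\<theta>)\<close>, so it is
enough to control \<open>r\<^sub>\<lambda>\<close> from both sides, simultaneously for all directions \<open>\<theta>\<close> and all grid points.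

The uniform control comes from PAC-Bayes. The direction \<open>\<theta>\<close> is replaced by a Gaussian vector
\<open>\<theta>'\<close> of mean \<open>\<theta>\<close> and covariance \<open>\<beta>\<^sup>-\<^sup>1 I\<close>, whose relative entropy with respect to the centred Gaussian is
only \<open>\<beta>\<parallel>\<theta>\<parallel>\<^sup>2/2\<close>; no dimension enters. What makes this work for a bounded influence function is
that \<open>\<psi>\<close> at the mean of a random variable \<open>X\<close> is at most the mean of \<open>ln (1 + X + X\<^sup>2/2)\<close>, up to an
eighth of the variance: through each point of the graph of \<open>\<psi>\<close> there
is a parabola of second derivative \<open>-1/4\<close> that stays below \<open>ln (1 + z + z\<^sup>2/2)\<close>, truncated at a suitable level (lemma
\<open>psi_above_parabola\<close>). Applied to \<open>\<theta>'\<^sup>T A \<theta>' - Tr(A)/\<beta> - \<lambda>\<close>, this gives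
\<open>psi_le_gaussian_ln_laplace_factor\<close>: \<open>\<psi>(\<theta>\<^sup>T A \<theta> - \<lambda>)\<close>, and likewise its negative, is bounded by a Gaussian
mean of logarithms. The exponential inequality \<open>pac_bayes_event\<close> then replaces the empirical mean of
these logarithms by the logarithm of an expectation, in which only second moments of \<open>A\<close> appear. The
variance term is where the constant \<open>c\<close> comes from.

After division by \<open>\<lambda>\<close> the outcome reads, with \<open>x = N(\<theta>)/\<lambda>\<close>,
\<open>\<bar>r\<^sub>\<lambda>(\<theta>)/\<lambda> - (x - 1)\<bar> \<le> \<gamma> + \<mu>(x - 1) + \<xi>(x - 1)\<^sup>2 + \<delta>\<parallel>\<theta>\<parallel>\<^sup>2\<close>, on an event of probability at least
\<open>1 - 2\<epsilon>\<close> that serves the whole grid (\<open>all_concentrated_event\<close>). At the root of \<open>\<alpha> \<mapsto> r\<^sub>\<lambda>(\<alpha>\<theta>)\<close> the number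
\<open>x\<close> is the ratio of the energy to its estimate, so a quadratic inequality for this ratio is
available. It confines \<open>x\<close> either to a neighbourhood of 1 or to a region far to the right of it; the latter
is excluded because \<open>r\<^sub>\<lambda>(\<alpha>\<theta>)\<close> is monotone in \<open>\<alpha>\<close>, which makes the inequality hold along the whole
segment from 1 to \<open>x\<close>. Hence \<open>ratio_le_B_bound\<close>, and \<open>B_bound_le\<close> expresses the same bound through the true energy.

The selected grid point minimises the bound, so any grid point may be used to estimate it. One at
the right scale makes \<open>\<gamma> + \<lambda>\<delta>/t\<close> at most \<open>n\<^sup>-\<^sup>1\<^sup>/\<^sup>2 \<zeta>\<^sub>*(t)\<close> (\<open>grid_optimised\<close>); the numerical factors of
\<open>\<zeta>\<^sub>*\<close> are the optimal ones multiplied by the loss from rounding to the grid, up to their last decimal.\<close>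

section \<open>The influence function\<close>

text \<open>The influence function is squeezed between \<open>psi_bot\<close> and \<open>psi_top\<close>, and equals the first on \<open>[0,1]\<close>
and the second on \<open>[-1,0]\<close>. Both are smooth on the whole line, with derivatives \<open>psi_bot'\<close> and \<open>psi_top'\<close>.\<close>

definition psi_top :: "real \<Rightarrow> real" where
  "psi_top z = ln (1 + z + z\<^sup>2 / 2)"

definition psi_bot :: "real \<Rightarrow> real" where
  "psi_bot z = - ln (1 - z + z\<^sup>2 / 2)"

definition psi_top' :: "real \<Rightarrow> real" where
  "psi_top' z = (1 + z) / (1 + z + z\<^sup>2 / 2)"

definition psi_bot' :: "real \<Rightarrow> real" where
  "psi_bot' z = (1 - z) / (1 - z + z\<^sup>2 / 2)"

lemma quad_ge_half: "1 + z + z\<^sup>2 / 2 \<ge> 1 / 2" "1 - z + z\<^sup>2 / 2 \<ge> 1 / 2" for z :: real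
proof -
  have "0 \<le> (1 + z)\<^sup>2" "0 \<le> (1 - z)\<^sup>2" by simp_all
  then show "1 + z + z\<^sup>2 / 2 \<ge> 1 / 2" "1 - z + z\<^sup>2 / 2 \<ge> 1 / 2"
    by (simp_all add: power2_eq_square algebra_simps)
qed

lemma quad_pos: "1 + z + z\<^sup>2 / 2 > 0" "1 - z + z\<^sup>2 / 2 > 0" for z :: real
  using quad_ge_half[of z] by linarith+

lemma psi_top_deriv: "(psi_top has_real_derivative psi_top' z) (at z)"
  unfolding psi_top_def[abs_def] psi_top'_def
  using quad_pos(1)[of z] by (auto intro!: derivative_eq_intros simp: field_simps)

lemma psi_bot_deriv: "(psi_bot has_real_derivative psi_bot' z) (at z)"
  unfolding psi_bot_def[abs_def] psi_bot'_def
  using quad_pos(2)[of z] by (auto intro!: derivative_eq_intros simp: field_simps)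

lemma psi_top_minus: "psi_top (- z) = - psi_bot z"
  by (simp add: psi_top_def psi_bot_def)

text \<open>The product of the two quadratics is \<open>1 + z\<^sup>4/4\<close>.\<close>

lemma psi_bot_le_top: "psi_bot z \<le> psi_top z"
proof -
  have "(1 + z + z\<^sup>2 / 2) * (1 - z + z\<^sup>2 / 2) = 1 + (z\<^sup>2)\<^sup>2 / 4"
    by (simp add: power2_eq_square algebra_simps)
  then have "1 \<le> (1 + z + z\<^sup>2 / 2) * (1 - z + z\<^sup>2 / 2)" by simp
  then have "0 \<le> ln ((1 + z + z\<^sup>2 / 2) * (1 - z + z\<^sup>2 / 2))" by simp
  then show ?thesis
    using quad_pos[of z] by (simp add: psi_top_def psi_bot_def ln_mult)
qed

lemma psi_top_ge: "- ln 2 \<le> psi_top z"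
proof -
  have "ln (1 / 2) \<le> psi_top z"
    unfolding psi_top_def using quad_ge_half[of z] by (subst ln_le_cancel_iff) auto
  then show ?thesis by (simp add: ln_div)
qed

lemma psi_bot'_le_top': "psi_bot' z \<le> psi_top' z" if "z \<ge> 0"
proof -
  have "(1 + z) * (1 - z + z\<^sup>2 / 2) = (1 - z) * (1 + z + z\<^sup>2 / 2) + z * z * z"
    by (simp add: power2_eq_square field_simps)
  then have "(1 - z) * (1 + z + z\<^sup>2 / 2) \<le> (1 + z) * (1 - z + z\<^sup>2 / 2)"
    using that by simp
  then show ?thesis
    unfolding psi_bot'_def psi_top'_def using quad_pos[of z]
    by (subst pos_divide_le_eq) (auto simp: pos_le_divide_eq)
qed

lemma mono_deriv_imp_above_tangent:
  fixes h :: "real \<Rightarrow> real"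
  assumes I: "m \<in> I" "z \<in> I" "is_interval I"
    and d: "\<And>x. x \<in> I \<Longrightarrow> (h has_real_derivative h' x) (at x)"
    and mono: "\<And>x y. x \<in> I \<Longrightarrow> y \<in> I \<Longrightarrow> x \<le> y \<Longrightarrow> h' x \<le> h' y"
  shows "h m + h' m * (z - m) \<le> h z"
proof -
  have between: "x \<in> I" if "u \<in> I" "v \<in> I" "u \<le> x" "x \<le> v" for u v x
    using I(3) that unfolding is_interval_1 by blast
  consider "z = m" | "m < z" | "z < m" by linarith
  then show ?thesis
  proof cases
    case 2
    obtain x where x: "m < x" "x < z" "h z - h m = (z - m) * h' x"
      using MVT2[of m z h h'] 2 d between I by (metis)
    have "h' m \<le> h' x" using mono between x I by (meson less_imp_le)
    then have "(z - m) * h' m \<le> (z - m) * h' x" using 2 by (intro mult_left_mono) auto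
    then show ?thesis using x by (simp add: algebra_simps)
  next
    case 3
    obtain x where x: "z < x" "x < m" "h m - h z = (m - z) * h' x"
      using MVT2[of z m h h'] 3 d between I by (metis)
    have "h' x \<le> h' m" using mono between x I by (meson less_imp_le)
    then have "(m - z) * h' x \<le> (m - z) * h' m" using 3 by (intro mult_left_mono) auto
    then show ?thesis using x by (simp add: algebra_simps)
  qed simp
qed

text \<open>A function whose second derivative is at least \<open>-1/4\<close> becomes convex after adding \<open>z\<^sup>2/8\<close>, so its
tangent parabolas of curvature \<open>-1/4\<close> lie below it.\<close>

lemma semiconvex_imp_above_parabola:
  fixes f :: "real \<Rightarrow> real"
  assumes "m \<in> I" "z \<in> I" "is_interval I"
    and d: "\<And>x. x \<in> I \<Longrightarrow> (f has_real_derivative f' x) (at x)"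
    and mono: "\<And>x y. x \<in> I \<Longrightarrow> y \<in> I \<Longrightarrow> x \<le> y \<Longrightarrow> f' x + x / 4 \<le> f' y + y / 4"
  shows "f m + f' m * (z - m) - (z - m)\<^sup>2 / 8 \<le> f z"
proof -
  have "(f m + m\<^sup>2 / 8) + (f' m + m / 4) * (z - m) \<le> f z + z\<^sup>2 / 8"
    by (rule mono_deriv_imp_above_tangent[where I = I])
       (use assms in \<open>auto intro!: derivative_eq_intros\<close>)
  then show ?thesis by (simp add: power2_eq_square field_simps)
qed

text \<open>With \<open>D = 1 + z + z\<^sup>2/2\<close> the second derivative of \<open>psi_top\<close> is \<open>(1 - D)/D\<^sup>2\<close>, which is never below
\<open>-1/4\<close>: the difference is \<open>(D - 2)\<^sup>2/(4D\<^sup>2)\<close>.\<close>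

lemma psi_top_semiconvex: "psi_top' x + x / 4 \<le> psi_top' y + y / 4" if "x \<le> y"
proof (rule DERIV_nonneg_imp_nondecreasing[OF that])
  fix z :: real
  let ?D = "1 + z + z\<^sup>2 / 2"
  have d: "((\<lambda>z. psi_top' z + z / 4) has_real_derivative (1 * ?D - (1 + z) * (1 + z)) / (?D * ?D) + 1 / 4) (at z)"
    unfolding psi_top'_def[abs_def] using quad_pos(1)[of z]
    by (auto intro!: derivative_eq_intros simp: power2_eq_square)
  have e: "(1 * ?D - (1 + z) * (1 + z)) / (?D * ?D) + 1 / 4 = (?D - 2)\<^sup>2 / (4 * (?D * ?D))"
    using quad_pos(1)[of z] by (simp add: divide_simps) (simp add: power2_eq_square algebra_simps)
  have nn: "0 \<le> (?D - 2)\<^sup>2 / (4 * (?D * ?D))"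
    by (rule divide_nonneg_nonneg[OF zero_le_power2 mult_nonneg_nonneg[OF _ zero_le_square]]) simp
  show "\<exists>d. ((\<lambda>z. psi_top' z + z / 4) has_real_derivative d) (at z) \<and> 0 \<le> d"
    by (rule exI, rule conjI, rule d[unfolded e], rule nn)
qed

text \<open>The point where the second derivative of \<open>psi_bot\<close> crosses \<open>-1/4\<close> downwards. To its left \<open>psi_bot\<close> is
above its tangent parabolas; between it and 1 the tangent parabola at \<open>z_infl\<close> is above \<open>psi_bot\<close>.\<close>

definition z_infl :: real where "z_infl = 1 - sqrt (4 * sqrt 2 - 5)"

lemma sqrt2_bounds: "1.41421356 \<le> sqrt (2::real)" "sqrt (2::real) \<le> 1.41421357"
  by (rule real_le_rsqrt real_le_lsqrt; simp add: power2_eq_square)+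

lemma z_infl: "0 \<le> z_infl" "z_infl \<le> 1" "(1 - z_infl)\<^sup>2 = 4 * sqrt 2 - 5" "z_infl < 1"
  using sqrt2_bounds by (auto simp: z_infl_def real_le_lsqrt)

lemma psi_bot_deriv2:
  "((\<lambda>z. psi_bot' z + z / 4) has_real_derivative
     ((1 - z + z\<^sup>2 / 2 + 2)\<^sup>2 - 8) / (4 * (1 - z + z\<^sup>2 / 2)\<^sup>2)) (at z)"
proof -
  let ?D = "1 - z + z\<^sup>2 / 2"
  have d: "((\<lambda>z. psi_bot' z + z / 4) has_real_derivative ((- 1) * ?D - (1 - z) * (- 1 + z)) / (?D * ?D) + 1 / 4) (at z)"
    unfolding psi_bot'_def[abs_def] using quad_pos(2)[of z]
    by (auto intro!: derivative_eq_intros simp: power2_eq_square)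
  have e: "((- 1) * ?D - (1 - z) * (- 1 + z)) / (?D * ?D) + 1 / 4 = ((?D + 2)\<^sup>2 - 8) / (4 * ?D\<^sup>2)"
    using quad_pos(2)[of z] by (simp add: divide_simps) (simp add: power2_eq_square algebra_simps)
  show ?thesis by (rule d[unfolded e])
qed

lemma z_infl_quad: "1 - z_infl + z_infl\<^sup>2 / 2 = 2 * (sqrt 2 - 1)"
  using z_infl(3) by (simp add: power2_eq_square algebra_simps)

lemma psi_bot_semiconvex: "psi_bot' x + x / 4 \<le> psi_bot' y + y / 4" if "x \<le> y" "y \<le> z_infl"
proof (rule DERIV_nonneg_imp_nondecreasing[OF that(1)])
  fix z :: real
  assume "z \<le> y"
  let ?D = "1 - z + z\<^sup>2 / 2"
  have "(1 - z)\<^sup>2 \<ge> (1 - z_infl)\<^sup>2" using z_infl \<open>z \<le> y\<close> that by (intro power_mono) auto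
  then have "?D + 2 \<ge> 2 * sqrt 2" using z_infl(3) by (simp add: power2_eq_square algebra_simps)
  then have sq: "(?D + 2)\<^sup>2 \<ge> (2 * sqrt 2)\<^sup>2" by (intro power_mono) auto
  then show "\<exists>d. ((\<lambda>z. psi_bot' z + z / 4) has_real_derivative d) (at z) \<and> 0 \<le> d"
    by (intro exI conjI) (rule psi_bot_deriv2, use sq in \<open>simp add: power_mult_distrib\<close>)
qed

lemma psi_bot_semiconcave: "psi_bot' x + x / 4 \<ge> psi_bot' y + y / 4" if "x \<le> y" "z_infl \<le> x" "y \<le> 1"
proof (rule DERIV_nonpos_imp_nonincreasing[OF that(1)])
  fix z :: real
  assume z: "x \<le> z" "z \<le> y"
  let ?D = "1 - z + z\<^sup>2 / 2"
  have "(1 - z)\<^sup>2 \<le> (1 - z_infl)\<^sup>2" using z_infl z that by (intro power_mono) auto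
  then have "?D + 2 \<le> 2 * sqrt 2" using z_infl(3) by (simp add: power2_eq_square algebra_simps)
  then have sq: "(?D + 2)\<^sup>2 \<le> (2 * sqrt 2)\<^sup>2" using quad_pos(2)[of z] by (intro power_mono) auto
  then show "\<exists>d. ((\<lambda>z. psi_bot' z + z / 4) has_real_derivative d) (at z) \<and> d \<le> 0"
    by (intro exI conjI) (rule psi_bot_deriv2, use sq in \<open>auto simp: power_mult_distrib intro!: divide_nonpos_nonneg\<close>)
qed

text \<open>The height of the vertex of the tangent parabola to \<open>psi_bot\<close> at \<open>z_infl\<close> (see \<open>psi_cap_eq\<close>). Truncating
\<open>psi_top\<close> at this level is what keeps the constant \<open>c\<close> finite.\<close>

definition psi_cap :: real where
  "psi_cap = ln (1 / (2 * (sqrt 2 - 1)) * exp ((1 + 2 * sqrt 2) / 2))"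

definition cap_parabola :: "real \<Rightarrow> real" where
  "cap_parabola z = psi_bot z_infl + psi_bot' z_infl * (z - z_infl) - (z - z_infl)\<^sup>2 / 8"

definition z_peak :: real where "z_peak = z_infl + 4 * psi_bot' z_infl"

lemma psi_bot'_infl: "psi_bot' z_infl \<ge> 1 / 4" "(psi_bot' z_infl)\<^sup>2 = (1 + 2 * sqrt 2) / 4"
proof -
  have e: "psi_bot' z_infl = sqrt (4 * sqrt 2 - 5) / (2 * (sqrt 2 - 1))"
    unfolding psi_bot'_def z_infl_quad by (simp add: z_infl_def)
  have s: "sqrt 2 * sqrt 2 = (2::real)" by simp
  have "(psi_bot' z_infl)\<^sup>2 = (4 * sqrt 2 - 5) / (4 * (sqrt 2 - 1)\<^sup>2)"
    unfolding e power_divide power_mult_distrib using sqrt2_bounds by simp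
  also have "\<dots> = (1 + 2 * sqrt 2) / 4"
  proof -
    have "(4 * sqrt 2 - 5) = (1 + 2 * sqrt 2) * (sqrt 2 - 1)\<^sup>2"
      by (simp add: power2_eq_square algebra_simps)
    then show ?thesis using sqrt2_bounds by simp
  qed
  finally show sq: "(psi_bot' z_infl)\<^sup>2 = (1 + 2 * sqrt 2) / 4" .
  have "0 \<le> psi_bot' z_infl" unfolding e using sqrt2_bounds by auto
  moreover have "(1/4)\<^sup>2 \<le> (psi_bot' z_infl)\<^sup>2" unfolding sq using sqrt2_bounds by (simp add: power2_eq_square)
  ultimately show "psi_bot' z_infl \<ge> 1 / 4" by (rule power2_le_imp_le[rotated])
qed

lemma psi_cap_eq: "psi_cap = psi_bot z_infl + 2 * (psi_bot' z_infl)\<^sup>2"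
proof -
  have "psi_cap = - ln (2 * (sqrt 2 - 1)) + (1 + 2 * sqrt 2) / 2"
    unfolding psi_cap_def using sqrt2_bounds by (subst ln_mult) (auto simp: ln_div)
  then show ?thesis unfolding psi_bot'_infl psi_bot_def z_infl_quad by (simp add: field_simps)
qed

lemma cap_parabola_peak: "cap_parabola z = psi_cap - (z - z_peak)\<^sup>2 / 8"
  unfolding cap_parabola_def psi_cap_eq z_peak_def
  by (simp add: power2_eq_square algebra_simps add_divide_distrib diff_divide_distrib)

lemma cap_parabola_expand:
  "cap_parabola z = cap_parabola m + (psi_bot' z_infl - (m - z_infl) / 4) * (z - m) - (z - m)\<^sup>2 / 8"
  unfolding cap_parabola_def by (simp add: power2_eq_square field_simps)

lemma psi_bot_above_parabola:
  assumes "m \<le> z_infl" "z \<le> z_infl"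
  shows "psi_bot m + psi_bot' m * (z - m) - (z - m)\<^sup>2 / 8 \<le> psi_bot z"
  by (rule semiconvex_imp_above_parabola[where I = "{..z_infl}"])
     (use assms psi_bot_deriv psi_bot_semiconvex in auto)

lemma psi_top_above_parabola:
  "psi_top m + psi_top' m * (z - m) - (z - m)\<^sup>2 / 8 \<le> psi_top z"
  by (rule semiconvex_imp_above_parabola[where I = UNIV])
     (use psi_top_deriv psi_top_semiconvex in auto)

text \<open>To the left of \<open>z_infl\<close> the parabola is below \<open>psi_bot\<close>. To the right it starts below \<open>psi_top\<close> with a
slope no larger, and \<open>psi_top\<close> never bends downwards faster than the parabola.\<close>

lemma cap_parabola_le_psi_top: "cap_parabola z \<le> psi_top z"
proof (cases "z \<le> z_infl")
  case True
  then show ?thesis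
    using psi_bot_above_parabola[of z_infl z] psi_bot_le_top[of z] by (simp add: cap_parabola_def)
next
  case False
  have "psi_bot' z_infl * (z - z_infl) \<le> psi_top' z_infl * (z - z_infl)"
    using False z_infl by (intro mult_right_mono psi_bot'_le_top') auto
  then show ?thesis
    using psi_top_above_parabola[of z_infl z] psi_bot_le_top[of z_infl] by (simp add: cap_parabola_def)
qed

lemma cap_parabola_le_cap: "cap_parabola z \<le> psi_cap"
  by (simp add: cap_parabola_peak)

lemma psi_bot_mono: "psi_bot x \<le> psi_bot y" if "x \<le> y" "y \<le> 1"
proof (rule DERIV_nonneg_imp_nondecreasing[OF that(1)])
  fix z assume "z \<le> y"
  then show "\<exists>d. (psi_bot has_real_derivative d) (at z) \<and> 0 \<le> d"
    by (intro exI conjI) (rule psi_bot_deriv, use that quad_pos(2)[of z] in \<open>auto simp: psi_bot'_def\<close>)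
qed

lemma psi_bot_1: "psi_bot 1 = ln 2"
  by (simp add: psi_bot_def ln_div)

lemma psi_eq_bot: "psi z = psi_bot z" if "0 \<le> z" "z \<le> 1"
  using that by (simp add: psi_def psi_nonneg_def psi_bot_def)

lemma psi_eq_ln2: "psi z = ln 2" if "1 \<le> z"
  using that psi_bot_1 by (cases "z = 1") (auto simp: psi_def psi_nonneg_def psi_bot_def)

lemma psi_minus: "psi (- z) = - psi z"
  by (auto simp: psi_def psi_nonneg_def)

lemma psi_eq_top: "psi z = psi_top z" if "-1 \<le> z" "z \<le> 0"
  using that psi_eq_bot[of "-z"] psi_minus[of z] psi_top_minus[of "-z"] by simp

lemma psi_eq_neg_ln2: "psi z = - ln 2" if "z \<le> -1"
  using that psi_eq_ln2[of "-z"] psi_minus[of z] by simp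

lemma psi_mono: "psi x \<le> psi y" if "x \<le> y"
proof -
  have nonneg: "psi u \<le> psi v" if "0 \<le> u" "u \<le> v" for u v
  proof (cases "v \<le> 1")
    case True then show ?thesis using that psi_bot_mono by (simp add: psi_eq_bot)
  next
    case False
    then show ?thesis
      using that psi_bot_mono[of u 1] psi_bot_1 psi_eq_bot[of u] psi_eq_ln2[of u] psi_eq_ln2[of v]
      by (cases "u \<le> 1") auto
  qed
  have "psi 0 = 0" by (simp add: psi_def psi_nonneg_def)
  then show ?thesis
    using that nonneg[of x y] nonneg[of "-y" "-x"] nonneg[of 0 y] nonneg[of 0 "-x"]
      psi_minus[of x] psi_minus[of y]
    by (cases "0 \<le> x"; cases "0 \<le> y") auto
qed

lemma psi_le: "psi z \<le> ln 2"
  using psi_mono[of z "max z 1"] psi_eq_ln2[of "max z 1"] by simp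

lemma continuous_psi: "continuous_on UNIV psi"
proof -
  have c0: "continuous_on S psi_bot" for S
    using psi_bot_deriv by (intro DERIV_continuous_on) (rule DERIV_subset, auto)
  have c1: "continuous_on S psi_top" for S
    using psi_top_deriv by (intro DERIV_continuous_on) (rule DERIV_subset, auto)
  have "continuous_on {0..1} psi"
    using c0[of "{0..1}"] by (rule continuous_on_eq) (auto simp: psi_eq_bot)
  moreover have "continuous_on {-1..0} psi"
    using c1[of "{-1..0}"] by (rule continuous_on_eq) (auto simp: psi_eq_top)
  moreover have "continuous_on {1..} psi"
    by (rule continuous_on_eq[OF continuous_on_const[of _ "ln 2"]]) (auto simp: psi_eq_ln2)
  moreover have "continuous_on {..-1} psi"
    by (rule continuous_on_eq[OF continuous_on_const[of _ "- ln 2"]]) (auto simp: psi_eq_neg_ln2)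
  ultimately have "continuous_on ({..-1} \<union> ({-1..0} \<union> ({0..1} \<union> {1..}))) psi"
    by (intro continuous_on_closed_Un) auto
  moreover have "{..-1} \<union> ({-1..0} \<union> ({0..1} \<union> {1..})) = (UNIV :: real set)" by auto
  ultimately show ?thesis by simp
qed

lemma psi_cap_ge: "2 \<le> psi_cap"
proof -
  have "2 * (psi_bot' z_infl)\<^sup>2 = (1 + 2 * sqrt 2) / 2" using psi_bot'_infl by simp
  moreover have "ln (2 * (sqrt 2 - 1)) \<le> 2 * (sqrt 2 - 1) - (1::real)"
    using sqrt2_bounds by (intro ln_le_minus_one) auto
  then have "psi_bot z_infl \<ge> 0.171"
    unfolding psi_bot_def z_infl_quad using sqrt2_bounds by simp
  ultimately show ?thesis using sqrt2_bounds unfolding psi_cap_eq by simp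
qed

lemma psi_bot_infl_le_cap: "psi_bot z_infl \<le> psi_cap"
  unfolding psi_cap_eq by simp

lemma psi_top'_le_1: "psi_top' m \<le> 1" "0 \<le> psi_top' m" if "-1 \<le> m"
  using that quad_pos(1)[of m] by (auto simp: psi_top'_def)

lemma parabola_le_peak: "a + p * (z - m) - (z - m)\<^sup>2 / 8 \<le> a + 2 * p\<^sup>2" for a p z m :: real
proof -
  have "0 \<le> ((z - m) - 4 * p)\<^sup>2" by simp
  then show ?thesis by (simp add: power2_eq_square field_simps)
qed

text \<open>Between \<open>z_infl\<close> and 1 the function \<open>psi_bot\<close> bends downwards faster than the parabola; after 1
\<open>\<psi>\<close> is constant while the parabola grows up to its vertex.\<close>

lemma psi_le_cap_parabola: "psi m \<le> cap_parabola m" if "z_infl \<le> m" "m \<le> z_peak"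
proof -
  have in1: "psi m \<le> cap_parabola m" if "z_infl \<le> m" "m \<le> 1" for m
  proof -
    have anti: "- psi_bot' x - x / 4 \<le> - psi_bot' y - y / 4" if "x \<in> {z_infl..1}" "y \<in> {z_infl..1}" "x \<le> y" for x y
      using psi_bot_semiconcave[of x y] that by simp
    have "(- psi_bot z_infl - z_infl\<^sup>2 / 8) + (- psi_bot' z_infl - z_infl / 4) * (m - z_infl) \<le> - psi_bot m - m\<^sup>2 / 8"
      by (rule mono_deriv_imp_above_tangent[where I = "{z_infl..1}"])
         (use that z_infl anti in \<open>auto intro!: derivative_eq_intros psi_bot_deriv\<close>)
    then have "psi_bot m \<le> cap_parabola m" by (simp add: cap_parabola_def power2_eq_square field_simps)
    then show ?thesis using that z_infl by (simp add: psi_eq_bot)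
  qed
  show ?thesis
  proof (cases "m \<le> 1")
    case False
    have "\<bar>m - z_peak\<bar> \<le> \<bar>1 - z_peak\<bar>" using that False by auto
    then have "(m - z_peak)\<^sup>2 \<le> (1 - z_peak)\<^sup>2" unfolding abs_le_square_iff .
    then have "cap_parabola 1 \<le> cap_parabola m" unfolding cap_parabola_peak by simp
    then show ?thesis using in1[of 1] False z_infl psi_eq_ln2 by simp
  qed (use in1 that in simp)
qed

text \<open>The analytic core of the smoothing step. Integrating this inequality against a distribution of mean
\<open>m\<close> removes the linear term and leaves \<open>\<psi>(m)\<close> minus an eighth of the variance. The truncation at
\<open>psi_cap\<close> on the right-hand side is what \<open>min_psi_top_add_le\<close> needs.\<close>

lemma psi_above_parabola:
  "\<exists>p. \<forall>z. psi m + p * (z - m) - (z - m)\<^sup>2 / 8 \<le> min (psi_top z) psi_cap"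
proof -
  consider "m \<le> -1" | "-1 \<le> m" "m \<le> 0" | "0 \<le> m" "m \<le> z_infl" | "z_infl \<le> m" "m \<le> z_peak"
    | "z_infl \<le> m" "z_peak \<le> m" by linarith
  then show ?thesis
  proof cases
    \<comment> \<open>\<open>\<psi>(m)\<close> is the global minimum of \<open>psi_top\<close>.\<close>
    case 1
    have "psi m + 0 * (z - m) - (z - m)\<^sup>2 / 8 \<le> min (psi_top z) psi_cap" for z
    proof -
      have "- ln 2 \<le> psi_cap" using psi_cap_ge ln_ge_zero[of "2::real"] by linarith
      then show ?thesis using psi_top_ge[of z] psi_eq_neg_ln2[OF 1] zero_le_power2[of "z - m"]
        unfolding min_def by (simp only: split: if_splits) linarith
    qed
    then show ?thesis by blast
  next
    \<comment> \<open>The tangent parabola to \<open>psi_top\<close>, whose vertex is no higher than \<open>2\<close>.\<close>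
    case 2
    have "psi m + psi_top' m * (z - m) - (z - m)\<^sup>2 / 8 \<le> min (psi_top z) psi_cap" for z
    proof -
      have "psi_top m \<le> psi_top 0"
        using psi_bot_mono[of 0 "-m"] 2 psi_top_minus[of "-m"] psi_top_minus[of 0] psi_mono[of m 0] psi_eq_top by simp
      moreover have "(psi_top' m)\<^sup>2 \<le> 1\<^sup>2" using psi_top'_le_1[of m] 2 by (intro power_mono) auto
      ultimately show ?thesis
        using parabola_le_peak[of "psi_top m" "psi_top' m" z m] psi_top_above_parabola[of m z] 2 psi_cap_ge
        by (simp add: psi_eq_top psi_top_def)
    qed
    then show ?thesis by blast
  next
    \<comment> \<open>The tangent parabola to \<open>psi_bot\<close>; to the right of \<open>z_infl\<close> it is below the one tangent at \<open>z_infl\<close>.\<close>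
    case 3
    have *: "psi m = psi_bot m" using 3 z_infl by (simp add: psi_eq_bot)
    have "psi_bot m + psi_bot' m * (z - m) - (z - m)\<^sup>2 / 8 \<le> min (psi_top z) psi_cap" for z
    proof (cases "z \<le> z_infl")
      case True
      then show ?thesis
        using psi_bot_above_parabola[of m z] 3 psi_bot_le_top[of z] psi_bot_mono[of z z_infl] z_infl
          psi_bot_infl_le_cap by simp
    next
      case False
      have "psi_bot' m + m / 4 \<le> psi_bot' z_infl + z_infl / 4" using 3 by (intro psi_bot_semiconvex) auto
      then have "(psi_bot' m + m / 4) * (z - z_infl) \<le> (psi_bot' z_infl + z_infl / 4) * (z - z_infl)"
        using False by (intro mult_right_mono) auto
      then have "psi_bot m + psi_bot' m * (z - m) - (z - m)\<^sup>2 / 8 \<le> cap_parabola z"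
        using psi_bot_above_parabola[of m z_infl] 3 by (simp add: cap_parabola_def power2_eq_square field_simps)
      then show ?thesis using cap_parabola_le_psi_top[of z] cap_parabola_le_cap[of z] by simp
    qed
    then show ?thesis using * by metis
  next
    \<comment> \<open>A vertical translate of the parabola tangent at \<open>z_infl\<close>.\<close>
    case 4
    have "psi m + (psi_bot' z_infl - (m - z_infl) / 4) * (z - m) - (z - m)\<^sup>2 / 8 \<le> min (psi_top z) psi_cap" for z
      using psi_le_cap_parabola[OF 4] cap_parabola_expand[of z m] cap_parabola_le_psi_top[of z] cap_parabola_le_cap[of z] by simp
    then show ?thesis by blast
  next
    \<comment> \<open>The parabola with its vertex at \<open>m\<close>, to the right of the vertex of the previous one.\<close>
    case 5
    have l2: "ln 2 \<le> (1::real)" using ln_2_less_1 by simp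
    have "psi m + 0 * (z - m) - (z - m)\<^sup>2 / 8 \<le> min (psi_top z) psi_cap" for z
    proof (cases "z \<le> z_peak")
      case True
      then have "(z_peak - z)\<^sup>2 \<le> (m - z)\<^sup>2" using 5 by (intro power_mono) auto
      then have "psi_cap - (z - m)\<^sup>2 / 8 \<le> cap_parabola z" unfolding cap_parabola_peak by (simp add: power2_commute)
      then show ?thesis using psi_le[of m] psi_cap_ge l2 cap_parabola_le_psi_top[of z] cap_parabola_le_cap[of z] by simp
    next
      case False
      then have z: "z > 1" using psi_bot'_infl z_infl unfolding z_peak_def by linarith
      have "ln 2 \<le> psi_top z" unfolding psi_top_def using z zero_le_power2[of z] by (subst ln_le_cancel_iff) linarith+
      moreover have "0 \<le> (z - m)\<^sup>2" by simp
      ultimately show ?thesis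
        unfolding min.bounded_iff using psi_le[of m] psi_cap_ge l2 by (intro conjI) linarith+
    qed
    then show ?thesis by blast
  qed
qed

lemma c_const_eq_exp_cap: "c_const = 15 / (4 * ln 2) * exp psi_cap"
  unfolding c_const_def psi_cap_def using sqrt2_bounds by (subst exp_ln) (auto simp: field_simps)

text \<open>An additive correction \<open>y\<close> is moved inside the logarithm. It is truncated at \<open>4 ln 2 = ln 16\<close>, so the chord
bound \<open>exp y \<le> 1 + 15 y/(4 ln 2)\<close> applies, and the factor in front of it is at most \<open>exp psi_cap\<close>; the
product of the two is \<open>c\<close>.\<close>

lemma min_psi_top_add_le:
  assumes "0 \<le> y"
  shows "min (psi_top z) psi_cap + min (4 * ln 2) y \<le> ln (1 + z + z\<^sup>2 / 2 + c_const * y)"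
proof -
  let ?k = "15 / (4 * ln 2) :: real"
  have l2: "(0::real) < ln 2" by simp
  have e16: "exp (4 * ln 2) = (16::real)"
    by (simp add: exp_of_nat_mult[of 4, simplified])
  have chord: "exp (min (4 * ln 2) y) \<le> 1 + ?k * y"
  proof (cases "y \<le> 4 * ln 2")
    case True
    define t where "t = y / (4 * ln 2)"
    have t: "0 \<le> t" "t \<le> 1" "y = t * (4 * ln 2)" using True assms l2 by (auto simp: t_def)
    have "exp ((1 - t) *\<^sub>R 0 + t *\<^sub>R (4 * ln 2)) \<le> (1 - t) * exp 0 + t * exp (4 * ln 2)"
      using t by (intro convex_onD[OF exp_convex]) auto
    then show ?thesis using True l2 e16 by (simp add: t(3) min_def algebra_simps)
  next
    case False
    then have "15 \<le> ?k * y" using l2 by (simp add: field_simps)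
    then show ?thesis using False e16 by (simp add: min_def)
  qed
  have pos: "0 < exp (min (psi_top z) psi_cap)" "0 \<le> ?k * y" using assms by auto
  have "exp (min (psi_top z) psi_cap + min (4 * ln 2) y) \<le> exp (min (psi_top z) psi_cap) * (1 + ?k * y)"
    unfolding exp_add using chord by (intro mult_left_mono) auto
  also have "\<dots> = exp (min (psi_top z) psi_cap) + exp (min (psi_top z) psi_cap) * (?k * y)" by (simp add: algebra_simps)
  also have "\<dots> \<le> exp (psi_top z) + exp psi_cap * (?k * y)"
    using pos by (intro add_mono mult_right_mono) auto
  also have "\<dots> = 1 + z + z\<^sup>2 / 2 + c_const * y"
    using quad_pos(1)[of z] by (simp add: c_const_eq_exp_cap psi_top_def)
  finally have *: "exp (min (psi_top z) psi_cap + min (4 * ln 2) y) \<le> 1 + z + z\<^sup>2 / 2 + c_const * y" .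
  then show ?thesis
    by (metis exp_gt_zero ln_exp ln_le_cancel_iff order_less_le_trans)
qed

section \<open>Positive semi-definite matrices and their square roots\<close>

lemma inner_matrix_commute:
  fixes S :: "real^'d^'d"
  assumes "transpose S = S"
  shows "x \<bullet> (S *v y) = (S *v x) \<bullet> y"
  using dot_lmul_matrix[of x S y] assms by (metis transpose_matrix_vector)

lemma psd_sym: "psd S \<Longrightarrow> transpose S = S"
  and psd_nonneg: "psd S \<Longrightarrow> 0 \<le> x \<bullet> (S *v x)"
  by (auto simp: psd_def)

text \<open>The discriminant argument for a form that may be degenerate; if it vanishes at \<open>y\<close>, the quadratic
polynomial is affine and bounded below, hence constant.\<close>

lemma psd_Cauchy_Schwarz:
  assumes "psd S"
  shows "(x \<bullet> (S *v y))\<^sup>2 \<le> (x \<bullet> (S *v x)) * (y \<bullet> (S *v y))"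
proof -
  let ?a = "x \<bullet> (S *v x)" and ?b = "x \<bullet> (S *v y)" and ?c = "y \<bullet> (S *v y)"
  have comm: "y \<bullet> (S *v x) = ?b"
    using inner_matrix_commute[OF psd_sym[OF assms], of y x] by (simp add: inner_commute)
  have q: "0 \<le> ?a * s\<^sup>2 + 2 * ?b * s * t + ?c * t\<^sup>2" for s t
  proof -
    have "0 \<le> (s *\<^sub>R x + t *\<^sub>R y) \<bullet> (S *v (s *\<^sub>R x + t *\<^sub>R y))"
      by (rule psd_nonneg[OF assms])
    also have "\<dots> = ?a * s\<^sup>2 + 2 * ?b * s * t + ?c * t\<^sup>2"
      by (simp add: matrix_vector_right_distrib matrix_vector_mult_scaleR inner_add_left inner_add_right
          comm power2_eq_square algebra_simps)
    finally show ?thesis .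
  qed
  have a: "0 \<le> ?a" and c: "0 \<le> ?c" using psd_nonneg[OF assms] by auto
  show ?thesis
  proof (cases "?c = 0")
    case False
    then have "0 < ?c" using c by simp
    have "?a * ?c\<^sup>2 + 2 * ?b * ?c * (- ?b) + ?c * (- ?b)\<^sup>2 = ?c * (?a * ?c - ?b\<^sup>2)"
      by (simp add: power2_eq_square algebra_simps)
    then have "0 \<le> ?c * (?a * ?c - ?b\<^sup>2)" using q[of ?c "- ?b"] by simp
    then show ?thesis using \<open>0 < ?c\<close> by (simp add: zero_le_mult_iff)
  next
    case True
    have "?b = 0"
    proof (rule ccontr)
      assume "?b \<noteq> 0"
      then show False using q[of 1 "- (?a + 1) / (2 * ?b)"] True a by simp
    qed
    then show ?thesis using True by simp
  qed
qed

lemma psd_form_eq_0_imp: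
  assumes "psd S" "x \<bullet> (S *v x) = 0" shows "S *v x = 0"
proof -
  have "((S *v x) \<bullet> (S *v x))\<^sup>2 \<le> 0"
    using psd_Cauchy_Schwarz[OF assms(1), of "S *v x" x] assms(2) by simp
  then show ?thesis by simp
qed

lemma norm_mult_le_op_norm: "norm (S *v x) \<le> op_norm S * norm x"
  unfolding op_norm_def by (intro onorm matrix_vector_mul_bounded_linear)

lemma op_norm_nonneg: "0 \<le> op_norm S"
  unfolding op_norm_def by (intro onorm_pos_le matrix_vector_mul_bounded_linear)

lemma quadform_le_op_norm: "x \<bullet> (S *v x) \<le> op_norm S * (norm x)\<^sup>2"
proof -
  have "x \<bullet> (S *v x) \<le> norm x * norm (S *v x)" by (rule norm_cauchy_schwarz)
  also have "\<dots> \<le> norm x * (op_norm S * norm x)" by (intro mult_left_mono norm_mult_le_op_norm) auto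
  finally show ?thesis by (simp add: power2_eq_square algebra_simps)
qed

text \<open>Cauchy--Schwarz for the form of \<open>S\<close>, applied to \<open>S x\<close> and \<open>x\<close>, avoids any use of the square root of \<open>S\<close>.\<close>

lemma norm_sq_mult_le:
  assumes "psd S"
  shows "(norm (S *v x))\<^sup>2 \<le> op_norm S * (x \<bullet> (S *v x))"
proof (cases "S *v x = 0")
  case True
  then show ?thesis by simp
next
  case False
  have "((norm (S *v x))\<^sup>2)\<^sup>2 = ((S *v x) \<bullet> (S *v x))\<^sup>2" by (simp add: power2_norm_eq_inner)
  also have "\<dots> \<le> ((S *v x) \<bullet> (S *v (S *v x))) * (x \<bullet> (S *v x))" by (rule psd_Cauchy_Schwarz[OF assms])
  also have "\<dots> \<le> (op_norm S * (norm (S *v x))\<^sup>2) * (x \<bullet> (S *v x))"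
    by (intro mult_right_mono quadform_le_op_norm psd_nonneg assms)
  finally have "(norm (S *v x))\<^sup>2 * (norm (S *v x))\<^sup>2 \<le> (norm (S *v x))\<^sup>2 * (op_norm S * (x \<bullet> (S *v x)))"
    by (simp add: power2_eq_square algebra_simps)
  then show ?thesis by (rule mult_left_le_imp_le) (use False in simp)
qed

lemma norm_matrix_sq: "(norm S)\<^sup>2 = (\<Sum>i\<in>UNIV. \<Sum>j\<in>UNIV. (S $ i $ j)\<^sup>2)" for S :: "real^'n^'m"
  by (simp add: norm_vec_def L2_set_def sum_nonneg)

lemma trace_square_sym:
  fixes S :: "real^'d^'d"
  assumes "transpose S = S"
  shows "trace (S ** S) = (norm S)\<^sup>2"
proof -
  have "S $ j $ i = S $ i $ j" for i j using assms by (metis transpose_def vec_lambda_beta)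
  then show ?thesis unfolding norm_matrix_sq
    by (simp add: trace_def matrix_matrix_mult_def power2_eq_square)
qed

lemma norm_matrix_vector_le: "norm (S *v \<theta>) \<le> norm S * norm \<theta>" for S :: "real^'d^'d"
proof -
  have "(norm (S *v \<theta>))\<^sup>2 = (\<Sum>i\<in>UNIV. ((S $ i) \<bullet> \<theta>)\<^sup>2)"
    by (simp add: norm_vec_def[of "S *v \<theta>"] L2_set_def sum_nonneg matrix_vector_mul_component)
  also have "\<dots> \<le> (\<Sum>i\<in>UNIV. (norm (S $ i) * norm \<theta>)\<^sup>2)"
    by (intro sum_mono) (simp add: Cauchy_Schwarz_ineq2 abs_le_square_iff[symmetric])
  also have "\<dots> = (norm S * norm \<theta>)\<^sup>2"
    by (simp add: norm_vec_def[of S] L2_set_def sum_nonneg power_mult_distrib sum_distrib_right)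
  finally show ?thesis by (rule power2_le_imp_le) simp
qed

lemma abs_quadform_le: "\<bar>\<theta> \<bullet> (S *v \<theta>)\<bar> \<le> (norm \<theta>)\<^sup>2 * norm S" for S :: "real^'d^'d"
proof -
  have "\<bar>\<theta> \<bullet> (S *v \<theta>)\<bar> \<le> norm \<theta> * norm (S *v \<theta>)" by (rule Cauchy_Schwarz_ineq2)
  also have "\<dots> \<le> norm \<theta> * (norm S * norm \<theta>)" by (intro mult_left_mono norm_matrix_vector_le) auto
  finally show ?thesis by (simp add: power2_eq_square mult_ac)
qed

lemma abs_trace_le:
  fixes S :: "real^'d^'d"
  shows "\<bar>trace S\<bar> \<le> real CARD('d) * norm S"
proof -
  have "\<bar>S $ i $ i\<bar> \<le> norm S" for i
    using component_le_norm_cart[of "S $ i" i] Finite_Cartesian_Product.norm_nth_le[of S i] by linarith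
  then have "(\<Sum>i\<in>(UNIV::'d set). \<bar>S $ i $ i\<bar>) \<le> (\<Sum>i\<in>(UNIV::'d set). norm S)" by (intro sum_mono)
  then show ?thesis unfolding trace_def by (intro order_trans[OF sum_abs]) simp
qed

lemma norm_le_op_norm:
  fixes S :: "real^'d^'d"
  shows "(norm S)\<^sup>2 \<le> real CARD('d) * (op_norm S)\<^sup>2"
proof -
  have col: "(\<Sum>i\<in>UNIV. (S $ i $ j)\<^sup>2) \<le> (op_norm S)\<^sup>2" for j
  proof -
    have "(\<Sum>i\<in>UNIV. (S $ i $ j)\<^sup>2) = (norm (S *v axis j 1))\<^sup>2"
      by (simp add: matrix_vector_mult_basis norm_vec_def L2_set_def sum_nonneg column_def)
    also have "\<dots> \<le> (op_norm S * norm (axis j 1 :: real^'d))\<^sup>2"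
      by (intro power_mono norm_mult_le_op_norm) auto
    finally show ?thesis by simp
  qed
  have "(norm S)\<^sup>2 = (\<Sum>j\<in>UNIV. \<Sum>i\<in>UNIV. (S $ i $ j)\<^sup>2)"
    unfolding norm_matrix_sq by (rule sum.swap)
  also have "\<dots> \<le> (\<Sum>j\<in>(UNIV::'d set). (op_norm S)\<^sup>2)" by (intro sum_mono col)
  finally show ?thesis by simp
qed

lemma matrix_eq_0_iff: "(\<forall>x. D *v x = 0) \<longleftrightarrow> D = 0" for D :: "real^'n^'m"
  using matrix_eq[of D 0] by simp

lemma sym_square_eq_0:
  fixes D :: "real^'d^'d"
  assumes "transpose D = D" "D ** D = 0" shows "D = 0"
proof -
  have "(D *v x) \<bullet> (D *v x) = 0" for x
    using inner_matrix_commute[OF assms(1), of x "D *v x"] assms(2)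
    by (simp add: matrix_vector_mul_assoc)
  then show ?thesis using matrix_eq_0_iff by (metis inner_eq_zero_iff)
qed

lemma psd_trace:
  assumes "psd P" shows "0 \<le> trace P" "trace P = 0 \<Longrightarrow> P *v x = 0"
proof -
  have diag: "P $ i $ i = axis i 1 \<bullet> (P *v axis i 1)" for i
    by (simp add: inner_axis' matrix_vector_mult_basis column_def)
  then have nn: "0 \<le> P $ i $ i" for i using psd_nonneg[OF assms] by metis
  then show "0 \<le> trace P" by (simp add: trace_def sum_nonneg)
  assume "trace P = 0"
  then have "P $ i $ i = 0" for i using nn by (simp add: trace_def sum_nonneg_eq_0_iff)
  then have "P *v axis i 1 = 0" for i using diag psd_form_eq_0_imp[OF assms] by metis
  then have "column i P = 0" for i by (simp add: matrix_vector_mult_basis)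
  then show "P *v x = 0" by (simp add: matrix_mult_sum)
qed

lemma trace_commute: "trace (X ** Y) = trace (Y ** X)" for X Y :: "real^'d^'d"
  by (rule trace_mul_sym)

text \<open>Let \<open>D\<close> be the difference and \<open>T\<close> the sum of two square roots. Equality of the squares means that \<open>D\<close> and
\<open>T\<close> anticommute, so the positive semi-definite matrix \<open>D T D\<close> has the same trace as its negative. Hence it
vanishes, which kills both roots on the range of \<open>D\<close>, and \<open>D\<^sup>2 = 0\<close>.\<close>

lemma psd_sqrt_unique:
  assumes R: "psd R" and Q: "psd Q" and eq: "R ** R = Q ** Q"
  shows "R = Q"
proof -
  define D T where "D = R - Q" and "T = R + Q"
  have symD: "transpose D = D" and T: "psd T"
    using R Q by (auto simp: D_def T_def psd_def transpose_def vec_eq_iff matrix_vector_mult_add_rdistrib inner_add_right)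
  have eqv: "R *v (R *v x) = Q *v (Q *v x)" for x using eq by (metis matrix_vector_mul_assoc)
  have anti: "D ** T = - (T ** D)"
  proof -
    have "D *v (T *v x) + T *v (D *v x) = 0" for x
      by (simp add: D_def T_def algebra_simps eqv)
    then have "(D ** T + T ** D) *v x = 0" for x
      by (simp add: matrix_vector_mult_add_rdistrib flip: matrix_vector_mul_assoc)
    then show ?thesis using matrix_eq_0_iff eq_neg_iff_add_eq_0 by blast
  qed
  have P: "psd (D ** T ** D)"
  proof -
    have "transpose (D ** T ** D) = D ** T ** D"
      using symD psd_sym[OF T] by (simp add: matrix_transpose_mul matrix_mul_assoc)
    moreover have "x \<bullet> ((D ** T ** D) *v x) = (D *v x) \<bullet> (T *v (D *v x))" for x
      using inner_matrix_commute[OF symD, of x "T *v (D *v x)"] by (simp add: matrix_vector_mul_assoc matrix_mul_assoc)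
    ultimately show ?thesis using psd_nonneg[OF T] by (simp add: psd_def)
  qed
  have "trace (D ** T ** D) = - trace (T ** D ** D)"
    unfolding anti by (simp add: trace_def matrix_matrix_mult_def sum_negf)
  also have "trace (T ** D ** D) = trace (D ** T ** D)"
    by (metis matrix_mul_assoc trace_commute)
  finally have "trace (D ** T ** D) = 0" by simp
  then have z: "(D ** T ** D) *v x = 0" for x using psd_trace(2)[OF P] by blast
  have "D *v (D *v x) = 0" for x
  proof -
    let ?y = "D *v x"
    have "x \<bullet> ((D ** T ** D) *v x) = ?y \<bullet> (T *v ?y)"
      using inner_matrix_commute[OF symD, of x "T *v (D *v x)"] by (simp add: matrix_vector_mul_assoc matrix_mul_assoc)
    then have "?y \<bullet> (R *v ?y) + ?y \<bullet> (Q *v ?y) = 0"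
      using z by (simp add: T_def matrix_vector_mult_add_rdistrib inner_add_right)
    then have "?y \<bullet> (R *v ?y) = 0" "?y \<bullet> (Q *v ?y) = 0"
      using psd_nonneg[OF R, of ?y] psd_nonneg[OF Q, of ?y] by linarith+
    then have "R *v ?y = 0" "Q *v ?y = 0" using psd_form_eq_0_imp R Q by blast+
    then have "R *v ?y - Q *v ?y = 0" by simp
    then show ?thesis using D_def by (metis matrix_vector_mult_diff_rdistrib)
  qed
  then have "D ** D = 0" using matrix_eq_0_iff by (metis matrix_vector_mul_assoc)
  then show ?thesis using sym_square_eq_0[OF symD] by (simp add: D_def)
qed

definition outer :: "real^'d \<Rightarrow> real^'d^'d" where
  "outer b = (\<chi> i j. b $ i * b $ j)"

lemma outer_mult: "outer b *v x = (b \<bullet> x) *\<^sub>R b"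
proof -
  have "(outer b *v x) $ i = ((b \<bullet> x) *\<^sub>R b) $ i" for i
    unfolding outer_def matrix_vector_mult_def inner_vec_def by (simp add: sum_distrib_left mult_ac)
  then show ?thesis unfolding vec_eq_iff by blast
qed

lemma transpose_outer: "transpose (outer b) = outer b"
  unfolding outer_def transpose_def by (simp add: vec_eq_iff mult.commute)

text \<open>A maximiser \<open>b\<close> of the quadratic form on the unit sphere, with value \<open>l\<close>: then \<open>l I - S\<close> is positive
semi-definite and its form vanishes at \<open>b\<close>.\<close>

lemma psd_top_eigenvector:
  fixes S :: "real^'d^'d"
  assumes S: "psd S" and "S \<noteq> 0"
  obtains b l where "norm b = 1" "l > 0" "S *v b = l *\<^sub>R b"
proof -
  have cont: "continuous_on (sphere 0 1) (\<lambda>x. x \<bullet> (S *v x))"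
    by (intro continuous_intros matrix_vector_mult_linear_continuous_on)
  have "sphere (0::real^'d) 1 \<noteq> {}" by simp
  then have "\<exists>b\<in>sphere 0 1. \<forall>x\<in>sphere 0 1. x \<bullet> (S *v x) \<le> b \<bullet> (S *v b)"
    using cont by (intro continuous_attains_sup compact_sphere)
  then obtain b where b: "b \<in> sphere 0 1" and max: "\<forall>x\<in>sphere 0 1. x \<bullet> (S *v x) \<le> b \<bullet> (S *v b)" ..
  define l where "l = b \<bullet> (S *v b)"
  have le: "x \<bullet> (S *v x) \<le> l * (x \<bullet> x)" for x
  proof (cases "x = 0")
    case False
    have "(x /\<^sub>R norm x) \<bullet> (S *v (x /\<^sub>R norm x)) \<le> l"
      unfolding l_def by (rule bspec[OF max]) (use False in simp)
    then have "inverse (norm x) * (inverse (norm x) * (x \<bullet> (S *v x))) \<le> l"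
      by (simp add: matrix_vector_mult_scaleR)
    then have "(x \<bullet> (S *v x)) / (norm x)\<^sup>2 \<le> l" by (simp add: power2_eq_square divide_inverse mult_ac)
    then show ?thesis using False by (simp add: pos_divide_le_eq power2_norm_eq_inner)
  qed simp
  have bb: "b \<bullet> b = 1" using b by (simp flip: power2_norm_eq_inner)
  have "transpose (l *\<^sub>R mat 1 - S) = l *\<^sub>R mat 1 - S"
    using psd_sym[OF S] by (auto simp: transpose_def vec_eq_iff mat_def)
  then have "psd (l *\<^sub>R mat 1 - S)"
    using le by (simp add: psd_def matrix_vector_mult_diff_rdistrib inner_diff_right
        scaleR_matrix_vector_assoc[symmetric])
  moreover have "b \<bullet> ((l *\<^sub>R mat 1 - S) *v b) = 0"
    using bb by (simp add: l_def matrix_vector_mult_diff_rdistrib inner_diff_right scaleR_matrix_vector_assoc[symmetric])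
  ultimately have "(l *\<^sub>R mat 1 - S) *v b = 0" by (rule psd_form_eq_0_imp)
  then have "S *v b = l *\<^sub>R b"
    by (simp add: matrix_vector_mult_diff_rdistrib scaleR_matrix_vector_assoc[symmetric])
  moreover have "l > 0"
  proof (rule ccontr)
    assume "\<not> l > 0"
    then have "x \<bullet> (S *v x) = 0" for x
      using le[of x] psd_nonneg[OF S, of x] mult_nonpos_nonneg[of l "x \<bullet> x"] by simp
    then have "S *v x = 0" for x using psd_form_eq_0_imp[OF S] by blast
    then show False using matrix_eq_0_iff[of S] \<open>S \<noteq> 0\<close> by blast
  qed
  ultimately show ?thesis using b that by simp
qed

text \<open>Deflation: subtracting \<open>l b b\<^sup>T\<close> for a top eigenvector \<open>b\<close> leaves a positive semi-definite matrix with
a larger kernel. If \<open>R\<close> is a root of the remainder then \<open>R b = 0\<close>, so \<open>R + l\<^sup>1\<^sup>/\<^sup>2 b b\<^sup>T\<close> is a root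
of the original matrix.\<close>

lemma psd_sqrt_exists:
  fixes S :: "real^'d^'d"
  assumes "psd S"
  shows "\<exists>R. psd R \<and> R ** R = S"
  using assms
proof (induction "CARD('d) - dim {x. S *v x = 0}" arbitrary: S rule: less_induct)
  case less
  note S = \<open>psd S\<close>
  show ?case
  proof (cases "S = 0")
    case True
    then show ?thesis by (intro exI[of _ 0]) (simp add: psd_def transpose_def vec_eq_iff)
  next
    case False
    then obtain b l where b: "norm b = 1" and l: "l > 0" and eig: "S *v b = l *\<^sub>R b"
      using psd_top_eigenvector[OF S] by blast
    have bb: "b \<bullet> b = 1" using b by (simp flip: power2_norm_eq_inner)
    define S' where "S' = S - l *\<^sub>R outer b"
    have S'v: "S' *v x = S *v x - (l * (b \<bullet> x)) *\<^sub>R b" for x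
      by (simp add: S'_def matrix_vector_mult_diff_rdistrib scaleR_matrix_vector_assoc[symmetric] outer_mult)
    have bS: "b \<bullet> (S *v x) = l * (b \<bullet> x)" for x
      using inner_matrix_commute[OF psd_sym[OF S], of b x] eig by simp
    have S': "psd S'"
    proof -
      have "transpose S' = S'"
        using psd_sym[OF S] transpose_outer[of b] by (simp add: S'_def transpose_def vec_eq_iff)
      moreover have "0 \<le> x \<bullet> (S' *v x)" for x
      proof -
        have "(b \<bullet> (S *v x))\<^sup>2 \<le> l * (x \<bullet> (S *v x))"
          using psd_Cauchy_Schwarz[OF S, of b x] bb by (simp add: eig)
        then have "l * (l * (b \<bullet> x)\<^sup>2) \<le> l * (x \<bullet> (S *v x))"
          by (simp add: bS power2_eq_square mult_ac)
        then have "l * (b \<bullet> x)\<^sup>2 \<le> x \<bullet> (S *v x)" using l by simp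
        then show ?thesis
          by (simp add: S'v inner_diff_right inner_commute[of x b] power2_eq_square)
      qed
      ultimately show ?thesis by (simp add: psd_def)
    qed
    have S'b: "S' *v b = 0" by (simp add: S'v eig bb)
    have sub: "subspace {x. T *v x = 0}" for T :: "real^'d^'d"
      by (simp add: subspace_def matrix_vector_right_distrib matrix_vector_mult_scaleR)
    have "{x. S *v x = 0} \<subset> {x. S' *v x = 0}"
    proof
      show "{x. S *v x = 0} \<subseteq> {x. S' *v x = 0}"
      proof
        fix x assume "x \<in> {x. S *v x = 0}"
        then show "x \<in> {x. S' *v x = 0}" using bS[of x] l by (simp add: S'v)
      qed
      have "S *v b \<noteq> 0" using eig l b by auto
      then show "{x. S *v x = 0} \<noteq> {x. S' *v x = 0}" using S'b by blast
    qed
    then have "dim {x. S *v x = 0} < dim {x. S' *v x = 0}"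
      using sub by (intro dim_psubset) (simp add: span_eq_iff[THEN iffD2])
    moreover have "dim {x. S' *v x = 0} \<le> CARD('d)" using dim_subset_UNIV_cart by blast
    ultimately obtain R where R: "psd R" "R ** R = S'" using less.hyps[of S'] S' by fastforce
    have Rv: "R *v (R *v x) = S' *v x" for x using R(2) by (metis matrix_vector_mul_assoc)
    have "(R *v b) \<bullet> (R *v b) = 0"
      using inner_matrix_commute[OF psd_sym[OF R(1)], of b "R *v b"] by (simp add: Rv S'b)
    then have Rb: "R *v b = 0" by simp
    then have bR: "b \<bullet> (R *v x) = 0" for x
      using inner_matrix_commute[OF psd_sym[OF R(1)], of b x] by simp
    define Q where "Q = R + sqrt l *\<^sub>R outer b"
    have Qv: "Q *v x = R *v x + (sqrt l * (b \<bullet> x)) *\<^sub>R b" for x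
      by (simp add: Q_def matrix_vector_mult_add_rdistrib scaleR_matrix_vector_assoc[symmetric] outer_mult)
    have "psd Q"
    proof -
      have "transpose Q = Q"
        using psd_sym[OF R(1)] transpose_outer[of b] by (simp add: Q_def transpose_def vec_eq_iff)
      moreover have "0 \<le> x \<bullet> (Q *v x)" for x
        using psd_nonneg[OF R(1), of x] l by (simp add: Qv inner_add_right inner_commute[of x b] mult.assoc)
      ultimately show ?thesis by (simp add: psd_def)
    qed
    moreover have "Q *v (Q *v x) = S *v x" for x
      using l by (simp add: Qv matrix_vector_right_distrib matrix_vector_mult_scaleR Rv Rb bR inner_add_right bb S'v
          real_sqrt_mult_self flip: mult.assoc)
    then have "Q ** Q = S" by (simp add: matrix_eq flip: matrix_vector_mul_assoc)
    ultimately show ?thesis by blast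
  qed
qed

text \<open>From here on the square root is only seen through the quadratic form of the matrix itself.\<close>

lemma norm_psd_sqrt:
  assumes "psd S"
  shows "(norm (psd_sqrt S *v x))\<^sup>2 = x \<bullet> (S *v x)"
proof -
  have "\<exists>!R. psd R \<and> R ** R = S"
    using psd_sqrt_exists[OF assms] psd_sqrt_unique by metis
  then have R: "psd (psd_sqrt S)" "psd_sqrt S ** psd_sqrt S = S"
    unfolding psd_sqrt_def using theI'[of "\<lambda>R. psd R \<and> R ** R = S"] by auto
  have "(norm (psd_sqrt S *v x))\<^sup>2 = x \<bullet> (psd_sqrt S *v (psd_sqrt S *v x))"
    using inner_matrix_commute[OF psd_sym[OF R(1)], of x "psd_sqrt S *v x"] by (simp add: power2_norm_eq_inner)
  then show ?thesis using R(2) by (simp add: matrix_vector_mul_assoc)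
qed

section \<open>The standard Gaussian measure\<close>

lemma lborel_cart_prod:
  fixes f :: "'d::finite \<Rightarrow> real \<Rightarrow> real"
  assumes f: "\<And>i. integrable lborel (f i)"
  shows "integrable lborel (\<lambda>x::real^'d. \<Prod>i\<in>UNIV. f i (x $ i))"
    and "(\<integral>x. (\<Prod>i\<in>UNIV. f i (x $ i)) \<partial>(lborel :: (real^'d) measure)) = (\<Prod>i\<in>UNIV. (\<integral>x. f i x \<partial>lborel))"
proof -
  interpret product_sigma_finite "\<lambda>b::real^'d. lborel :: real measure" ..
  define g where "g b = f (axis_index b)" for b :: "real^'d"
  have m [measurable]: "f i \<in> borel_measurable borel" for i
    using borel_measurable_integrable[OF f[of i]] by simp
  have inj: "inj_on (\<lambda>i. axis i (1::real) :: real^'d) UNIV"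
    by (auto simp: inj_on_def axis_eq_axis)
  have Basis_eq: "(Basis :: (real^'d) set) = range (\<lambda>i. axis i 1)"
    by (auto simp: Basis_vec_def)
  have P: "(\<Prod>b\<in>(Basis :: (real^'d) set). G b) = (\<Prod>i\<in>UNIV. G (axis i 1))" for G :: "real^'d \<Rightarrow> real"
    unfolding Basis_eq by (subst prod.reindex[OF inj]) simp
  have eq: "(\<Prod>i\<in>UNIV. f i (x $ i)) = (\<Prod>b\<in>Basis. g b (x \<bullet> b))" for x :: "real^'d"
    unfolding P by (simp add: g_def axis_index_axis inner_axis)
  have fold: "(\<Prod>b\<in>(Basis::(real^'d) set). g b ((\<Sum>b\<in>Basis. v b *\<^sub>R b) \<bullet> b)) = (\<Prod>b\<in>(Basis::(real^'d) set). g b (v b))" for v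
    by (intro prod.cong) (auto simp: inner_sum_left_Basis)
  have mm [measurable]: "(\<lambda>x::real^'d. \<Prod>i\<in>UNIV. f i (x $ i)) \<in> borel_measurable borel"
    by measurable
  have mm2 [measurable]: "(\<lambda>v. \<Sum>b\<in>(Basis::(real^'d) set). v b *\<^sub>R b) \<in> Pi\<^sub>M Basis (\<lambda>b. lborel) \<rightarrow>\<^sub>M borel"
    by measurable
  have int: "integrable (Pi\<^sub>M (Basis::(real^'d) set) (\<lambda>b. lborel)) (\<lambda>v. \<Prod>b\<in>(Basis::(real^'d) set). g b (v b))"
    by (rule product_integrable_prod) (auto simp: g_def f)
  show "integrable lborel (\<lambda>x::real^'d. \<Prod>i\<in>UNIV. f i (x $ i))"
    by (subst lborel_eq, rule integrable_distr_eq[OF mm2 mm, THEN iffD2], unfold eq fold, rule int)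
  have "(\<integral>x. (\<Prod>i\<in>UNIV. f i (x $ i)) \<partial>(lborel :: (real^'d) measure))
     = (\<integral>v. (\<Prod>b\<in>(Basis::(real^'d) set). g b (v b)) \<partial>Pi\<^sub>M Basis (\<lambda>b. lborel))"
    by (subst lborel_eq, subst integral_distr[OF mm2 mm], unfold eq fold, rule refl)
  also have "\<dots> = (\<Prod>b\<in>(Basis::(real^'d) set). (\<integral>x. g b x \<partial>lborel))"
    by (rule product_integral_prod) (auto simp: g_def f)
  also have "\<dots> = (\<Prod>i\<in>UNIV. (\<integral>x. f i x \<partial>lborel))"
    unfolding P by (simp add: g_def axis_index_axis)
  finally show "(\<integral>x. (\<Prod>i\<in>UNIV. f i (x $ i)) \<partial>(lborel :: (real^'d) measure)) = (\<Prod>i\<in>UNIV. (\<integral>x. f i x \<partial>lborel))" .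
qed

definition gauss_density :: "real^'d \<Rightarrow> real" where
  "gauss_density w = (\<Prod>i\<in>UNIV. std_normal_density (w $ i))"

definition gaussian :: "(real^'d) measure" where
  "gaussian = density lborel (\<lambda>w. ennreal (gauss_density w))"

lemma gauss_density_nonneg [simp]: "0 \<le> gauss_density w"
  unfolding gauss_density_def by (intro prod_nonneg) simp

lemma gauss_density_measurable [measurable]: "gauss_density \<in> borel_measurable borel"
  unfolding gauss_density_def[abs_def] by measurable

lemma space_gaussian [simp]: "space gaussian = UNIV"
  and sets_gaussian [simp, measurable_cong]: "sets gaussian = sets borel"
  by (simp_all add: gaussian_def)

definition normal_moment :: "nat \<Rightarrow> real" where
  "normal_moment k = (\<integral>x. std_normal_density x * x ^ k \<partial>lborel)"

lemma normal_moment_vals [simp]: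
  "normal_moment 0 = 1" "normal_moment (Suc 0) = 0" "normal_moment 2 = 1" "normal_moment 3 = 0" "normal_moment 4 = 3"
  using integral_std_normal_moment_even[of 0] integral_std_normal_moment_odd[of 0]
    integral_std_normal_moment_even[of 1] integral_std_normal_moment_odd[of 1] integral_std_normal_moment_even[of 2]
  by (simp_all add: normal_moment_def fact_numeral)

lemma normal_moment_Suc:
  "normal_moment (Suc (Suc 0)) = 1" "normal_moment (Suc (Suc (Suc 0))) = 0"
  "normal_moment (Suc (Suc (Suc (Suc 0)))) = 3"
  using normal_moment_vals by (simp_all add: eval_nat_numeral)

lemma gaussian_monomial:
  fixes e :: "'d::finite \<Rightarrow> nat"
  shows "integrable gaussian (\<lambda>w::real^'d. \<Prod>i\<in>UNIV. (w $ i) ^ e i)"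
    and "(\<integral>w. (\<Prod>i\<in>UNIV. (w $ i) ^ e i) \<partial>gaussian) = (\<Prod>i\<in>UNIV. normal_moment (e i))"
proof -
  have eq: "gauss_density w * (\<Prod>i\<in>UNIV. (w $ i) ^ e i) = (\<Prod>i\<in>UNIV. std_normal_density (w $ i) * (w $ i) ^ e i)"
    for w :: "real^'d" by (simp add: gauss_density_def prod.distrib)
  note * = lborel_cart_prod[of "\<lambda>i x. std_normal_density x * x ^ e i", OF integrable_std_normal_moment]
  show "integrable gaussian (\<lambda>w::real^'d. \<Prod>i\<in>UNIV. (w $ i) ^ e i)"
    unfolding gaussian_def by (subst integrable_density) (use * in \<open>auto simp: eq\<close>)
  show "(\<integral>w. (\<Prod>i\<in>UNIV. (w $ i) ^ e i) \<partial>gaussian) = (\<Prod>i\<in>UNIV. normal_moment (e i))"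
    unfolding gaussian_def by (subst integral_density) (use * in \<open>auto simp: eq normal_moment_def\<close>)
qed

lemma prod_power_of_bool: "(\<Prod>m\<in>UNIV. (w $ m) ^ of_bool (m = i)) = w $ i" for w :: "real^'d"
  using prod.delta[of UNIV i "\<lambda>m. w $ m"] by (simp add: of_bool_def if_distrib cong: if_cong)

lemma prob_space_gaussian: "prob_space (gaussian :: (real^'d) measure)"
proof
  have "integrable gaussian (\<lambda>w::real^'d. 1::real)" and one: "(\<integral>w. 1 \<partial>(gaussian :: (real^'d) measure)) = (1::real)"
    using gaussian_monomial[of "\<lambda>_. 0"] by simp_all
  then have "emeasure (gaussian :: (real^'d) measure) UNIV \<noteq> \<infinity>"
    using integrable_iff_bounded by force
  then show "emeasure (gaussian :: (real^'d) measure) (space gaussian) = 1"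
    using one by (simp add: emeasure_eq_ennreal_measure)
qed

lemma gaussian_one [simp]: "measure (gaussian :: (real^'d) measure) UNIV = 1"
  using prob_space.prob_space[OF prob_space_gaussian] by simp

lemma gaussian_moment1:
  "integrable gaussian (\<lambda>w::real^'d. w $ i)" "(\<integral>w. w $ i \<partial>(gaussian :: (real^'d) measure)) = 0"
proof -
  let ?e = "\<lambda>m. of_bool (m = i) :: nat"
  have eq: "(\<Prod>m\<in>UNIV. (w $ m) ^ ?e m) = w $ i" for w :: "real^'d"
    by (simp only: prod_power_of_bool)
  have "(\<Prod>m\<in>UNIV. normal_moment (?e m)) = 0" by (intro prod_zero) auto
  then show "integrable gaussian (\<lambda>w::real^'d. w $ i)" "(\<integral>w. w $ i \<partial>(gaussian :: (real^'d) measure)) = 0"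
    using gaussian_monomial[of ?e] unfolding eq by simp_all
qed

lemma gaussian_moment2:
  "integrable gaussian (\<lambda>w::real^'d. w $ i * w $ j)"
  "(\<integral>w. w $ i * w $ j \<partial>(gaussian :: (real^'d) measure)) = of_bool (i = j)"
proof -
  let ?e = "\<lambda>m. of_bool (m = i) + of_bool (m = j) :: nat"
  have eq: "(\<Prod>m\<in>UNIV. (w $ m) ^ ?e m) = w $ i * w $ j" for w :: "real^'d"
    by (simp only: power_add prod.distrib prod_power_of_bool)
  have "(\<Prod>m\<in>UNIV. normal_moment (?e m)) = (\<Prod>m\<in>{i,j}. normal_moment (?e m))"
    by (rule prod.mono_neutral_right) auto
  also have "\<dots> = of_bool (i = j)" by (cases "i = j") (auto simp: normal_moment_Suc)
  finally show "integrable gaussian (\<lambda>w::real^'d. w $ i * w $ j)"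
     "(\<integral>w. w $ i * w $ j \<partial>(gaussian :: (real^'d) measure)) = of_bool (i = j)"
    using gaussian_monomial[of ?e] unfolding eq by simp_all
qed

lemma gaussian_moment3:
  "integrable gaussian (\<lambda>w::real^'d. w $ i * w $ j * w $ k)"
  "(\<integral>w. w $ i * w $ j * w $ k \<partial>(gaussian :: (real^'d) measure)) = 0"
proof -
  let ?e = "\<lambda>m. of_bool (m = i) + of_bool (m = j) + of_bool (m = k) :: nat"
  have eq: "(\<Prod>m\<in>UNIV. (w $ m) ^ ?e m) = w $ i * w $ j * w $ k" for w :: "real^'d"
    by (simp only: power_add prod.distrib prod_power_of_bool)
  have "\<exists>m\<in>UNIV. normal_moment (?e m) = 0"
    by (cases "i = j"; cases "j = k"; cases "i = k")
       (auto simp: normal_moment_Suc intro: exI[of _ i] exI[of _ j] exI[of _ k])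
  then have "(\<Prod>m\<in>UNIV. normal_moment (?e m)) = 0" by (intro prod_zero) auto
  then show "integrable gaussian (\<lambda>w::real^'d. w $ i * w $ j * w $ k)"
     "(\<integral>w. w $ i * w $ j * w $ k \<partial>(gaussian :: (real^'d) measure)) = 0"
    using gaussian_monomial[of ?e] unfolding eq by simp_all
qed

text \<open>Wick's formula: each coordinate contributes its own moment, and only index patterns that pair up give
something nonzero.\<close>

lemma gaussian_moment4:
  "integrable gaussian (\<lambda>w::real^'d. w $ i * w $ j * w $ k * w $ l)"
  "(\<integral>w. w $ i * w $ j * w $ k * w $ l \<partial>(gaussian :: (real^'d) measure)) =
    of_bool (i = j \<and> k = l) + of_bool (i = k \<and> j = l) + of_bool (i = l \<and> j = k)"
proof -
  let ?e = "\<lambda>m. of_bool (m = i) + of_bool (m = j) + of_bool (m = k) + of_bool (m = l) :: nat"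
  have eq: "(\<Prod>m\<in>UNIV. (w $ m) ^ ?e m) = w $ i * w $ j * w $ k * w $ l" for w :: "real^'d"
    by (simp only: power_add prod.distrib prod_power_of_bool)
  have "(\<Prod>m\<in>UNIV. normal_moment (?e m)) = (\<Prod>m\<in>{i,j,k,l}. normal_moment (?e m))"
    by (rule prod.mono_neutral_right) auto
  also have "\<dots> = of_bool (i = j \<and> k = l) + of_bool (i = k \<and> j = l) + of_bool (i = l \<and> j = k)"
    by (cases "i = j"; cases "i = k"; cases "i = l"; cases "j = k"; cases "j = l"; cases "k = l")
       (simp_all add: normal_moment_Suc insert_commute)
  finally show "integrable gaussian (\<lambda>w::real^'d. w $ i * w $ j * w $ k * w $ l)"
    "(\<integral>w. w $ i * w $ j * w $ k * w $ l \<partial>(gaussian :: (real^'d) measure)) =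
      of_bool (i = j \<and> k = l) + of_bool (i = k \<and> j = l) + of_bool (i = l \<and> j = k)"
    using gaussian_monomial[of ?e] unfolding eq by simp_all
qed

lemma quad_expand: "w \<bullet> (S *v w) = (\<Sum>i\<in>UNIV. \<Sum>j\<in>UNIV. S $ i $ j * (w $ i * w $ j))" for w :: "real^'d"
  unfolding inner_vec_def matrix_vector_mult_def by (simp add: sum_distrib_left mult_ac)

lemma quad_sq_expand:
  "(w \<bullet> (S *v w))\<^sup>2 = (\<Sum>k\<in>UNIV. \<Sum>l\<in>UNIV. \<Sum>i\<in>UNIV. \<Sum>j\<in>UNIV.
     (S $ k $ l * S $ i $ j) * (w $ k * w $ l * w $ i * w $ j))" for w :: "real^'d"
proof -
  have "(w \<bullet> (S *v w))\<^sup>2 = (\<Sum>k\<in>UNIV. \<Sum>l\<in>UNIV. S $ k $ l * (w $ k * w $ l)) * (w \<bullet> (S *v w))"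
    using quad_expand[of w S] by (simp add: power2_eq_square)
  also have "\<dots> = (\<Sum>k\<in>UNIV. \<Sum>l\<in>UNIV. S $ k $ l * (w $ k * w $ l) * (w \<bullet> (S *v w)))"
    by (simp only: sum_distrib_right)
  also have "\<dots> = (\<Sum>k\<in>UNIV. \<Sum>l\<in>UNIV. \<Sum>i\<in>UNIV. \<Sum>j\<in>UNIV.
     (S $ k $ l * S $ i $ j) * (w $ k * w $ l * w $ i * w $ j))"
    by (intro sum.cong refl) (simp add: quad_expand sum_distrib_left mult_ac)
  finally show ?thesis .
qed

lemma gaussian_linear:
  fixes u :: "real^'d"
  shows "integrable gaussian (\<lambda>w. u \<bullet> w)" "(\<integral>w. u \<bullet> w \<partial>gaussian) = 0"
    and "integrable gaussian (\<lambda>w. (u \<bullet> w)\<^sup>2)" "(\<integral>w. (u \<bullet> w)\<^sup>2 \<partial>gaussian) = (norm u)\<^sup>2"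
proof -
  have 1: "u \<bullet> w = (\<Sum>i\<in>UNIV. u $ i * w $ i)" for w by (simp add: inner_vec_def)
  have 2: "(u \<bullet> w)\<^sup>2 = (\<Sum>i\<in>UNIV. \<Sum>j\<in>UNIV. (u $ i * u $ j) * (w $ i * w $ j))" for w
    unfolding 1 power2_eq_square sum_product by (simp add: mult_ac)
  show "integrable gaussian (\<lambda>w. u \<bullet> w)" unfolding 1
    by (intro Bochner_Integration.integrable_sum integrable_mult_right gaussian_moment1)
  show "(\<integral>w. u \<bullet> w \<partial>gaussian) = 0" unfolding 1
    by (subst Bochner_Integration.integral_sum) (auto simp: gaussian_moment1)
  show "integrable gaussian (\<lambda>w. (u \<bullet> w)\<^sup>2)" unfolding 2
    by (intro Bochner_Integration.integrable_sum integrable_mult_right gaussian_moment2)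
  have "(\<integral>w. (u \<bullet> w)\<^sup>2 \<partial>gaussian) = (\<Sum>i\<in>UNIV. \<Sum>j\<in>UNIV. (u $ i * u $ j) * of_bool (i = j))"
    unfolding 2 by (simp add: Bochner_Integration.integral_sum gaussian_moment2)
  also have "\<dots> = (\<Sum>i\<in>UNIV. u $ i * u $ i)" by (simp add: of_bool_def if_distrib cong: if_cong)
  finally show "(\<integral>w. (u \<bullet> w)\<^sup>2 \<partial>gaussian) = (norm u)\<^sup>2"
    by (simp add: power2_norm_eq_inner inner_vec_def)
qed

lemma gaussian_quad:
  fixes S :: "real^'d^'d"
  shows "integrable gaussian (\<lambda>w. w \<bullet> (S *v w))" "(\<integral>w. w \<bullet> (S *v w) \<partial>gaussian) = trace S"
    and "integrable gaussian (\<lambda>w. (u \<bullet> w) * (w \<bullet> (S *v w)))" "(\<integral>w. (u \<bullet> w) * (w \<bullet> (S *v w)) \<partial>gaussian) = 0"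
    and "integrable gaussian (\<lambda>w. (w \<bullet> (S *v w))\<^sup>2)"
proof -
  show "integrable gaussian (\<lambda>w. w \<bullet> (S *v w))" unfolding quad_expand
    by (intro Bochner_Integration.integrable_sum integrable_mult_right gaussian_moment2)
  show "(\<integral>w. w \<bullet> (S *v w) \<partial>gaussian) = trace S"
    unfolding quad_expand
    by (simp add: Bochner_Integration.integral_sum gaussian_moment2 of_bool_def if_distrib trace_def cong: if_cong)
  have 3: "(u \<bullet> w) * (w \<bullet> (S *v w)) = (\<Sum>k\<in>UNIV. \<Sum>i\<in>UNIV. \<Sum>j\<in>UNIV. (u $ k * S $ i $ j) * (w $ k * w $ i * w $ j))" for w
    unfolding quad_expand inner_vec_def[of u w] sum_distrib_right by (simp add: sum_distrib_left mult_ac)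
  show "integrable gaussian (\<lambda>w. (u \<bullet> w) * (w \<bullet> (S *v w)))" unfolding 3
    by (intro Bochner_Integration.integrable_sum integrable_mult_right gaussian_moment3)
  show "(\<integral>w. (u \<bullet> w) * (w \<bullet> (S *v w)) \<partial>gaussian) = 0" unfolding 3
    by (simp add: Bochner_Integration.integral_sum gaussian_moment3)
  show "integrable gaussian (\<lambda>w. (w \<bullet> (S *v w))\<^sup>2)" unfolding quad_sq_expand
    by (intro Bochner_Integration.integrable_sum integrable_mult_right gaussian_moment4)
qed

text \<open>The variance \<open>2 \<parallel>S\<parallel>\<^sup>2\<close> of a Gaussian quadratic form is needed with its exact constant, since it enters the
factor \<open>2 + 3c\<close>. The norm of a matrix is its Hilbert--Schmidt norm.\<close>

lemma gaussian_quad_square: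
  fixes S :: "real^'d^'d"
  assumes "transpose S = S"
  shows "(\<integral>w. (w \<bullet> (S *v w))\<^sup>2 \<partial>gaussian) = (trace S)\<^sup>2 + 2 * (norm S)\<^sup>2"
proof -
  have sym: "S $ j $ i = S $ i $ j" for i j using assms by (metis transpose_def vec_lambda_beta)
  have i4: "integrable gaussian (\<lambda>w::real^'d. c * (w $ i * w $ j * w $ k * w $ l))" for c i j k l
    by (intro integrable_mult_right gaussian_moment4)
  have pick: "(\<Sum>i\<in>UNIV. \<Sum>j\<in>UNIV. x i j * of_bool (k = i \<and> l = j)) = x k l"
    and pick': "(\<Sum>i\<in>UNIV. \<Sum>j\<in>UNIV. x i j * of_bool (k = j \<and> l = i)) = x l k"
    for x :: "'d \<Rightarrow> 'd \<Rightarrow> real" and k l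
  proof -
    have "(\<Sum>j\<in>UNIV. x i j * of_bool (k = i \<and> l = j)) = (if k = i then x i l else 0)"
      "(\<Sum>j\<in>UNIV. x i j * of_bool (k = j \<and> l = i)) = (if l = i then x i k else 0)" for i
      by (auto simp: of_bool_def if_distrib cong: if_cong)
    then show "(\<Sum>i\<in>UNIV. \<Sum>j\<in>UNIV. x i j * of_bool (k = i \<and> l = j)) = x k l"
      "(\<Sum>i\<in>UNIV. \<Sum>j\<in>UNIV. x i j * of_bool (k = j \<and> l = i)) = x l k" by simp_all
  qed
  let ?T = "\<lambda>f. \<Sum>k\<in>(UNIV::'d set). \<Sum>l\<in>(UNIV::'d set). \<Sum>i\<in>(UNIV::'d set). \<Sum>j\<in>(UNIV::'d set). S $ k $ l * S $ i $ j * of_bool (f k l i j) :: real"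
  have "(\<integral>w. (w \<bullet> (S *v w))\<^sup>2 \<partial>gaussian) =
    (\<Sum>k\<in>UNIV. \<Sum>l\<in>UNIV. \<Sum>i\<in>UNIV. \<Sum>j\<in>UNIV. (S $ k $ l * S $ i $ j) *
      (of_bool (k = l \<and> i = j) + of_bool (k = i \<and> l = j) + of_bool (k = j \<and> l = i)))"
    unfolding quad_sq_expand by (simp add: Bochner_Integration.integral_sum i4 Bochner_Integration.integrable_sum gaussian_moment4)
  also have "\<dots> = ?T (\<lambda>k l i j. k = l \<and> i = j) + ?T (\<lambda>k l i j. k = i \<and> l = j) + ?T (\<lambda>k l i j. k = j \<and> l = i)"
    by (simp add: distrib_left sum.distrib)
  also have "?T (\<lambda>k l i j. k = l \<and> i = j) = (trace S)\<^sup>2"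
  proof -
    have tr: "(\<Sum>i\<in>UNIV. \<Sum>j\<in>UNIV. S $ i $ j * of_bool (i = j)) = trace S"
      by (simp add: trace_def of_bool_def if_distrib cong: if_cong)
    have "?T (\<lambda>k l i j. k = l \<and> i = j) = (\<Sum>k\<in>UNIV. \<Sum>l\<in>UNIV. (S $ k $ l * of_bool (k = l)) * trace S)"
      unfolding tr[symmetric] sum_distrib_left by (intro sum.cong refl) (simp add: of_bool_conj)
    then show ?thesis by (simp only: sum_distrib_right[symmetric] tr power2_eq_square)
  qed
  also have "?T (\<lambda>k l i j. k = i \<and> l = j) = (norm S)\<^sup>2"
    unfolding norm_matrix_sq pick by (simp add: power2_eq_square)
  also have "?T (\<lambda>k l i j. k = j \<and> l = i) = (norm S)\<^sup>2"
    unfolding norm_matrix_sq pick' by (simp add: power2_eq_square sym)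
  finally show ?thesis by simp
qed

lemma gaussian_norm_mult:
  fixes S :: "real^'d^'d"
  shows "integrable gaussian (\<lambda>w. (norm (S *v w))\<^sup>2)" "(\<integral>w. (norm (S *v w))\<^sup>2 \<partial>gaussian) = (norm S)\<^sup>2"
proof -
  have eq: "(norm (S *v w))\<^sup>2 = (\<Sum>i\<in>UNIV. ((S $ i) \<bullet> w)\<^sup>2)" for w
    by (simp add: norm_vec_def[of "S *v w"] L2_set_def sum_nonneg matrix_vector_mul_component)
  show "integrable gaussian (\<lambda>w. (norm (S *v w))\<^sup>2)" unfolding eq
    by (intro Bochner_Integration.integrable_sum gaussian_linear)
  show "(\<integral>w. (norm (S *v w))\<^sup>2 \<partial>gaussian) = (norm S)\<^sup>2" unfolding eq
    by (simp add: Bochner_Integration.integral_sum gaussian_linear norm_vec_def[of S] L2_set_def sum_nonneg)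
qed

text \<open>The Cameron--Martin formula.\<close>

lemma gaussian_shift:
  fixes f :: "real^'d \<Rightarrow> ennreal"
  assumes [measurable]: "f \<in> borel_measurable borel"
  shows "(\<integral>\<^sup>+w. f w \<partial>gaussian) = (\<integral>\<^sup>+w. f (w + u) * ennreal (exp (- (u \<bullet> w) - (norm u)\<^sup>2 / 2)) \<partial>gaussian)"
proof -
  have dens: "gauss_density (w + u) = gauss_density w * exp (- (u \<bullet> w) - (norm u)\<^sup>2 / 2)" for w :: "real^'d"
  proof -
    have "std_normal_density (w $ i + u $ i) = std_normal_density (w $ i) * exp (- (u $ i * w $ i) - (u $ i)\<^sup>2 / 2)" for i
      by (simp add: std_normal_density_def power2_sum field_simps flip: exp_add)
    then have "gauss_density (w + u) = gauss_density w * exp (\<Sum>i\<in>UNIV. - (u $ i * w $ i) - (u $ i)\<^sup>2 / 2)"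
      by (simp add: gauss_density_def prod.distrib exp_sum)
    then show ?thesis
      by (simp add: inner_vec_def norm_vec_def L2_set_def sum_nonneg sum_subtractf sum_negf sum_divide_distrib)
  qed
  have "(\<integral>\<^sup>+w. f w \<partial>gaussian) = (\<integral>\<^sup>+w. ennreal (gauss_density w) * f w \<partial>lborel)"
    unfolding gaussian_def by (subst nn_integral_density) auto
  also have "\<dots> = (\<integral>\<^sup>+w. ennreal (gauss_density w) * f w \<partial>distr lborel borel ((+) u))"
    by (simp add: lborel_distr_plus)
  also have "\<dots> = (\<integral>\<^sup>+w. ennreal (gauss_density (w + u)) * f (w + u) \<partial>lborel)"
    by (subst nn_integral_distr) (auto simp: add.commute)
  also have "\<dots> = (\<integral>\<^sup>+w. ennreal (gauss_density w) * (f (w + u) * ennreal (exp (- (u \<bullet> w) - (norm u)\<^sup>2 / 2))) \<partial>lborel)"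
    unfolding dens by (intro nn_integral_cong) (simp add: ennreal_mult' mult_ac)
  also have "\<dots> = (\<integral>\<^sup>+w. f (w + u) * ennreal (exp (- (u \<bullet> w) - (norm u)\<^sup>2 / 2)) \<partial>gaussian)"
    unfolding gaussian_def by (subst nn_integral_density) auto
  finally show ?thesis .
qed

text \<open>The variational inequality between relative entropy and log-Laplace transform for a translated
Gaussian, whose relative entropy is \<open>\<parallel>u\<parallel>\<^sup>2/2\<close>.\<close>

lemma gaussian_donsker_varadhan:
  fixes g :: "real^'d \<Rightarrow> real"
  assumes [measurable]: "g \<in> borel_measurable borel"
    and int: "integrable gaussian (\<lambda>w. g (w + u))"
  shows "ennreal (exp ((\<integral>w. g (w + u) \<partial>gaussian) - (norm u)\<^sup>2 / 2)) \<le> (\<integral>\<^sup>+w. ennreal (exp (g w)) \<partial>gaussian)"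
proof -
  interpret prob_space "gaussian :: (real^'d) measure" by (rule prob_space_gaussian)
  define a where "a = (\<integral>w. g (w + u) \<partial>gaussian) - (norm u)\<^sup>2 / 2"
  define X where "X w = g (w + u) + (- (u \<bullet> w) - (norm u)\<^sup>2 / 2)" for w
  have X: "integrable gaussian X" "(\<integral>w. X w \<partial>gaussian) = a"
    unfolding X_def a_def using int gaussian_linear[of u] by (auto simp: prob_space)
  let ?\<phi> = "\<lambda>w. exp a * (1 + (X w - a))"
  have \<phi>: "integrable gaussian ?\<phi>" "(\<integral>w. ?\<phi> w \<partial>gaussian) = exp a"
    using X by (auto simp: prob_space)
  have "exp a = (\<integral>w. ?\<phi> w \<partial>gaussian)" using \<phi> by simp
  also have "\<dots> \<le> (\<integral>w. max 0 (?\<phi> w) \<partial>gaussian)"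
    using \<phi> by (intro integral_mono) auto
  finally have "ennreal (exp a) \<le> ennreal (\<integral>w. max 0 (?\<phi> w) \<partial>gaussian)" by (rule ennreal_leI)
  also have "\<dots> = (\<integral>\<^sup>+w. ennreal (max 0 (?\<phi> w)) \<partial>gaussian)"
    using \<phi> by (intro nn_integral_eq_integral[symmetric]) auto
  also have "\<dots> \<le> (\<integral>\<^sup>+w. ennreal (exp (X w)) \<partial>gaussian)"
  proof (intro nn_integral_mono ennreal_leI)
    fix w
    have "exp a * (1 + (X w - a)) \<le> exp a * exp (X w - a)" by (intro mult_left_mono) auto
    also have "\<dots> = exp (X w)" by (simp flip: exp_add)
    finally show "max 0 (?\<phi> w) \<le> exp (X w)" by simp
  qed
  also have "\<dots> = (\<integral>\<^sup>+w. ennreal (exp (g w)) \<partial>gaussian)"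
    by (subst gaussian_shift[of _ u]) (auto simp: X_def exp_add ennreal_mult')
  finally show ?thesis by (simp add: a_def)
qed

lemma gaussian_uminus:
  fixes f :: "real^'d \<Rightarrow> ennreal"
  assumes [measurable]: "f \<in> borel_measurable borel"
  shows "(\<integral>\<^sup>+w. f (- w) \<partial>gaussian) = (\<integral>\<^sup>+w. f w \<partial>gaussian)"
proof -
  have "distr lborel borel uminus = (lborel :: (real^'d) measure)"
    using lborel_affine[of "-1" "0 :: real^'d"] by (simp add: density_1)
  then have "(\<integral>\<^sup>+w. f w \<partial>gaussian) = (\<integral>\<^sup>+w. ennreal (gauss_density w) * f w \<partial>distr lborel borel uminus)"
    unfolding gaussian_def by (subst nn_integral_density) auto
  also have "\<dots> = (\<integral>\<^sup>+w. ennreal (gauss_density (- w)) * f (- w) \<partial>lborel)"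
    by (subst nn_integral_distr) auto
  also have "\<dots> = (\<integral>\<^sup>+w. f (- w) \<partial>gaussian)"
    unfolding gaussian_def by (subst nn_integral_density) (auto simp: gauss_density_def std_normal_density_def)
  finally show ?thesis ..
qed

section \<open>Gaussian smoothing of the influence function\<close>

text \<open>For \<open>\<theta>' = \<theta> + \<tau> w\<close> with a standard Gaussian \<open>w\<close>, the mean of \<open>\<theta>'\<^sup>T S \<theta>'\<close> exceeds \<open>\<theta>\<^sup>T S \<theta>\<close> by
\<open>\<tau>\<^sup>2 Tr(S)\<close>; subtracting this makes the mean of \<open>centred_form\<close> equal to \<open>\<theta>\<^sup>T S \<theta> - l\<close>. In the application
\<open>\<tau>\<^sup>2 = 1/\<beta>\<close>.\<close>

definition centred_form :: "real \<Rightarrow> real \<Rightarrow> real^'d^'d \<Rightarrow> real^'d \<Rightarrow> real" where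
  "centred_form \<tau> l S \<theta> = \<theta> \<bullet> (S *v \<theta>) - \<tau>\<^sup>2 * trace S - l"

text \<open>For symmetric \<open>S\<close> this is a quarter of the variance of \<open>centred_form\<close> at \<open>\<theta> + \<tau> w\<close>. It is kept as a function
of \<open>\<theta>\<close> because it will itself be averaged over the perturbation.\<close>

definition noise_cost :: "real \<Rightarrow> real^'d^'d \<Rightarrow> real^'d \<Rightarrow> real" where
  "noise_cost \<tau> S \<theta> = \<tau>\<^sup>2 * (norm (S *v \<theta>))\<^sup>2 + \<tau> ^ 4 * (norm S)\<^sup>2 / 2"

text \<open>The quantity whose logarithm dominates \<open>\<psi>\<close> on average. The sign \<open>s\<close> selects an upper bound (\<open>1\<close>) or a
lower bound (\<open>-1\<close>) for the criterion.\<close>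

definition laplace_factor :: "real \<Rightarrow> real \<Rightarrow> real \<Rightarrow> real^'d^'d \<Rightarrow> real^'d \<Rightarrow> real" where
  "laplace_factor s \<tau> l S \<theta> = 1 + s * centred_form \<tau> l S \<theta> + (centred_form \<tau> l S \<theta>)\<^sup>2 / 2 + c_const * noise_cost \<tau> S \<theta>"

lemma c_const_pos: "c_const > 0"
  unfolding c_const_eq_exp_cap by simp

lemma noise_cost_nonneg: "0 \<le> noise_cost \<tau> S \<theta>"
  by (simp add: noise_cost_def)

lemma laplace_factor_ge_half: "1 / 2 \<le> laplace_factor s \<tau> l S \<theta>" if "s = 1 \<or> s = -1"
proof -
  have "0 \<le> c_const * noise_cost \<tau> S \<theta>" using c_const_pos noise_cost_nonneg[of \<tau> S \<theta>] by simp
  then show ?thesis unfolding laplace_factor_def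
    using quad_ge_half[of "centred_form \<tau> l S \<theta>"] that by auto
qed

lemma continuous_matrix_vector:
  "continuous_on UNIV (\<lambda>p::(real^'n^'m) \<times> (real^'n). fst p *v snd p)"
  unfolding matrix_vector_mult_def by (intro continuous_on_vec_lambda continuous_intros)

lemma measurable_matrix_vector [measurable (raw)]:
  fixes f :: "'a \<Rightarrow> real^'n^'m"
  assumes [measurable]: "f \<in> borel_measurable M" "g \<in> borel_measurable M"
  shows "(\<lambda>x. f x *v g x) \<in> borel_measurable M"
proof -
  have "(\<lambda>p::(real^'n^'m) \<times> (real^'n). fst p *v snd p) \<in> borel_measurable borel"
    by (rule borel_measurable_continuous_onI[OF continuous_matrix_vector])
  moreover have "(\<lambda>x. (f x, g x)) \<in> borel_measurable M" by measurable
  ultimately have "(\<lambda>x. (\<lambda>p. fst p *v snd p) (f x, g x)) \<in> borel_measurable M"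
    by (rule measurable_compose[rotated])
  then show ?thesis by simp
qed

lemma measurable_trace [measurable (raw)]:
  fixes f :: "'a \<Rightarrow> real^'n^'n"
  assumes [measurable]: "f \<in> borel_measurable M"
  shows "(\<lambda>x. trace (f x)) \<in> borel_measurable M"
proof -
  have "continuous_on UNIV (trace :: real^'n^'n \<Rightarrow> real)"
    unfolding trace_def[abs_def] by (intro continuous_intros)
  then show ?thesis using assms borel_measurable_continuous_onI measurable_compose by blast
qed

lemma measurable_laplace_factor [measurable (raw)]:
  assumes [measurable]: "f \<in> borel_measurable M" "g \<in> borel_measurable M"
  shows "(\<lambda>x. laplace_factor s \<tau> l (f x) (g x)) \<in> borel_measurable M"
  unfolding laplace_factor_def centred_form_def noise_cost_def by measurable

lemma measurable_psi_top [measurable]: "psi_top \<in> borel_measurable borel"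
  unfolding psi_top_def[abs_def] by measurable

lemma centred_form_shift:
  assumes sym: "transpose S = S"
  shows "centred_form \<tau> l S (\<theta> + \<tau> *\<^sub>R w) =
    (\<theta> \<bullet> (S *v \<theta>) - l) + (2 * \<tau> * ((S *v \<theta>) \<bullet> w) + \<tau>\<^sup>2 * (w \<bullet> (S *v w) - trace S))"
proof -
  have 1: "\<theta> \<bullet> (S *v w) = (S *v \<theta>) \<bullet> w" by (rule inner_matrix_commute[OF sym])
  have 2: "w \<bullet> (S *v \<theta>) = (S *v \<theta>) \<bullet> w" by (rule inner_commute)
  have "(\<theta> + \<tau> *\<^sub>R w) \<bullet> (S *v (\<theta> + \<tau> *\<^sub>R w)) =
      \<theta> \<bullet> (S *v \<theta>) + \<tau> * (\<theta> \<bullet> (S *v w)) + \<tau> * (w \<bullet> (S *v \<theta>)) + \<tau>\<^sup>2 * (w \<bullet> (S *v w))"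
    by (simp add: matrix_vector_right_distrib matrix_vector_mult_scaleR inner_add_left inner_add_right power2_eq_square
        distrib_left)
  then show ?thesis unfolding centred_form_def 1 2 by (simp add: right_diff_distrib)
qed

lemma noise_cost_shift:
  assumes sym: "transpose S = S"
  shows "noise_cost \<tau> S (\<theta> + \<tau> *\<^sub>R w) =
    noise_cost \<tau> S \<theta> + \<tau>\<^sup>2 * (2 * \<tau> * ((S *v (S *v \<theta>)) \<bullet> w) + \<tau>\<^sup>2 * (norm (S *v w))\<^sup>2)"
proof -
  have 1: "(S *v (S *v \<theta>)) \<bullet> w = (S *v \<theta>) \<bullet> (S *v w)"
    by (rule inner_matrix_commute[OF sym, symmetric])
  have 2: "(S *v w) \<bullet> (S *v \<theta>) = (S *v \<theta>) \<bullet> (S *v w)" by (rule inner_commute)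
  have "(S *v (\<theta> + \<tau> *\<^sub>R w)) \<bullet> (S *v (\<theta> + \<tau> *\<^sub>R w)) =
      (S *v \<theta>) \<bullet> (S *v \<theta>) + \<tau> * ((S *v \<theta>) \<bullet> (S *v w)) + \<tau> * ((S *v w) \<bullet> (S *v \<theta>))
        + \<tau>\<^sup>2 * ((S *v w) \<bullet> (S *v w))"
    by (simp add: matrix_vector_right_distrib matrix_vector_mult_scaleR inner_add_left inner_add_right
        power2_eq_square distrib_left)
  then show ?thesis unfolding noise_cost_def power2_norm_eq_inner 1 2 by (simp add: distrib_left)
qed

lemma gaussian_fluctuation:
  fixes S :: "real^'d^'d" and u :: "real^'d" and \<tau> :: real
  assumes sym: "transpose S = S"
  defines "Y \<equiv> \<lambda>w. 2 * \<tau> * (u \<bullet> w) + \<tau>\<^sup>2 * (w \<bullet> (S *v w) - trace S)"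
  shows "integrable gaussian Y" "(\<integral>w. Y w \<partial>gaussian) = 0"
    "integrable gaussian (\<lambda>w. (Y w)\<^sup>2)"
    "(\<integral>w. (Y w)\<^sup>2 \<partial>gaussian) = 4 * \<tau>\<^sup>2 * (norm u)\<^sup>2 + 2 * \<tau> ^ 4 * (norm S)\<^sup>2"
proof -
  interpret prob_space "gaussian :: (real^'d) measure" by (rule prob_space_gaussian)
  show "integrable gaussian Y" "(\<integral>w. Y w \<partial>gaussian) = 0"
    unfolding Y_def by (auto simp: gaussian_linear gaussian_quad)
  have sq: "(Y w)\<^sup>2 = 4 * \<tau>\<^sup>2 * (u \<bullet> w)\<^sup>2 + 4 * \<tau> ^ 3 * ((u \<bullet> w) * (w \<bullet> (S *v w)))
      - 4 * \<tau> ^ 3 * trace S * (u \<bullet> w) + \<tau> ^ 4 * (w \<bullet> (S *v w))\<^sup>2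
      - 2 * \<tau> ^ 4 * trace S * (w \<bullet> (S *v w)) + \<tau> ^ 4 * (trace S)\<^sup>2" for w
    unfolding Y_def by (simp add: power2_eq_square power3_eq_cube power4_eq_xxxx algebra_simps)
  show "integrable gaussian (\<lambda>w. (Y w)\<^sup>2)" unfolding sq
    by (intro Bochner_Integration.integrable_add Bochner_Integration.integrable_diff integrable_mult_right
        gaussian_linear gaussian_quad) auto
  have "(\<integral>w. (Y w)\<^sup>2 \<partial>gaussian) = 4 * \<tau>\<^sup>2 * (norm u)\<^sup>2 + \<tau> ^ 4 * ((trace S)\<^sup>2 + 2 * (norm S)\<^sup>2)
      - 2 * \<tau> ^ 4 * trace S * trace S + \<tau> ^ 4 * (trace S)\<^sup>2"
    unfolding sq by (simp add: gaussian_linear gaussian_quad gaussian_quad_square[OF sym])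
  then show "(\<integral>w. (Y w)\<^sup>2 \<partial>gaussian) = 4 * \<tau>\<^sup>2 * (norm u)\<^sup>2 + 2 * \<tau> ^ 4 * (norm S)\<^sup>2"
    by (simp add: power2_eq_square algebra_simps)
qed

text \<open>The variance of \<open>centred_form\<close> gives \<open>2\<close> in \<open>2 + c\<close> and in \<open>2 + 3c\<close>; the correction contributes \<open>c\<close> and
\<open>3c\<close>, as averaging \<open>noise_cost\<close> adds \<open>\<tau>\<^sup>4 \<parallel>S\<parallel>\<^sup>2\<close> to it.\<close>

lemma laplace_factor_gaussian:
  fixes S :: "real^'d^'d"
  assumes sym: "transpose S = S"
  shows "integrable gaussian (\<lambda>w. laplace_factor s \<tau> l S (\<theta> + \<tau> *\<^sub>R w))"
    "(\<integral>w. laplace_factor s \<tau> l S (\<theta> + \<tau> *\<^sub>R w) \<partial>gaussian) =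
      1 + s * (\<theta> \<bullet> (S *v \<theta>) - l) + (\<theta> \<bullet> (S *v \<theta>) - l)\<^sup>2 / 2
        + (2 + c_const) * \<tau>\<^sup>2 * (norm (S *v \<theta>))\<^sup>2 + (2 + 3 * c_const) / 2 * \<tau> ^ 4 * (norm S)\<^sup>2"
proof -
  interpret prob_space "gaussian :: (real^'d) measure" by (rule prob_space_gaussian)
  define m where "m = \<theta> \<bullet> (S *v \<theta>) - l"
  define Y where "Y w = 2 * \<tau> * ((S *v \<theta>) \<bullet> w) + \<tau>\<^sup>2 * (w \<bullet> (S *v w) - trace S)" for w
  note Y = gaussian_fluctuation[OF sym, of \<tau> "S *v \<theta>", folded Y_def]
  have eq: "laplace_factor s \<tau> l S (\<theta> + \<tau> *\<^sub>R w) = (1 + s * m + m\<^sup>2 / 2 + c_const * noise_cost \<tau> S \<theta>)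
     + (s + m) * Y w + (1 / 2) * (Y w)\<^sup>2
     + c_const * (\<tau>\<^sup>2 * (2 * \<tau> * ((S *v (S *v \<theta>)) \<bullet> w) + \<tau>\<^sup>2 * (norm (S *v w))\<^sup>2))" for w
    unfolding laplace_factor_def centred_form_shift[OF sym] noise_cost_shift[OF sym] m_def[symmetric] Y_def[symmetric]
    by (simp add: power2_eq_square field_simps)
  show "integrable gaussian (\<lambda>w. laplace_factor s \<tau> l S (\<theta> + \<tau> *\<^sub>R w))"
    unfolding eq
    by (intro Bochner_Integration.integrable_add integrable_mult_right Y gaussian_linear gaussian_norm_mult) auto
  have "(\<integral>w. laplace_factor s \<tau> l S (\<theta> + \<tau> *\<^sub>R w) \<partial>gaussian) = (1 + s * m + m\<^sup>2 / 2 + c_const * noise_cost \<tau> S \<theta>)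
     + (1 / 2) * (4 * \<tau>\<^sup>2 * (norm (S *v \<theta>))\<^sup>2 + 2 * \<tau> ^ 4 * (norm S)\<^sup>2) + c_const * (\<tau>\<^sup>2 * (\<tau>\<^sup>2 * (norm S)\<^sup>2))"
    unfolding eq by (simp add: Y gaussian_linear gaussian_norm_mult)
  then show "(\<integral>w. laplace_factor s \<tau> l S (\<theta> + \<tau> *\<^sub>R w) \<partial>gaussian) =
      1 + s * (\<theta> \<bullet> (S *v \<theta>) - l) + (\<theta> \<bullet> (S *v \<theta>) - l)\<^sup>2 / 2
        + (2 + c_const) * \<tau>\<^sup>2 * (norm (S *v \<theta>))\<^sup>2 + (2 + 3 * c_const) / 2 * \<tau> ^ 4 * (norm S)\<^sup>2"
    unfolding m_def[symmetric] by (simp add: noise_cost_def power2_eq_square power4_eq_xxxx field_simps)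
qed

lemma integrable_ln_between:
  fixes f :: "'a \<Rightarrow> real"
  assumes "prob_space P" and int: "integrable P f" and ge: "\<And>w. 1 / 2 \<le> f w"
  shows "integrable P (\<lambda>w. ln (f w))"
proof (rule Bochner_Integration.integrable_bound[of P "\<lambda>w. ln 2 + f w"])
  interpret prob_space P by fact
  have [measurable]: "f \<in> borel_measurable P" using int by simp
  show "integrable P (\<lambda>w. ln 2 + f w)" using int by simp
  show "(\<lambda>w. ln (f w)) \<in> borel_measurable P" by measurable
  have "norm (ln (f w)) \<le> norm (ln 2 + f w)" for w
  proof -
    have "ln (1 / 2) \<le> ln (f w)" using ge[of w] by (subst ln_le_cancel_iff) auto
    moreover have "ln (f w) \<le> f w - 1" using ge[of w] by (intro ln_le_minus_one) auto
    moreover have "(0::real) < ln 2" "ln (1 / 2) = - ln (2::real)" by (simp_all add: ln_div)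
    ultimately show ?thesis using ge[of w] unfolding real_norm_def by linarith
  qed
  then show "AE w in P. norm (ln (f w)) \<le> norm (ln 2 + f w)" by simp
qed

text \<open>Of \<open>\<theta> + \<tau> w\<close> and \<open>\<theta> - \<tau> w\<close> at least one has a cost no smaller than that of \<open>\<theta>\<close>, and the two have the same law. So
the cost at the unperturbed point can be paid by an average over perturbed points.\<close>

lemma half_min_le_gaussian:
  fixes S :: "real^'d^'d"
  assumes k: "0 \<le> k"
  shows "min k (noise_cost \<tau> S \<theta>) / 2 \<le> (\<integral>w. min k (noise_cost \<tau> S (\<theta> + \<tau> *\<^sub>R w)) \<partial>gaussian)"
proof -
  interpret prob_space "gaussian :: (real^'d) measure" by (rule prob_space_gaussian)
  define y where "y w = noise_cost \<tau> S (\<theta> + \<tau> *\<^sub>R w)" for w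
  have m [measurable]: "y \<in> borel_measurable borel" unfolding y_def noise_cost_def by measurable
  have y0: "0 \<le> y w" for w by (simp add: y_def noise_cost_nonneg)
  have int: "integrable gaussian (\<lambda>w. min k (y w))"
    by (rule integrable_const_bound[of _ k]) (use k y0 in auto)
  have int': "integrable gaussian (\<lambda>w. min k (y (- w)))"
    by (rule integrable_const_bound[of _ k]) (use k y0 in auto)
  have flip: "(\<integral>w. min k (y (- w)) \<partial>gaussian) = (\<integral>w. min k (y w) \<partial>gaussian)"
    by (subst (1 2) integral_eq_nn_integral)
       (use k y0 gaussian_uminus[of "\<lambda>w. ennreal (min k (y w))"] in auto)
  have pt: "min k (noise_cost \<tau> S \<theta>) \<le> min k (y w) + min k (y (- w))" for w
  proof -
    have "0 \<le> \<tau> * (\<tau> * ((S *v w) \<bullet> (S *v w)))" by (simp flip: mult.assoc)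
    then have "2 * (norm (S *v \<theta>))\<^sup>2 \<le> (norm (S *v (\<theta> + \<tau> *\<^sub>R w)))\<^sup>2 + (norm (S *v (\<theta> + \<tau> *\<^sub>R (- w))))\<^sup>2"
      by (simp add: matrix_vector_right_distrib matrix_vector_mult_scaleR matrix_vector_mult_diff_distrib
          power2_norm_eq_inner inner_add_left inner_add_right inner_diff_left inner_diff_right inner_commute)
    then have "\<tau>\<^sup>2 * (2 * (norm (S *v \<theta>))\<^sup>2) \<le> \<tau>\<^sup>2 * ((norm (S *v (\<theta> + \<tau> *\<^sub>R w)))\<^sup>2 + (norm (S *v (\<theta> + \<tau> *\<^sub>R (- w))))\<^sup>2)"
      by (intro mult_left_mono) auto
    then have "2 * noise_cost \<tau> S \<theta> \<le> y w + y (- w)"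
      unfolding y_def noise_cost_def by (simp add: algebra_simps)
    moreover have "0 \<le> y w" "0 \<le> y (- w)" by (simp_all add: y_def noise_cost_nonneg)
    ultimately show ?thesis using k by (auto simp: min_def)
  qed
  have "min k (noise_cost \<tau> S \<theta>) = (\<integral>w. min k (noise_cost \<tau> S \<theta>) \<partial>(gaussian :: (real^'d) measure))"
    by simp
  also have "\<dots> \<le> (\<integral>w. min k (y w) + min k (y (- w)) \<partial>gaussian)"
    using pt int int' by (intro integral_mono) auto
  also have "\<dots> = 2 * (\<integral>w. min k (y w) \<partial>gaussian)" using int int' flip by simp
  finally show ?thesis by (simp add: y_def)
qed

text \<open>The loss in the Jensen-type bound is at most the smaller of an eighth of the variance and \<open>2 ln 2\<close>, the
oscillation of \<open>\<psi>\<close>. This minimum is half of \<open>min (4 ln 2) (noise_cost)\<close> at \<open>\<theta>\<close>, so it is absorbed by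
the average over the perturbation.\<close>

lemma psi_le_gaussian_ln_laplace_factor:
  fixes S :: "real^'d^'d"
  assumes sym: "transpose S = S" and s: "s = 1 \<or> s = -1"
  shows "psi (s * (\<theta> \<bullet> (S *v \<theta>) - l)) \<le> (\<integral>w. ln (laplace_factor s \<tau> l S (\<theta> + \<tau> *\<^sub>R w)) \<partial>gaussian)"
proof -
  interpret prob_space "gaussian :: (real^'d) measure" by (rule prob_space_gaussian)
  define m where "m = \<theta> \<bullet> (S *v \<theta>) - l"
  define Y where "Y w = 2 * \<tau> * ((S *v \<theta>) \<bullet> w) + \<tau>\<^sup>2 * (w \<bullet> (S *v w) - trace S)" for w
  note Y = gaussian_fluctuation[OF sym, of \<tau> "S *v \<theta>", folded Y_def]
  have [measurable]: "Y \<in> borel_measurable borel" unfolding Y_def by measurable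
  define X where "X w = s * centred_form \<tau> l S (\<theta> + \<tau> *\<^sub>R w)" for w
  have XY: "X w - s * m = s * Y w" for w
    unfolding X_def centred_form_shift[OF sym] m_def Y_def by (simp add: algebra_simps)
  have [measurable]: "X \<in> borel_measurable borel" unfolding X_def centred_form_def by measurable
  define f where "f w = min (psi_top (X w)) psi_cap" for w
  define y where "y w = min (4 * ln 2) (noise_cost \<tau> S (\<theta> + \<tau> *\<^sub>R w))" for w
  have [measurable]: "f \<in> borel_measurable borel" unfolding f_def by measurable
  have [measurable]: "y \<in> borel_measurable borel" unfolding y_def noise_cost_def by measurable
  have l2: "(0::real) < ln 2" by simp
  have f_ge: "- ln 2 \<le> f w" and f_le: "f w \<le> psi_cap" for w
    using psi_top_ge[of "X w"] psi_cap_ge l2 unfolding f_def by linarith+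
  have f_abs: "\<bar>f w\<bar> \<le> ln 2 + psi_cap" for w
    using f_ge[of w] f_le[of w] psi_cap_ge l2 by linarith
  have intf: "integrable gaussian f"
    by (rule integrable_const_bound[of _ "ln 2 + psi_cap"])
       (use f_abs in auto)
  have y_abs: "\<bar>y w\<bar> \<le> 4 * ln 2" for w
    using noise_cost_nonneg[of \<tau> S "\<theta> + \<tau> *\<^sub>R w"] l2 unfolding y_def by linarith
  have inty: "integrable gaussian y"
    by (rule integrable_const_bound[of _ "4 * ln 2"]) (use y_abs in auto)
  obtain p where p: "psi (s * m) + p * (z - s * m) - (z - s * m)\<^sup>2 / 8 \<le> min (psi_top z) psi_cap" for z
    using psi_above_parabola by blast
  have s2: "s\<^sup>2 = 1" using s by auto
  have "psi (s * m) - noise_cost \<tau> S \<theta> / 2 = (\<integral>w. psi (s * m) + p * (s * Y w) - (Y w)\<^sup>2 / 8 \<partial>gaussian)"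
    using Y by (simp add: noise_cost_def field_simps)
  also have "\<dots> \<le> (\<integral>w. f w \<partial>gaussian)"
  proof (rule integral_mono)
    show "integrable gaussian (\<lambda>w. psi (s * m) + p * (s * Y w) - (Y w)\<^sup>2 / 8)" using Y by simp
    show "psi (s * m) + p * (s * Y w) - (Y w)\<^sup>2 / 8 \<le> f w" for w
      using p[of "X w"] unfolding XY f_def by (simp add: power_mult_distrib s2)
  qed (rule intf)
  finally have 1: "psi (s * m) \<le> (\<integral>w. f w \<partial>gaussian) + noise_cost \<tau> S \<theta> / 2" by simp
  have "- ln 2 = (\<integral>w. - ln 2 \<partial>(gaussian :: (real^'d) measure))" by simp
  also have "\<dots> \<le> (\<integral>w. f w \<partial>gaussian)" using intf f_ge by (intro integral_mono) auto
  finally have 2: "psi (s * m) \<le> (\<integral>w. f w \<partial>gaussian) + 2 * ln 2" using psi_le[of "s * m"] by simp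
  have "psi (s * m) \<le> (\<integral>w. f w \<partial>gaussian) + min (4 * ln 2) (noise_cost \<tau> S \<theta>) / 2"
    using 1 2 by (auto simp: min_def)
  also have "\<dots> \<le> (\<integral>w. f w \<partial>gaussian) + (\<integral>w. y w \<partial>gaussian)"
    unfolding y_def using half_min_le_gaussian[of "4 * ln 2" \<tau> S \<theta>] l2 by simp
  also have "\<dots> = (\<integral>w. f w + y w \<partial>gaussian)" using intf inty by simp
  also have "\<dots> \<le> (\<integral>w. ln (laplace_factor s \<tau> l S (\<theta> + \<tau> *\<^sub>R w)) \<partial>gaussian)"
  proof (rule integral_mono)
    show "integrable gaussian (\<lambda>w. f w + y w)" using intf inty by simp
    show "integrable gaussian (\<lambda>w. ln (laplace_factor s \<tau> l S (\<theta> + \<tau> *\<^sub>R w)))"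
      by (intro integrable_ln_between prob_space_gaussian laplace_factor_gaussian sym laplace_factor_ge_half s)
    show "f w + y w \<le> ln (laplace_factor s \<tau> l S (\<theta> + \<tau> *\<^sub>R w))" for w
      using min_psi_top_add_le[OF noise_cost_nonneg[of \<tau> S "\<theta> + \<tau> *\<^sub>R w"], of "X w"]
      unfolding f_def y_def laplace_factor_def by (simp add: X_def power_mult_distrib s2)
  qed
  finally show ?thesis by (simp add: m_def)
qed

section \<open>A PAC-Bayesian inequality with Gaussian posteriors\<close>

text \<open>The product of the normalised factors \<open>f (Xs i \<omega>) w / \<^bold>E[f (X) w]\<close> has mean 1 for each \<open>w\<close> by independence, hence so
has its average over a Gaussian \<open>w\<close>. Markov's inequality gives one event that does not
depend on \<open>u\<close>, and on this event the variational inequality holds for all translations \<open>u\<close> at once.\<close>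

lemma pac_bayes_event:
  fixes X :: "'w \<Rightarrow> 'b::second_countable_topology" and Xs :: "nat \<Rightarrow> 'w \<Rightarrow> 'b"
    and f :: "'b \<Rightarrow> real^'d \<Rightarrow> real"
  assumes "prob_space M"
    and X [measurable]: "X \<in> borel_measurable M"
    and Xs: "\<And>i. i < n \<Longrightarrow> Xs i \<in> borel_measurable M"
    and distr: "\<And>i. i < n \<Longrightarrow> distr M borel (Xs i) = distr M borel X"
    and indep: "prob_space.indep_vars M (\<lambda>_. borel) Xs {..<n}"
    and f [measurable]: "(\<lambda>(x, w). f x w) \<in> borel_measurable (borel \<Otimes>\<^sub>M borel)"
    and pos: "\<And>x w. 0 < f x w"
    and int: "\<And>w. integrable M (\<lambda>\<omega>. f (X \<omega>) w)"
    and \<eta>: "0 < \<eta>"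
  shows "\<exists>E\<in>sets M. 1 - \<eta> \<le> measure M E \<and> (\<forall>\<omega>\<in>E. \<forall>u.
     (\<forall>i<n. integrable gaussian (\<lambda>w. ln (f (Xs i \<omega>) (w + u)))) \<longrightarrow>
     integrable gaussian (\<lambda>w. ln (\<integral>\<omega>. f (X \<omega>) (w + u) \<partial>M)) \<longrightarrow>
     (\<Sum>i<n. \<integral>w. ln (f (Xs i \<omega>) (w + u)) \<partial>gaussian)
       \<le> n * (\<integral>w. ln (\<integral>\<omega>. f (X \<omega>) (w + u) \<partial>M) \<partial>gaussian) + (norm u)\<^sup>2 / 2 + ln (1 / \<eta>))"
proof -
  interpret prob_space M by fact
  interpret G: prob_space "gaussian :: (real^'d) measure" by (rule prob_space_gaussian)
  interpret MG: pair_sigma_finite M "gaussian :: (real^'d) measure" ..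
  define F where "F w = (\<integral>\<omega>. f (X \<omega>) w \<partial>M)" for w
  have fm [measurable]: "(\<lambda>x. f (g x) (h x)) \<in> borel_measurable N"
    if "g \<in> borel_measurable N" "h \<in> borel_measurable N" for g h and N :: "'c measure"
    using measurable_compose[OF _ f, of "\<lambda>x. (g x, h x)" N] that by simp
  have Fm [measurable]: "F \<in> borel_measurable borel"
  proof -
    have "(\<lambda>(w, \<omega>). f (X \<omega>) w) \<in> borel_measurable (borel \<Otimes>\<^sub>M M)"
      using fm[of "\<lambda>p. X (snd p)" "borel \<Otimes>\<^sub>M M" fst] by (simp add: case_prod_beta)
    then show ?thesis unfolding F_def by (rule borel_measurable_lebesgue_integral)
  qed
  have Fpos: "0 < F w" for w
  proof -
    have "0 \<le> F w" unfolding F_def using pos by (intro Bochner_Integration.integral_nonneg) (simp add: less_imp_le)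
    moreover have "F w \<noteq> 0"
    proof
      assume "F w = 0"
      then have "AE \<omega> in M. f (X \<omega>) w = 0"
        unfolding F_def using integral_nonneg_eq_0_iff_AE[OF int[of w]] pos by (simp add: less_imp_le)
      moreover have "AE \<omega> in M. f (X \<omega>) w \<noteq> 0" using pos[of _ w] by (simp add: less_imp_neq[symmetric])
      ultimately have "AE \<omega> in M. False" by eventually_elim simp
      then show False by simp
    qed
    ultimately show ?thesis by simp
  qed
  have ratio: "(\<integral>\<^sup>+\<omega>. ennreal (f (Xs i \<omega>) w / F w) \<partial>M) = 1" if "i < n" for i w
  proof -
    have [measurable]: "Xs i \<in> borel_measurable M" using Xs that .
    have "(\<integral>\<^sup>+\<omega>. ennreal (f (Xs i \<omega>) w / F w) \<partial>M) = (\<integral>\<^sup>+x. ennreal (f x w / F w) \<partial>distr M borel (Xs i))"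
      by (subst nn_integral_distr) auto
    also have "\<dots> = (\<integral>\<^sup>+\<omega>. ennreal (f (X \<omega>) w / F w) \<partial>M)"
      unfolding distr[OF that] by (subst nn_integral_distr) auto
    also have "\<dots> = ennreal (\<integral>\<omega>. f (X \<omega>) w / F w \<partial>M)"
      using int pos Fpos by (intro nn_integral_eq_integral) (auto simp: less_imp_le)
    also have "\<dots> = 1" using Fpos[of w] by (simp flip: F_def)
    finally show ?thesis .
  qed
  define Z where "Z \<omega> = (\<integral>\<^sup>+w. (\<Prod>i<n. ennreal (f (Xs i \<omega>) w / F w)) \<partial>gaussian)" for \<omega>
  have Xm [measurable]: "(\<lambda>p. Xs i (fst p)) \<in> borel_measurable (M \<Otimes>\<^sub>M gaussian)" if "i \<in> {..<n}" for i
    using Xs[of i] that by simp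
  have pm [measurable]: "(\<lambda>(\<omega>, w). \<Prod>i<n. ennreal (f (Xs i \<omega>) w / F w)) \<in> borel_measurable (M \<Otimes>\<^sub>M gaussian)"
    unfolding case_prod_beta by measurable
  have Zm [measurable]: "Z \<in> borel_measurable M"
    unfolding Z_def using pm by (rule G.borel_measurable_nn_integral)
  have "(\<integral>\<^sup>+\<omega>. Z \<omega> \<partial>M) = (\<integral>\<^sup>+w. (\<integral>\<^sup>+\<omega>. (\<Prod>i<n. ennreal (f (Xs i \<omega>) w / F w)) \<partial>M) \<partial>gaussian)"
    unfolding Z_def using MG.Fubini'[OF pm] by simp
  also have "\<dots> = (\<integral>\<^sup>+w. 1 \<partial>(gaussian :: (real^'d) measure))"
  proof (rule nn_integral_cong)
    fix w :: "real^'d"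
    have "indep_vars (\<lambda>_. borel) (\<lambda>i \<omega>. ennreal (f (Xs i \<omega>) w / F w)) {..<n}"
      by (rule indep_vars_compose2[OF indep]) auto
    then have "(\<integral>\<^sup>+\<omega>. (\<Prod>i<n. ennreal (f (Xs i \<omega>) w / F w)) \<partial>M) = (\<Prod>i<n. \<integral>\<^sup>+\<omega>. ennreal (f (Xs i \<omega>) w / F w) \<partial>M)"
      by (intro indep_vars_nn_integral) auto
    then show "(\<integral>\<^sup>+\<omega>. (\<Prod>i<n. ennreal (f (Xs i \<omega>) w / F w)) \<partial>M) = 1"
      using ratio by simp
  qed
  also have "\<dots> = 1" using G.emeasure_space_1 by simp
  finally have EZ: "(\<integral>\<^sup>+\<omega>. Z \<omega> \<partial>M) = 1" .
  \<comment> \<open>The exceptional event of Markov's inequality.\<close>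
  define B where "B = {\<omega> \<in> space M. 1 \<le> ennreal \<eta> * Z \<omega>}"
  have B [measurable]: "B \<in> sets M" unfolding B_def by measurable
  have "emeasure M B \<le> ennreal \<eta> * (\<integral>\<^sup>+\<omega>. Z \<omega> * indicator (space M) \<omega> \<partial>M)"
    unfolding B_def by (rule nn_integral_Markov_inequality) auto
  also have "(\<integral>\<^sup>+\<omega>. Z \<omega> * indicator (space M) \<omega> \<partial>M) = (\<integral>\<^sup>+\<omega>. Z \<omega> \<partial>M)"
    by (intro nn_integral_cong) auto
  finally have "measure M B \<le> \<eta>" using EZ \<eta> by (simp add: emeasure_eq_measure)
  then have "1 - \<eta> \<le> measure M (space M - B)" using prob_compl[OF B] by simp
  moreover have "(\<Sum>i<n. \<integral>w. ln (f (Xs i \<omega>) (w + u)) \<partial>gaussian)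
       \<le> n * (\<integral>w. ln (F (w + u)) \<partial>gaussian) + (norm u)\<^sup>2 / 2 + ln (1 / \<eta>)"
    if \<omega>: "\<omega> \<in> space M - B" and i1: "\<And>i. i < n \<Longrightarrow> integrable gaussian (\<lambda>w. ln (f (Xs i \<omega>) (w + u)))"
      and i2: "integrable gaussian (\<lambda>w. ln (F (w + u)))" for \<omega> u
  proof -
    define g where "g w = (\<Sum>i<n. ln (f (Xs i \<omega>) w) - ln (F w))" for w
    have gm: "g \<in> borel_measurable borel" unfolding g_def by measurable
    have gi: "integrable gaussian (\<lambda>w. g (w + u))" unfolding g_def using i1 i2 by auto
    have ge: "(\<integral>w. g (w + u) \<partial>gaussian) = (\<Sum>i<n. \<integral>w. ln (f (Xs i \<omega>) (w + u)) \<partial>gaussian) - n * (\<integral>w. ln (F (w + u)) \<partial>gaussian)"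
      unfolding g_def using i1 i2 by (subst Bochner_Integration.integral_sum) (auto simp: sum_subtractf)
    have eg: "ennreal (exp (g w)) = (\<Prod>i<n. ennreal (f (Xs i \<omega>) w / F w))" for w
    proof -
      have "exp (g w) = (\<Prod>i<n. f (Xs i \<omega>) w / F w)"
        using pos Fpos unfolding g_def by (simp add: exp_sum exp_diff)
      then show ?thesis using pos Fpos by (simp add: prod_ennreal less_imp_le)
    qed
    have "ennreal (exp ((\<integral>w. g (w + u) \<partial>gaussian) - (norm u)\<^sup>2 / 2)) \<le> Z \<omega>"
      using gaussian_donsker_varadhan[OF gm gi] unfolding eg Z_def .
    then have "ennreal \<eta> * ennreal (exp ((\<integral>w. g (w + u) \<partial>gaussian) - (norm u)\<^sup>2 / 2)) \<le> ennreal \<eta> * Z \<omega>"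
      by (intro mult_left_mono) auto
    also have "\<dots> < 1" using \<omega> by (auto simp: B_def)
    finally have "\<eta> * exp ((\<integral>w. g (w + u) \<partial>gaussian) - (norm u)\<^sup>2 / 2) < 1"
      using \<eta> by (simp flip: ennreal_mult'' ennreal_1 add: ennreal_less_iff del: ennreal_1)
    then have "exp ((\<integral>w. g (w + u) \<partial>gaussian) - (norm u)\<^sup>2 / 2) < 1 / \<eta>" using \<eta> by (simp add: field_simps)
    then have "(\<integral>w. g (w + u) \<partial>gaussian) - (norm u)\<^sup>2 / 2 < ln (1 / \<eta>)"
      using \<eta> by (metis exp_gt_zero ln_exp ln_less_cancel_iff order_less_trans)
    then show ?thesis unfolding ge by simp
  qed
  ultimately show ?thesis
    unfolding F_def by (intro bexI[of _ "space M - B"] conjI) auto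
qed

section \<open>Deviations of the empirical criterion\<close>

lemma integral_Cauchy_Schwarz:
  fixes f g :: "'a \<Rightarrow> real"
  assumes [measurable]: "f \<in> borel_measurable M" "g \<in> borel_measurable M"
    and int: "integrable M (\<lambda>x. (f x)\<^sup>2)" "integrable M (\<lambda>x. (g x)\<^sup>2)" "integrable M (\<lambda>x. f x * g x)"
    and nn: "\<And>x. x \<in> space M \<Longrightarrow> 0 \<le> f x" "\<And>x. x \<in> space M \<Longrightarrow> 0 \<le> g x"
  shows "(\<integral>x. f x * g x \<partial>M)\<^sup>2 \<le> (\<integral>x. (f x)\<^sup>2 \<partial>M) * (\<integral>x. (g x)\<^sup>2 \<partial>M)"
proof -
  have "(\<integral>\<^sup>+x. ennreal (f x) * ennreal (g x) \<partial>M)\<^sup>2 \<le> (\<integral>\<^sup>+x. (ennreal (f x))\<^sup>2 \<partial>M) * (\<integral>\<^sup>+x. (ennreal (g x))\<^sup>2 \<partial>M)"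
    by (rule Cauchy_Schwarz_nn_integral) auto
  also have "(\<integral>\<^sup>+x. ennreal (f x) * ennreal (g x) \<partial>M) = (\<integral>\<^sup>+x. ennreal (f x * g x) \<partial>M)"
    using nn by (intro nn_integral_cong) (simp add: ennreal_mult)
  also have "\<dots> = ennreal (\<integral>x. f x * g x \<partial>M)"
    using int nn by (intro nn_integral_eq_integral) (auto intro!: AE_I2)
  also have "(\<integral>\<^sup>+x. (ennreal (f x))\<^sup>2 \<partial>M) = (\<integral>\<^sup>+x. ennreal ((f x)\<^sup>2) \<partial>M)"
    using nn by (intro nn_integral_cong) (simp add: ennreal_power)
  also have "\<dots> = ennreal (\<integral>x. (f x)\<^sup>2 \<partial>M)"
    using int by (intro nn_integral_eq_integral) auto
  also have "(\<integral>\<^sup>+x. (ennreal (g x))\<^sup>2 \<partial>M) = (\<integral>\<^sup>+x. ennreal ((g x)\<^sup>2) \<partial>M)"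
    using nn by (intro nn_integral_cong) (simp add: ennreal_power)
  also have "\<dots> = ennreal (\<integral>x. (g x)\<^sup>2 \<partial>M)"
    using int by (intro nn_integral_eq_integral) auto
  finally have "ennreal ((\<integral>x. f x * g x \<partial>M)\<^sup>2) \<le> ennreal ((\<integral>x. (f x)\<^sup>2 \<partial>M) * (\<integral>x. (g x)\<^sup>2 \<partial>M))"
    using nn by (simp add: ennreal_power ennreal_mult integral_nonneg_AE)
  then show ?thesis by (simp add: ennreal_le_iff)
qed

locale random_gram = prob_space M
  for M :: "'w measure" +
  fixes A :: "'w \<Rightarrow> real^'d^'d"
  assumes random_psd: "random_psd_matrix M A"
    and op_norm_sq_integrable: "integrable M (\<lambda>\<omega>. (op_norm (A \<omega>))\<^sup>2)"
    and kappa_bdd: "bdd_above (kappa_ratios M A)"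
begin

lemma A_measurable [measurable]: "A \<in> borel_measurable M"
  using random_psd by (simp add: random_psd_matrix_def)

lemma A_psd: "\<omega> \<in> space M \<Longrightarrow> psd (A \<omega>)"
  using random_psd by (simp add: random_psd_matrix_def)

lemma norm_sq_integrable: "integrable M (\<lambda>\<omega>. (norm (A \<omega>))\<^sup>2)"
  by (rule Bochner_Integration.integrable_bound[of _ "\<lambda>\<omega>. real CARD('d) * (op_norm (A \<omega>))\<^sup>2"])
     (use norm_le_op_norm[of "A _"] op_norm_sq_integrable in auto)

text \<open>All integrability questions about the random matrix reduce to linear growth in its Hilbert--Schmidt norm.\<close>

lemma integrable_of_linear_bound:
  assumes [measurable]: "f \<in> borel_measurable M"
    and bound: "\<And>\<omega>. \<bar>f \<omega>\<bar> \<le> k * norm (A \<omega>) + c"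
  shows "integrable M f" "integrable M (\<lambda>\<omega>. (f \<omega>)\<^sup>2)"
proof -
  have sq: "(f \<omega>)\<^sup>2 \<le> 2 * k\<^sup>2 * (norm (A \<omega>))\<^sup>2 + 2 * c\<^sup>2" for \<omega>
  proof -
    have "(f \<omega>)\<^sup>2 \<le> (k * norm (A \<omega>) + c)\<^sup>2" using bound[of \<omega>] by (simp add: abs_le_square_iff[symmetric])
    also have "\<dots> \<le> 2 * k\<^sup>2 * (norm (A \<omega>))\<^sup>2 + 2 * c\<^sup>2"
      using zero_le_power2[of "k * norm (A \<omega>) - c"] by (simp add: power2_eq_square algebra_simps)
    finally show ?thesis .
  qed
  have int: "integrable M (\<lambda>\<omega>. 2 * k\<^sup>2 * (norm (A \<omega>))\<^sup>2 + 2 * c\<^sup>2)"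
    by (intro Bochner_Integration.integrable_add integrable_mult_right norm_sq_integrable) auto
  show *: "integrable M (\<lambda>\<omega>. (f \<omega>)\<^sup>2)"
    by (rule Bochner_Integration.integrable_bound[OF int]) (use sq in auto)
  show "integrable M f"
  proof (rule Bochner_Integration.integrable_bound[of _ "\<lambda>\<omega>. 1 + (f \<omega>)\<^sup>2"])
    have "\<bar>x\<bar> \<le> \<bar>1 + x\<^sup>2\<bar>" for x :: real
      using zero_le_power2[of "\<bar>x\<bar> - 1"] by (simp add: power2_eq_square algebra_simps)
    then show "AE \<omega> in M. norm (f \<omega>) \<le> norm (1 + (f \<omega>)\<^sup>2)" by simp
  qed (use * in auto)
qed

lemma quadform_integrable:
  "integrable M (\<lambda>\<omega>. \<theta> \<bullet> (A \<omega> *v \<theta>))" "integrable M (\<lambda>\<omega>. (\<theta> \<bullet> (A \<omega> *v \<theta>))\<^sup>2)"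
proof -
  have m: "(\<lambda>\<omega>. \<theta> \<bullet> (A \<omega> *v \<theta>)) \<in> borel_measurable M" by measurable
  have b: "\<bar>\<theta> \<bullet> (A \<omega> *v \<theta>)\<bar> \<le> (norm \<theta>)\<^sup>2 * norm (A \<omega>) + 0" for \<omega>
    using abs_quadform_le[of \<theta> "A \<omega>"] by simp
  show "integrable M (\<lambda>\<omega>. \<theta> \<bullet> (A \<omega> *v \<theta>))" "integrable M (\<lambda>\<omega>. (\<theta> \<bullet> (A \<omega> *v \<theta>))\<^sup>2)"
    using integrable_of_linear_bound[OF m b] by auto
qed

lemma norm_mult_sq_integrable: "integrable M (\<lambda>\<omega>. (norm (A \<omega> *v \<theta>))\<^sup>2)"
  by (rule integrable_of_linear_bound(2)[of _ "norm \<theta>" 0]) (use norm_matrix_vector_le in \<open>auto simp: mult.commute\<close>)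

lemma centred_form_sq_integrable:
  "integrable M (\<lambda>\<omega>. centred_form \<tau> l (A \<omega>) \<theta>)" "integrable M (\<lambda>\<omega>. (centred_form \<tau> l (A \<omega>) \<theta>)\<^sup>2)"
proof -
  have m: "(\<lambda>\<omega>. centred_form \<tau> l (A \<omega>) \<theta>) \<in> borel_measurable M" unfolding centred_form_def by measurable
  have b: "\<bar>centred_form \<tau> l (A \<omega>) \<theta>\<bar> \<le> ((norm \<theta>)\<^sup>2 + \<tau>\<^sup>2 * real CARD('d)) * norm (A \<omega>) + \<bar>l\<bar>" for \<omega>
  proof -
    have "\<bar>\<tau>\<^sup>2 * trace (A \<omega>)\<bar> \<le> \<tau>\<^sup>2 * (real CARD('d) * norm (A \<omega>))"
      unfolding abs_mult using abs_trace_le[of "A \<omega>"] by (auto intro!: mult_left_mono)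
    then show ?thesis
      using abs_quadform_le[of \<theta> "A \<omega>"] unfolding centred_form_def by (simp add: algebra_simps)
  qed
  show "integrable M (\<lambda>\<omega>. centred_form \<tau> l (A \<omega>) \<theta>)" "integrable M (\<lambda>\<omega>. (centred_form \<tau> l (A \<omega>) \<theta>)\<^sup>2)"
    using integrable_of_linear_bound[OF m b] by auto
qed

lemma laplace_factor_integrable: "integrable M (\<lambda>\<omega>. laplace_factor s \<tau> l (A \<omega>) \<theta>)"
  unfolding laplace_factor_def noise_cost_def
  by (intro Bochner_Integration.integrable_add integrable_mult_right integrable_divide
      centred_form_sq_integrable norm_mult_sq_integrable norm_sq_integrable) auto

lemma N_nonneg: "0 \<le> N M A \<theta>"
  unfolding N_def by (intro integral_nonneg_AE AE_I2 psd_nonneg A_psd)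

text \<open>If \<open>N(\<theta>) = 0\<close> the ratio does not occur in the supremum that defines \<open>\<kappa>\<close>, but then the quadratic form
vanishes almost surely.\<close>

lemma second_moment_le: "(\<integral>\<omega>. (\<theta> \<bullet> (A \<omega> *v \<theta>))\<^sup>2 \<partial>M) \<le> kappa M A * (N M A \<theta>)\<^sup>2"
proof -
  have e2: "(\<integral>\<omega>. (norm (psd_sqrt (A \<omega>) *v \<theta>))\<^sup>2 \<partial>M) = N M A \<theta>"
    unfolding N_def by (intro Bochner_Integration.integral_cong) (auto simp: norm_psd_sqrt A_psd)
  have e4: "(\<integral>\<omega>. norm (psd_sqrt (A \<omega>) *v \<theta>) ^ 4 \<partial>M) = (\<integral>\<omega>. (\<theta> \<bullet> (A \<omega> *v \<theta>))\<^sup>2 \<partial>M)"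
  proof (rule Bochner_Integration.integral_cong)
    fix \<omega> assume "\<omega> \<in> space M"
    then have "\<theta> \<bullet> (A \<omega> *v \<theta>) = (norm (psd_sqrt (A \<omega>) *v \<theta>))\<^sup>2" by (simp add: norm_psd_sqrt A_psd)
    then show "norm (psd_sqrt (A \<omega>) *v \<theta>) ^ 4 = (\<theta> \<bullet> (A \<omega> *v \<theta>))\<^sup>2" by simp
  qed simp
  show ?thesis
  proof (cases "N M A \<theta> = 0")
    case True
    then have "AE \<omega> in M. \<theta> \<bullet> (A \<omega> *v \<theta>) = 0"
      unfolding N_def using integral_nonneg_eq_0_iff_AE[OF quadform_integrable(1)] psd_nonneg[OF A_psd] by (simp add: AE_I2)
    then have "(\<integral>\<omega>. (\<theta> \<bullet> (A \<omega> *v \<theta>))\<^sup>2 \<partial>M) = (\<integral>\<omega>. 0 \<partial>M)"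
      by (intro integral_cong_AE) auto
    then show ?thesis using True by simp
  next
    case False
    then have pos: "0 < N M A \<theta>" using N_nonneg[of \<theta>] by simp
    then have "(\<integral>\<omega>. (\<theta> \<bullet> (A \<omega> *v \<theta>))\<^sup>2 \<partial>M) / (N M A \<theta>)\<^sup>2 \<in> kappa_ratios M A"
      unfolding kappa_ratios_def by (intro image_eqI[of _ _ \<theta>]) (simp_all add: e2 e4)
    then have "(\<integral>\<omega>. (\<theta> \<bullet> (A \<omega> *v \<theta>))\<^sup>2 \<partial>M) / (N M A \<theta>)\<^sup>2 \<le> kappa M A"
      unfolding kappa_def by (intro cSup_upper kappa_bdd)
    then show ?thesis using pos by (simp add: pos_divide_le_eq)
  qed
qed

lemma E_op2_nonneg: "0 \<le> E_op2 M A"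
  unfolding E_op2_def by simp

lemma s4_sq: "(s4 M A)\<^sup>2 = sqrt (E_op2 M A)"
proof -
  have "(root 4 (E_op2 M A))\<^sup>2 = root 2 (E_op2 M A)"
  proof -
    have "root 4 (E_op2 M A) = root 2 (root 2 (E_op2 M A))"
      using real_root_mult_exp[of 2 2 "E_op2 M A"] by simp
    then show ?thesis using E_op2_nonneg by (simp add: real_root_pow_pos2)
  qed
  then show ?thesis by (simp add: s4_def sqrt_def)
qed

lemma op_norm_measurable: "(\<lambda>\<omega>. op_norm (A \<omega>)) \<in> borel_measurable M"
proof -
  have "(\<lambda>\<omega>. sqrt ((op_norm (A \<omega>))\<^sup>2)) \<in> borel_measurable M"
    using borel_measurable_integrable[OF op_norm_sq_integrable] by measurable
  then show ?thesis using op_norm_nonneg[of "A _"] by simp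
qed

lemma norm_mult_sq_le:
  "(\<integral>\<omega>. (norm (A \<omega> *v \<theta>))\<^sup>2 \<partial>M) \<le> sqrt (kappa M A) * (s4 M A)\<^sup>2 * N M A \<theta>"
proof -
  let ?q = "\<lambda>\<omega>. \<theta> \<bullet> (A \<omega> *v \<theta>)"
  have [measurable]: "(\<lambda>\<omega>. op_norm (A \<omega>)) \<in> borel_measurable M" by (rule op_norm_measurable)
  have int: "integrable M (\<lambda>\<omega>. op_norm (A \<omega>) * ?q \<omega>)"
  proof (rule Bochner_Integration.integrable_bound[of _ "\<lambda>\<omega>. (op_norm (A \<omega>))\<^sup>2 + (?q \<omega>)\<^sup>2"])
    show "integrable M (\<lambda>\<omega>. (op_norm (A \<omega>))\<^sup>2 + (?q \<omega>)\<^sup>2)"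
      using op_norm_sq_integrable quadform_integrable by simp
    have "\<bar>x * y\<bar> \<le> \<bar>x\<^sup>2 + y\<^sup>2\<bar>" for x y :: real
      using sum_squares_bound[of x y] sum_squares_bound[of x "-y"] by (simp add: abs_le_iff)
    then show "AE \<omega> in M. norm (op_norm (A \<omega>) * ?q \<omega>) \<le> norm ((op_norm (A \<omega>))\<^sup>2 + (?q \<omega>)\<^sup>2)" by simp
  qed auto
  have "(\<integral>\<omega>. (norm (A \<omega> *v \<theta>))\<^sup>2 \<partial>M) \<le> (\<integral>\<omega>. op_norm (A \<omega>) * ?q \<omega> \<partial>M)"
    by (intro integral_mono norm_mult_sq_integrable int norm_sq_mult_le A_psd)
  also have "\<dots> \<le> sqrt (kappa M A * (N M A \<theta>)\<^sup>2 * E_op2 M A)"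
  proof (rule real_le_rsqrt)
    have "(\<integral>\<omega>. op_norm (A \<omega>) * ?q \<omega> \<partial>M)\<^sup>2 \<le> E_op2 M A * (\<integral>\<omega>. (?q \<omega>)\<^sup>2 \<partial>M)"
      unfolding E_op2_def
      by (intro integral_Cauchy_Schwarz int op_norm_sq_integrable quadform_integrable psd_nonneg A_psd op_norm_nonneg) auto
    also have "\<dots> \<le> E_op2 M A * (kappa M A * (N M A \<theta>)\<^sup>2)"
      by (intro mult_left_mono second_moment_le E_op2_nonneg)
    finally show "(\<integral>\<omega>. op_norm (A \<omega>) * ?q \<omega> \<partial>M)\<^sup>2 \<le> kappa M A * (N M A \<theta>)\<^sup>2 * E_op2 M A" by (simp add: mult_ac)
  qed
  also have "\<dots> = sqrt (kappa M A) * (s4 M A)\<^sup>2 * N M A \<theta>"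
    using N_nonneg[of \<theta>] by (simp add: real_sqrt_mult s4_sq mult_ac)
  finally show ?thesis .
qed

lemma N_le: "N M A \<theta> \<le> (s4 M A)\<^sup>2 * (norm \<theta>)\<^sup>2"
proof -
  have [measurable]: "(\<lambda>\<omega>. op_norm (A \<omega>)) \<in> borel_measurable M" by (rule op_norm_measurable)
  have int: "integrable M (\<lambda>\<omega>. op_norm (A \<omega>))"
    using square_integrable_imp_integrable[OF _ op_norm_sq_integrable] by simp
  have "N M A \<theta> \<le> (\<integral>\<omega>. op_norm (A \<omega>) * (norm \<theta>)\<^sup>2 \<partial>M)"
    unfolding N_def using int by (intro integral_mono quadform_integrable quadform_le_op_norm) auto
  also have "\<dots> = (\<integral>\<omega>. op_norm (A \<omega>) * 1 \<partial>M) * (norm \<theta>)\<^sup>2" by simp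
  also have "(\<integral>\<omega>. op_norm (A \<omega>) * 1 \<partial>M) \<le> sqrt (E_op2 M A)"
  proof (rule real_le_rsqrt)
    show "(\<integral>\<omega>. op_norm (A \<omega>) * 1 \<partial>M)\<^sup>2 \<le> E_op2 M A"
      using integral_Cauchy_Schwarz[of "\<lambda>\<omega>. op_norm (A \<omega>)" M "\<lambda>_. 1"] int op_norm_sq_integrable
      by (simp add: E_op2_def prob_space op_norm_nonneg)
  qed
  finally show ?thesis by (simp add: s4_sq mult_right_mono)
qed

lemma E_tr2_eq: "E_tr2 M A = (\<integral>\<omega>. (norm (A \<omega>))\<^sup>2 \<partial>M)"
  unfolding E_tr2_def by (intro Bochner_Integration.integral_cong) (auto simp: trace_square_sym psd_sym A_psd)

lemma E_tr2_nonneg: "0 \<le> E_tr2 M A"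
  unfolding E_tr2_eq by simp

text \<open>The second-order terms of the mean of \<open>laplace_factor\<close>, with \<open>\<tau>\<^sup>2 = 1/b\<close>, in terms of \<open>\<kappa>\<close> and
\<open>s\<^sub>4\<close>.\<close>

definition drift_bound :: "real \<Rightarrow> real \<Rightarrow> real^'d \<Rightarrow> real" where
  "drift_bound b l \<theta> = (kappa M A * (N M A \<theta>)\<^sup>2 - 2 * l * N M A \<theta> + l\<^sup>2) / 2
     + (2 + c_const) * sqrt (kappa M A) * (s4 M A)\<^sup>2 / b * N M A \<theta>
     + (2 + 3 * c_const) * E_tr2 M A / (2 * b\<^sup>2)"

text \<open>Since \<open>ln y \<le> y - 1\<close>, the mean of the logarithm is bounded by a double expectation; exchanging the order of
integration makes the closed formula of \<open>laplace_factor_gaussian\<close> available for each matrix.\<close>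

lemma gaussian_ln_mean_laplace_factor_le:
  assumes s: "s = 1 \<or> s = -1" and b: "b > 0"
  defines "\<tau> \<equiv> 1 / sqrt b"
  shows "integrable gaussian (\<lambda>w. ln (\<integral>\<omega>. laplace_factor s \<tau> l (A \<omega>) (\<theta> + \<tau> *\<^sub>R w) \<partial>M))"
    "(\<integral>w. ln (\<integral>\<omega>. laplace_factor s \<tau> l (A \<omega>) (\<theta> + \<tau> *\<^sub>R w) \<partial>M) \<partial>gaussian) \<le> s * (N M A \<theta> - l) + drift_bound b l \<theta>"
proof -
  interpret G: prob_space "gaussian :: (real^'d) measure" by (rule prob_space_gaussian)
  interpret MG: pair_sigma_finite M "gaussian :: (real^'d) measure" ..
  define F where "F = (\<lambda>(\<omega>, w). laplace_factor s \<tau> l (A \<omega>) (\<theta> + \<tau> *\<^sub>R w))"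
  define Fb where "Fb w = (\<integral>\<omega>. laplace_factor s \<tau> l (A \<omega>) (\<theta> + \<tau> *\<^sub>R w) \<partial>M)" for w
  define H where "H \<omega> = 1 + s * (\<theta> \<bullet> (A \<omega> *v \<theta>) - l) + (\<theta> \<bullet> (A \<omega> *v \<theta>) - l)\<^sup>2 / 2
        + (2 + c_const) * \<tau>\<^sup>2 * (norm (A \<omega> *v \<theta>))\<^sup>2 + (2 + 3 * c_const) / 2 * \<tau> ^ 4 * (norm (A \<omega>))\<^sup>2" for \<omega>
  have q2: "integrable M (\<lambda>\<omega>. (\<theta> \<bullet> (A \<omega> *v \<theta>) - l)\<^sup>2)"
    using centred_form_sq_integrable(2)[of 0 l \<theta>] by (simp add: centred_form_def)
  have q1: "integrable M (\<lambda>\<omega>. \<theta> \<bullet> (A \<omega> *v \<theta>) - l)"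
    using quadform_integrable by simp
  have H: "integrable M H" unfolding H_def
    by (intro Bochner_Integration.integrable_add integrable_mult_right integrable_divide q1 q2
      norm_mult_sq_integrable norm_sq_integrable) auto
  have Fpos: "1 / 2 \<le> F p" for p unfolding F_def case_prod_beta by (rule laplace_factor_ge_half[OF s])
  have inner: "integrable gaussian (\<lambda>w. F (\<omega>, w))" "(\<integral>w. F (\<omega>, w) \<partial>gaussian) = H \<omega>" if "\<omega> \<in> space M" for \<omega>
    using laplace_factor_gaussian[OF psd_sym[OF A_psd[OF that]]] by (auto simp: F_def H_def)
  have Fm: "F \<in> borel_measurable (M \<Otimes>\<^sub>M gaussian)" unfolding F_def case_prod_beta by measurable
  have F: "integrable (M \<Otimes>\<^sub>M gaussian) F"
  proof (rule MG.Fubini_integrable[OF Fm])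
    have "norm (F p) = F p" for p using Fpos[of p] by simp
    then have "(\<integral>w. norm (F (\<omega>, w)) \<partial>gaussian) = H \<omega>" if "\<omega> \<in> space M" for \<omega> using inner(2)[OF that] by simp
    then show "integrable M (\<lambda>\<omega>. \<integral>w. norm (F (\<omega>, w)) \<partial>gaussian)"
      using H by (subst Bochner_Integration.integrable_cong[of M M _ H]) auto
    show "AE \<omega> in M. integrable gaussian (\<lambda>w. F (\<omega>, w))" using inner by (intro AE_I2) auto
  qed
  have Fb: "integrable gaussian Fb"
    using MG.integrable_snd[of "\<lambda>\<omega> w. F (\<omega>, w)"] F by (simp add: Fb_def[abs_def] F_def)
  have "(\<integral>w. Fb w \<partial>gaussian) = (\<integral>\<omega>. (\<integral>w. F (\<omega>, w) \<partial>gaussian) \<partial>M)"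
    using MG.Fubini_integral[of "\<lambda>\<omega> w. F (\<omega>, w)"] F by (simp add: Fb_def F_def)
  also have "\<dots> = (\<integral>\<omega>. H \<omega> \<partial>M)" by (intro Bochner_Integration.integral_cong) (auto simp: inner)
  finally have EFb: "(\<integral>w. Fb w \<partial>gaussian) = (\<integral>\<omega>. H \<omega> \<partial>M)" .
  have Fb_ge: "1 / 2 \<le> Fb w" for w
  proof -
    have "(\<integral>\<omega>. 1 / 2 \<partial>M) \<le> Fb w" unfolding Fb_def
      by (intro integral_mono laplace_factor_integrable laplace_factor_ge_half s) auto
    then show ?thesis by (simp add: prob_space)
  qed
  show int: "integrable gaussian (\<lambda>w. ln (Fb w))"
    by (intro integrable_ln_between prob_space_gaussian Fb Fb_ge)
  have "(\<integral>w. ln (Fb w) \<partial>gaussian) \<le> (\<integral>w. Fb w - 1 \<partial>gaussian)"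
  proof (rule integral_mono[OF int])
    show "ln (Fb w) \<le> Fb w - 1" for w using Fb_ge[of w] by (intro ln_le_minus_one) auto
  qed (use Fb in simp)
  also have "\<dots> = (\<integral>\<omega>. H \<omega> \<partial>M) - 1" using Fb EFb by simp
  also have "(\<integral>\<omega>. H \<omega> \<partial>M) = 1 + s * (N M A \<theta> - l) + (\<integral>\<omega>. (\<theta> \<bullet> (A \<omega> *v \<theta>) - l)\<^sup>2 \<partial>M) / 2
      + (2 + c_const) * \<tau>\<^sup>2 * (\<integral>\<omega>. (norm (A \<omega> *v \<theta>))\<^sup>2 \<partial>M) + (2 + 3 * c_const) / 2 * \<tau> ^ 4 * E_tr2 M A"
    unfolding H_def N_def E_tr2_eq
    using q1 q2 norm_mult_sq_integrable norm_sq_integrable quadform_integrable by (simp add: prob_space)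
  also have "(\<integral>\<omega>. (\<theta> \<bullet> (A \<omega> *v \<theta>) - l)\<^sup>2 \<partial>M) = (\<integral>\<omega>. (\<theta> \<bullet> (A \<omega> *v \<theta>))\<^sup>2 \<partial>M) - 2 * l * N M A \<theta> + l\<^sup>2"
  proof -
    have "(\<theta> \<bullet> (A \<omega> *v \<theta>) - l)\<^sup>2 = (\<theta> \<bullet> (A \<omega> *v \<theta>))\<^sup>2 - 2 * l * (\<theta> \<bullet> (A \<omega> *v \<theta>)) + l\<^sup>2" for \<omega>
      by (simp add: power2_eq_square algebra_simps)
    then show ?thesis using quadform_integrable[of \<theta>] by (simp add: N_def prob_space)
  qed
  also have "(\<integral>\<omega>. (\<theta> \<bullet> (A \<omega> *v \<theta>))\<^sup>2 \<partial>M) \<le> kappa M A * (N M A \<theta>)\<^sup>2" by (rule second_moment_le)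
  also have "(2 + c_const) * \<tau>\<^sup>2 * (\<integral>\<omega>. (norm (A \<omega> *v \<theta>))\<^sup>2 \<partial>M)
      \<le> (2 + c_const) * \<tau>\<^sup>2 * (sqrt (kappa M A) * (s4 M A)\<^sup>2 * N M A \<theta>)"
    using c_const_pos by (intro mult_left_mono norm_mult_sq_le) auto
  finally have "(\<integral>w. ln (Fb w) \<partial>gaussian) \<le> s * (N M A \<theta> - l)
      + (kappa M A * (N M A \<theta>)\<^sup>2 - 2 * l * N M A \<theta> + l\<^sup>2) / 2
      + (2 + c_const) * \<tau>\<^sup>2 * (sqrt (kappa M A) * (s4 M A)\<^sup>2 * N M A \<theta>)
      + (2 + 3 * c_const) / 2 * \<tau> ^ 4 * E_tr2 M A" by simp
  moreover have "\<tau>\<^sup>2 = 1 / b" "\<tau> ^ 4 = 1 / b\<^sup>2"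
  proof -
    show t2: "\<tau>\<^sup>2 = 1 / b" using b by (simp add: \<tau>_def power_divide)
    have "\<tau> ^ 4 = (\<tau>\<^sup>2)\<^sup>2" by simp
    then show "\<tau> ^ 4 = 1 / b\<^sup>2" unfolding t2 by (simp add: power_divide)
  qed
  ultimately show "(\<integral>w. ln (Fb w) \<partial>gaussian) \<le> s * (N M A \<theta> - l) + drift_bound b l \<theta>"
    unfolding drift_bound_def by (simp add: mult_ac)
qed

end

locale gram_sample = random_gram M A
  for M :: "'w measure" and A :: "'w \<Rightarrow> real^'d^'d" +
  fixes As :: "nat \<Rightarrow> 'w \<Rightarrow> real^'d^'d" and n :: nat
  assumes n_pos: "1 \<le> n"
    and sample_psd: "\<And>i. i < n \<Longrightarrow> random_psd_matrix M (As i)"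
    and sample_distr: "\<And>i. i < n \<Longrightarrow> distr M borel (As i) = distr M borel A"
    and sample_indep: "indep_vars (\<lambda>_. borel) As {..<n}"
begin

text \<open>The prior is the law of \<open>\<tau> w\<close>. Translating \<open>w\<close> by \<open>\<theta>/\<tau>\<close> moves it to the law of \<open>\<theta> + \<tau> w\<close> at the entropy cost
\<open>b \<parallel>\<theta>\<parallel>\<^sup>2/2\<close>.\<close>

lemma deviation_event:
  assumes s: "s = 1 \<or> s = -1" and b: "b > 0" and \<eta>: "\<eta> > 0"
  shows "\<exists>E\<in>sets M. 1 - \<eta> \<le> prob E \<and> (\<forall>\<omega>\<in>E. \<forall>\<theta>.
    s * r_crit n (\<lambda>i. As i \<omega>) l \<theta> \<le>
      s * (N M A \<theta> - l) + drift_bound b l \<theta> + b * (norm \<theta>)\<^sup>2 / (2 * n) + ln (1 / \<eta>) / n)"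
proof -
  define \<tau> where "\<tau> = 1 / sqrt b"
  have \<tau>: "\<tau> > 0" using b by (simp add: \<tau>_def)
  obtain E where E: "E \<in> sets M" "1 - \<eta> \<le> prob E" and bound: "\<And>\<omega> u. \<omega> \<in> E \<Longrightarrow>
     (\<And>i. i < n \<Longrightarrow> integrable gaussian (\<lambda>w. ln (laplace_factor s \<tau> l (As i \<omega>) (\<tau> *\<^sub>R (w + u))))) \<Longrightarrow>
     integrable gaussian (\<lambda>w. ln (\<integral>\<omega>. laplace_factor s \<tau> l (A \<omega>) (\<tau> *\<^sub>R (w + u)) \<partial>M)) \<Longrightarrow>
     (\<Sum>i<n. \<integral>w. ln (laplace_factor s \<tau> l (As i \<omega>) (\<tau> *\<^sub>R (w + u))) \<partial>gaussian)
       \<le> n * (\<integral>w. ln (\<integral>\<omega>. laplace_factor s \<tau> l (A \<omega>) (\<tau> *\<^sub>R (w + u)) \<partial>M) \<partial>gaussian) + (norm u)\<^sup>2 / 2 + ln (1 / \<eta>)"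
  proof -
    have "(\<lambda>(S, w). laplace_factor s \<tau> l S (\<tau> *\<^sub>R w)) \<in> borel_measurable (borel \<Otimes>\<^sub>M borel)"
      unfolding case_prod_beta by measurable
    moreover have "0 < laplace_factor s \<tau> l S w" for S :: "real^'d^'d" and w
      using laplace_factor_ge_half[OF s, of \<tau> l S w] by simp
    ultimately have "\<exists>E\<in>sets M. 1 - \<eta> \<le> prob E \<and> (\<forall>\<omega>\<in>E. \<forall>u.
     (\<forall>i<n. integrable gaussian (\<lambda>w. ln (laplace_factor s \<tau> l (As i \<omega>) (\<tau> *\<^sub>R (w + u))))) \<longrightarrow>
     integrable gaussian (\<lambda>w. ln (\<integral>\<omega>. laplace_factor s \<tau> l (A \<omega>) (\<tau> *\<^sub>R (w + u)) \<partial>M)) \<longrightarrow>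
     (\<Sum>i<n. \<integral>w. ln (laplace_factor s \<tau> l (As i \<omega>) (\<tau> *\<^sub>R (w + u))) \<partial>gaussian)
       \<le> n * (\<integral>w. ln (\<integral>\<omega>. laplace_factor s \<tau> l (A \<omega>) (\<tau> *\<^sub>R (w + u)) \<partial>M) \<partial>gaussian) + (norm u)\<^sup>2 / 2 + ln (1 / \<eta>))"
      using sample_psd sample_distr
      by (intro pac_bayes_event[of M A n As "\<lambda>S w. laplace_factor s \<tau> l S (\<tau> *\<^sub>R w)" \<eta>] prob_space_axioms
          sample_indep laplace_factor_integrable \<eta> A_measurable) (auto simp: random_psd_matrix_def)
    then show ?thesis using that by blast
  qed
  show ?thesis
  proof (intro bexI[of _ E] conjI ballI allI E)
    fix \<omega> and \<theta> :: "real^'d" assume \<omega>: "\<omega> \<in> E"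
    then have sp: "\<omega> \<in> space M" using sets.sets_into_space E by blast
    have psd: "psd (As i \<omega>)" if "i < n" for i using sample_psd[OF that] sp by (simp add: random_psd_matrix_def)
    have sc: "\<tau> *\<^sub>R (w + \<theta> /\<^sub>R \<tau>) = \<theta> + \<tau> *\<^sub>R w" for w
      using \<tau> by (simp add: scaleR_add_right add.commute)
    note mean = gaussian_ln_mean_laplace_factor_le[OF s b, folded \<tau>_def, of l \<theta>]
    have "(\<Sum>i<n. \<integral>w. ln (laplace_factor s \<tau> l (As i \<omega>) (\<tau> *\<^sub>R (w + \<theta> /\<^sub>R \<tau>))) \<partial>gaussian)
       \<le> n * (\<integral>w. ln (\<integral>\<omega>. laplace_factor s \<tau> l (A \<omega>) (\<tau> *\<^sub>R (w + \<theta> /\<^sub>R \<tau>)) \<partial>M) \<partial>gaussian) + (norm (\<theta> /\<^sub>R \<tau>))\<^sup>2 / 2 + ln (1 / \<eta>)"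
    proof (rule bound[OF \<omega>])
      show "integrable gaussian (\<lambda>w. ln (laplace_factor s \<tau> l (As i \<omega>) (\<tau> *\<^sub>R (w + \<theta> /\<^sub>R \<tau>))))" if "i < n" for i
        unfolding sc
        by (intro integrable_ln_between prob_space_gaussian laplace_factor_gaussian psd_sym psd that laplace_factor_ge_half s)
      show "integrable gaussian (\<lambda>w. ln (\<integral>\<omega>. laplace_factor s \<tau> l (A \<omega>) (\<tau> *\<^sub>R (w + \<theta> /\<^sub>R \<tau>)) \<partial>M))"
        unfolding sc by (rule mean(1))
    qed
    then have up: "(\<Sum>i<n. \<integral>w. ln (laplace_factor s \<tau> l (As i \<omega>) (\<theta> + \<tau> *\<^sub>R w)) \<partial>gaussian)
       \<le> n * (s * (N M A \<theta> - l) + drift_bound b l \<theta>) + (norm (\<theta> /\<^sub>R \<tau>))\<^sup>2 / 2 + ln (1 / \<eta>)"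
      using mult_left_mono[OF mean(2), of "real n"] unfolding sc by linarith
    have "(norm (\<theta> /\<^sub>R \<tau>))\<^sup>2 = b * (norm \<theta>)\<^sup>2"
      using b by (simp add: \<tau>_def power_mult_distrib)
    note up = up[unfolded this]
    have psi_s: "s * psi x = psi (s * x)" for x using s psi_minus by auto
    have "n * (s * r_crit n (\<lambda>i. As i \<omega>) l \<theta>) = (\<Sum>i<n. psi (s * (\<theta> \<bullet> (As i \<omega> *v \<theta>) - l)))"
      using n_pos psd by (simp add: r_crit_def norm_psd_sqrt psi_s[symmetric] sum_distrib_left)
    also have "\<dots> \<le> (\<Sum>i<n. \<integral>w. ln (laplace_factor s \<tau> l (As i \<omega>) (\<theta> + \<tau> *\<^sub>R w)) \<partial>gaussian)"
      by (intro sum_mono psi_le_gaussian_ln_laplace_factor psd_sym psd s) auto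
    also note up
    finally have "s * r_crit n (\<lambda>i. As i \<omega>) l \<theta> \<le>
       (n * (s * (N M A \<theta> - l) + drift_bound b l \<theta>) + b * (norm \<theta>)\<^sup>2 / 2 + ln (1 / \<eta>)) / n"
      using n_pos by (simp add: pos_le_divide_eq mult.commute)
    then show "s * r_crit n (\<lambda>i. As i \<omega>) l \<theta> \<le>
      s * (N M A \<theta> - l) + drift_bound b l \<theta> + b * (norm \<theta>)\<^sup>2 / (2 * n) + ln (1 / \<eta>) / n"
      using n_pos by (simp add: add_divide_distrib)
  qed
qed

end

section \<open>Inverting quadratic deviation inequalities\<close>

text \<open>At \<open>x' = 1 + y\<close>, with \<open>y\<close> the claimed bound, the left-hand side exceeds the right-hand side, since
\<open>\<xi> y < \<gamma> + \<eta>\<close>. So the segment from 1 to \<open>x\<close> cannot contain this point. Letting the error grow in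
proportion to \<open>x'\<close> makes it possible to state it through the energy instead of its estimate.\<close>

lemma localise_upper:
  fixes x \<gamma> \<eta> \<mu> \<xi> :: real
  assumes pos: "0 < \<gamma> + \<eta>" "0 \<le> \<eta>" "0 \<le> \<xi>" "0 \<le> \<gamma>"
    and small: "\<xi> + \<mu> + \<gamma> + 2 * \<eta> < 1"
    and ineq: "\<And>x'. 1 \<le> x' \<Longrightarrow> x' \<le> x \<Longrightarrow> (1 - \<mu>) * (x' - 1) - \<xi> * (x' - 1)\<^sup>2 \<le> \<gamma> + \<eta> * x'"
  shows "x - 1 \<le> (\<gamma> + \<eta>) / (1 - \<mu> - \<gamma> - 2 * \<eta>)"
proof (rule ccontr)
  define D where "D = 1 - \<mu> - \<gamma> - 2 * \<eta>"
  define y where "y = (\<gamma> + \<eta>) / D"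
  have D: "0 < D" "\<xi> < D" using small pos by (auto simp: D_def)
  have y: "0 < y" "D * y = \<gamma> + \<eta>" using D pos by (auto simp: y_def)
  assume "\<not> x - 1 \<le> (\<gamma> + \<eta>) / (1 - \<mu> - \<gamma> - 2 * \<eta>)"
  then have "1 + y \<le> x" by (simp add: y_def D_def)
  then have "(1 - \<mu>) * y - \<xi> * y\<^sup>2 \<le> \<gamma> + \<eta> * (1 + y)" using ineq[of "1 + y"] y by simp
  moreover have "\<xi> * y < \<gamma> + \<eta>" using D y mult_strict_right_mono[of \<xi> D y] by simp
  then have "y * D < y * (1 - \<mu> - \<eta> - \<xi> * y)" using y pos by (intro mult_strict_left_mono) (auto simp: D_def)
  ultimately show False using y(2) by (simp add: power2_eq_square algebra_simps)
qed

text \<open>Here a single inequality suffices: \<open>u \<mapsto> (1 + \<mu>) u - \<xi> u\<^sup>2\<close> exceeds \<open>\<gamma> + \<eta>\<close> at the claimed bound \<open>y\<close> and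
does not fall below that value on \<open>[y, 1]\<close>, and \<open>1 - x\<close> is at most 1.\<close>

lemma localise_lower:
  fixes x \<gamma> \<eta> \<mu> \<xi> :: real
  assumes pos: "0 < \<gamma> + \<eta>" "0 \<le> \<eta>" "0 \<le> \<xi>" "0 \<le> \<mu>" "0 \<le> \<gamma>" and x: "0 \<le> x"
    and small: "\<xi> + \<mu> + \<gamma> + 2 * \<eta> < 1"
    and ineq: "0 \<le> (1 + \<mu>) * (x - 1) + \<xi> * (x - 1)\<^sup>2 + \<gamma> + \<eta>"
  shows "1 - x \<le> (\<gamma> + \<eta>) / (1 - \<mu> - \<gamma> - 2 * \<eta>)"
proof (rule ccontr)
  define D where "D = 1 - \<mu> - \<gamma> - 2 * \<eta>"
  define y where "y = (\<gamma> + \<eta>) / D"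
  define u where "u = 1 - x"
  have D: "0 < D" "\<xi> < D" using small pos by (auto simp: D_def)
  have y: "0 < y" "D * y = \<gamma> + \<eta>" using D pos by (auto simp: y_def)
  assume "\<not> 1 - x \<le> (\<gamma> + \<eta>) / (1 - \<mu> - \<gamma> - 2 * \<eta>)"
  then have u: "y < u" "u \<le> 1" using x by (auto simp: y_def D_def u_def)
  have "(1 + \<mu>) * u - \<xi> * u\<^sup>2 \<le> \<gamma> + \<eta>" using ineq by (simp add: u_def power2_eq_square algebra_simps)
  moreover have xy: "\<xi> * y < \<gamma> + \<eta>" using D y mult_strict_right_mono[of \<xi> D y] by simp
  then have "y * D < y * (1 + \<mu> - \<xi> * y)" using y pos by (intro mult_strict_left_mono) (auto simp: D_def)
  moreover have "0 \<le> (u - y) * (1 + \<mu> - \<xi> * (u + y))"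
  proof (rule mult_nonneg_nonneg)
    have "\<xi> * (u + y) \<le> \<xi> + \<xi> * y" using u pos mult_left_mono[of u 1 \<xi>] by (simp add: algebra_simps)
    then show "0 \<le> 1 + \<mu> - \<xi> * (u + y)" using xy small pos by linarith
  qed (use u in simp)
  ultimately show False using y(2) by (simp add: power2_eq_square algebra_simps)
qed

text \<open>The number \<open>\<eta>\<close> is proportional to the inverse of the estimated energy and \<open>\<eta>0\<close> to the inverse of the
true one. Replacing the former by the latter costs no more than doubling \<open>\<gamma>\<close> and \<open>\<eta>0\<close> in the denominator.\<close>

lemma plug_in_bound:
  fixes \<gamma> \<eta> \<eta>0 \<mu> \<xi> :: real
  assumes nn: "0 \<le> \<gamma>" "0 \<le> \<eta>0" "0 \<le> \<mu>" "0 \<le> \<xi>" "0 < \<gamma> + \<eta>0"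
    and small: "\<xi> + \<mu> + 2 * \<gamma> + 4 * \<eta>0 < 1"
    and \<eta>: "\<eta> \<le> \<eta>0 * (1 + (\<gamma> + \<eta>0) / (1 - \<mu> - \<gamma> - 2 * \<eta>0))"
  shows "\<xi> + \<mu> + \<gamma> + 2 * \<eta> < 1"
    and "(\<gamma> + \<eta>) / (1 - \<mu> - \<gamma> - 2 * \<eta>) \<le> (\<gamma> + \<eta>0) / (1 - \<mu> - 2 * \<gamma> - 4 * \<eta>0)"
proof -
  define D where "D = 1 - \<mu> - \<gamma> - 2 * \<eta>0"
  define P where "P = \<gamma> + \<eta>0"
  have D: "0 < D" "\<gamma> + 2 * \<eta>0 < D" using small nn by (auto simp: D_def)
  have \<eta>': "\<eta> * D \<le> \<eta>0 * (D + P)"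
  proof -
    have "\<eta> * D \<le> \<eta>0 * (1 + P / D) * D" using \<eta> D by (intro mult_right_mono) (auto simp: D_def P_def)
    also have "\<dots> = \<eta>0 * (D + P)" using D by (simp add: field_simps)
    finally show ?thesis .
  qed
  have "P / D \<le> 1" using D nn by (simp add: P_def)
  then have "\<eta>0 * (1 + P / D) \<le> \<eta>0 * 2" using nn by (intro mult_left_mono) auto
  then have "\<eta> \<le> 2 * \<eta>0" using \<eta> by (simp add: D_def P_def)
  then show small': "\<xi> + \<mu> + \<gamma> + 2 * \<eta> < 1" using small nn by linarith
  have den: "0 < 1 - \<mu> - \<gamma> - 2 * \<eta>" "0 < 1 - \<mu> - 2 * \<gamma> - 4 * \<eta>0" using small small' nn by linarith+
  have "(\<gamma> + \<eta>) * (D - \<gamma> - 2 * \<eta>0) \<le> P * (D + 2 * \<eta>0 - 2 * \<eta>)"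
  proof (rule mult_right_le_imp_le[OF _ D(1)])
    have "(\<gamma> + \<eta>) * (D - \<gamma> - 2 * \<eta>0) * D = (\<gamma> * D + \<eta> * D) * (D - \<gamma> - 2 * \<eta>0)" by (simp add: algebra_simps)
    also have "\<dots> \<le> (\<gamma> * D + \<eta>0 * (D + P)) * (D - \<gamma> - 2 * \<eta>0)"
      using \<eta>' D by (intro mult_right_mono) auto
    also have "\<dots> = P * ((D + \<eta>0) * (D - \<gamma> - 2 * \<eta>0))" by (simp add: P_def algebra_simps)
    also have "\<dots> \<le> P * (D * D + 2 * \<eta>0 * D - 2 * (\<eta>0 * (D + P)))"
    proof (rule mult_left_mono)
      have "\<eta>0 * \<gamma> \<le> D * \<gamma> + D * \<eta>0"
        using mult_right_mono[of \<eta>0 D \<gamma>] D nn mult_nonneg_nonneg[of D \<eta>0] by linarith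
      then show "(D + \<eta>0) * (D - \<gamma> - 2 * \<eta>0) \<le> D * D + 2 * \<eta>0 * D - 2 * (\<eta>0 * (D + P))"
        by (simp add: P_def algebra_simps)
    qed (use nn in \<open>simp add: P_def\<close>)
    also have "\<dots> \<le> P * (D * D + 2 * \<eta>0 * D - 2 * (\<eta> * D))"
      using \<eta>' nn by (intro mult_left_mono) (auto simp: P_def)
    also have "\<dots> = P * (D + 2 * \<eta>0 - 2 * \<eta>) * D" by (simp add: algebra_simps)
    finally show "(\<gamma> + \<eta>) * (D - \<gamma> - 2 * \<eta>0) * D \<le> P * (D + 2 * \<eta>0 - 2 * \<eta>) * D" .
  qed
  then have "(\<gamma> + \<eta>) * (1 - \<mu> - 2 * \<gamma> - 4 * \<eta>0) \<le> (\<gamma> + \<eta>0) * (1 - \<mu> - \<gamma> - 2 * \<eta>)"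
    by (simp add: D_def P_def algebra_simps)
  then show "(\<gamma> + \<eta>) / (1 - \<mu> - \<gamma> - 2 * \<eta>) \<le> (\<gamma> + \<eta>0) / (1 - \<mu> - 2 * \<gamma> - 4 * \<eta>0)"
    using den by (simp add: frac_le_eq divide_le_0_iff)
qed

lemma r_crit_scale: "r_crit n S l (\<alpha> *\<^sub>R \<theta>) = (1 / real n) * (\<Sum>i<n. psi (\<alpha>\<^sup>2 * (norm (psd_sqrt (S i) *v \<theta>))\<^sup>2 - l))"
  by (simp add: r_crit_def matrix_vector_mult_scaleR power_mult_distrib)

lemma r_crit_mono:
  assumes "0 \<le> \<alpha>" "\<alpha> \<le> \<beta>"
  shows "r_crit n S l (\<alpha> *\<^sub>R \<theta>) \<le> r_crit n S l (\<beta> *\<^sub>R \<theta>)"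
proof -
  have "\<alpha>\<^sup>2 \<le> \<beta>\<^sup>2" using assms by (intro power_mono) auto
  then show ?thesis unfolding r_crit_scale
    by (intro mult_left_mono sum_mono psi_mono diff_right_mono mult_right_mono) auto
qed

lemma isCont_psi: "isCont psi y"
  using continuous_psi by (simp add: continuous_on_eq_continuous_at)

lemma r_crit_isCont: "isCont (\<lambda>\<alpha>. r_crit n S l (\<alpha> *\<^sub>R \<theta>)) \<alpha>"
proof -
  have "isCont (\<lambda>\<alpha>. \<alpha>\<^sup>2 * x - l) \<alpha>" for x by simp
  then have "isCont (\<lambda>\<alpha>. psi (\<alpha>\<^sup>2 * (norm (psd_sqrt (S i) *v \<theta>))\<^sup>2 - l)) \<alpha>" for i
    using isCont_psi by (rule isCont_o2)
  then show ?thesis unfolding r_crit_scale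
    by (intro continuous_mult continuous_sum continuous_const)
qed

text \<open>All that matters about the estimator: the criterion is nonpositive up to the scale \<open>(l/s)\<^sup>1\<^sup>/\<^sup>2\<close> whenever \<open>s\<close> is
at least the estimate, and it is nonnegative at the scale that defines a positive estimate. The
set of scales in the definition is an interval containing a neighbourhood of 0, because \<open>\<psi>(-l) < 0\<close>.\<close>

lemma N_tilde_characterisation:
  assumes n: "1 \<le> n" and l: "0 < l"
  shows "\<And>s \<alpha>. N_tilde n S l \<theta> \<le> s \<Longrightarrow> 0 < s \<Longrightarrow> 0 \<le> \<alpha> \<Longrightarrow> \<alpha>\<^sup>2 * s \<le> l \<Longrightarrow> r_crit n S l (\<alpha> *\<^sub>R \<theta>) \<le> 0"
    and "0 < N_tilde n S l \<theta> \<Longrightarrow> 0 \<le> r_crit n S l (sqrt (l / N_tilde n S l \<theta>) *\<^sub>R \<theta>)"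
proof -
  let ?r = "\<lambda>\<alpha>. r_crit n S l (\<alpha> *\<^sub>R \<theta>)"
  define I where "I = {\<alpha>. 0 \<le> \<alpha> \<and> ?r \<alpha> \<le> 0}"
  define a where "a = alpha_hat n S l \<theta>"
  have a_eq: "a = Sup (ereal ` I)" by (simp add: a_def alpha_hat_def I_def)
  have below: "?r \<alpha> \<le> 0" if nn: "0 \<le> \<alpha>" and lt: "ereal \<alpha> < a" for \<alpha>
  proof -
    obtain \<beta> where "\<beta> \<in> I" "\<alpha> < \<beta>" using lt unfolding a_eq less_Sup_iff by auto
    then show ?thesis using r_crit_mono[of \<alpha> \<beta> n S l \<theta>] nn by (auto simp: I_def)
  qed
  have r0: "?r 0 < 0"
  proof -
    have "psi (- l) < 0"
    proof -
      define m where "m = min l 1"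
      have m: "0 < m" "m \<le> 1" "m \<le> l" using l by (auto simp: m_def)
      have "psi (- l) \<le> psi (- m)" using m by (intro psi_mono) auto
      also have "\<dots> = psi_top (- m)" using m by (intro psi_eq_top) auto
      also have "\<dots> < 0"
      proof -
        have "m\<^sup>2 \<le> m" using m by (simp add: power2_eq_square mult_left_le)
        then show ?thesis using quad_pos[of "-m"] m unfolding psi_top_def by (subst ln_less_zero_iff) auto
      qed
      finally show ?thesis .
    qed
    then show ?thesis using n r_crit_scale[of n S l 0 \<theta>] by simp
  qed
  have a_pos: "0 < a"
  proof -
    have "\<forall>\<^sub>F \<alpha> in at_right 0. ?r \<alpha> < 0"
      using order_tendstoD(2)[OF r_crit_isCont[of 0 n S l \<theta>, unfolded isCont_def] r0]
      by (rule filter_leD[OF at_le, rotated]) auto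
    moreover have "\<forall>\<^sub>F \<alpha> in at_right (0::real). 0 < \<alpha>" by (simp add: eventually_at_right_less)
    ultimately have "\<forall>\<^sub>F \<alpha> in at_right 0. 0 < \<alpha> \<and> ?r \<alpha> < 0" by eventually_elim simp
    then obtain \<alpha> where \<alpha>: "0 < \<alpha>" "?r \<alpha> < 0" using eventually_happens[of _ "at_right (0::real)"] by auto
    then have "ereal \<alpha> \<le> a" unfolding a_eq by (intro Sup_upper) (auto simp: I_def)
    then show ?thesis using \<alpha> by (metis ereal_less(2) less_le_trans)
  qed
  show "?r \<alpha> \<le> 0" if s: "N_tilde n S l \<theta> \<le> s" "0 < s" and \<alpha>: "0 \<le> \<alpha>" "\<alpha>\<^sup>2 * s \<le> l" for s \<alpha>
  proof (cases "a = \<infinity>")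
    case True
    then show ?thesis using below \<alpha> by simp
  next
    case False
    then obtain a' where a': "a = ereal a'" "0 < a'" using a_pos by (cases a) auto
    have Nt: "N_tilde n S l \<theta> = l / a'\<^sup>2" using a' by (simp add: N_tilde_def flip: a_def)
    have "\<alpha>\<^sup>2 * (l / a'\<^sup>2) \<le> \<alpha>\<^sup>2 * s" using s Nt by (intro mult_left_mono) auto
    then have "(\<alpha>\<^sup>2 * l) / a'\<^sup>2 \<le> l" using \<alpha> by simp
    then have "\<alpha>\<^sup>2 * l \<le> a'\<^sup>2 * l" using a' by (subst (asm) pos_divide_le_eq) (auto simp: mult.commute)
    then have "\<alpha>\<^sup>2 \<le> a'\<^sup>2" using l by simp
    then have "\<alpha> \<le> a'" by (rule power2_le_imp_le) (use a' in simp)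
    moreover have "?r a' \<le> 0"
    proof (rule tendsto_upperbound)
      show "(?r \<longlongrightarrow> ?r a') (at_left a')"
        using r_crit_isCont[of a' n S l \<theta>] unfolding isCont_def by (rule filterlim_mono) (auto intro: at_le)
      show "\<forall>\<^sub>F \<alpha> in at_left a'. ?r \<alpha> \<le> 0"
        using eventually_at_left_real[OF a'(2)] by eventually_elim (use below a' in auto)
    qed simp
    ultimately show ?thesis using r_crit_mono[of \<alpha> a' n S l \<theta>] \<alpha> by linarith
  qed
  show "0 \<le> ?r (sqrt (l / N_tilde n S l \<theta>))" if pos: "0 < N_tilde n S l \<theta>"
  proof -
    have "a \<noteq> \<infinity>" using pos by (auto simp: N_tilde_def a_def)
    then obtain a' where a': "a = ereal a'" "0 < a'" using a_pos by (cases a) auto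
    have Nt: "N_tilde n S l \<theta> = l / a'\<^sup>2" using a' by (simp add: N_tilde_def flip: a_def)
    have sq: "sqrt (l / N_tilde n S l \<theta>) = a'" using a' l by (simp add: Nt)
    have "0 \<le> ?r a'"
    proof (rule tendsto_lowerbound)
      show "(?r \<longlongrightarrow> ?r a') (at_right a')"
        using r_crit_isCont[of a' n S l \<theta>] unfolding isCont_def by (rule filterlim_mono) (auto intro: at_le)
      have "0 < ?r \<alpha>" if "a' < \<alpha>" for \<alpha>
      proof (rule ccontr)
        assume "\<not> 0 < ?r \<alpha>"
        then have "ereal \<alpha> \<le> a" unfolding a_eq using that a' by (intro Sup_upper) (auto simp: I_def)
        then show False using that a' by simp
      qed
      then show "\<forall>\<^sub>F \<alpha> in at_right a'. 0 \<le> ?r \<alpha>"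
        using eventually_at_right_less[of a'] by (auto elim!: eventually_mono intro: less_imp_le)
    qed simp
    then show ?thesis unfolding sq .
  qed
qed

section \<open>Numerical constants and the choice on the grid\<close>

lemma exp_le_taylor8:
  assumes "0 \<le> x" "x \<le> 1"
  shows "exp x \<le> (\<Sum>m<8. x ^ m / fact m) + 3 / fact 8 * (x::real) ^ 8"
proof -
  obtain t where t: "\<bar>t\<bar> \<le> \<bar>x\<bar>" "exp x = (\<Sum>m<8. x ^ m / fact m) + exp t / fact 8 * x ^ 8"
    using Maclaurin_exp_le[of x 8] by auto
  have "exp t \<le> exp 1" using t assms by auto
  also have "exp 1 \<le> (3::real)" using e_less_272 by simp
  finally have "exp t \<le> 3" .
  then have "exp t / fact 8 * x ^ 8 \<le> 3 / fact 8 * x ^ 8"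
    using assms by (intro mult_right_mono divide_right_mono) auto
  then show ?thesis using t by simp
qed

lemma ln2_ge: "0.69314 \<le> ln (2::real)"
proof -
  have "exp (0.34657::real) \<le> 1.41421"
    by (rule order_trans[OF exp_le_taylor8]) (simp_all add: lessThan_nat_numeral fact_numeral power_divide)
  then have "exp (0.34657::real) ^ 2 \<le> 1.41421 ^ 2" by (intro power_mono) auto
  then have "exp (0.69314::real) \<le> 2" by (simp add: power2_eq_square flip: exp_add)
  then have "ln (exp (0.69314::real)) \<le> ln 2" by (subst ln_le_cancel_iff) auto
  then show ?thesis by simp
qed

lemma c_const_le: "c_const \<le> 44.29"
proof -
  have e: "exp (0.47855340::real) \<le> 1.613739"
    by (rule order_trans[OF exp_le_taylor8]) (simp_all add: lessThan_nat_numeral fact_numeral power_divide)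
  have "exp ((1 + 2 * sqrt 2) / 2) \<le> exp (4 * 0.47855340 :: real)"
    using sqrt2_bounds by simp
  also have "\<dots> = exp 0.47855340 ^ 4" using exp_of_nat_mult[of 4 "0.47855340::real"] by simp
  also have "\<dots> \<le> 1.613739 ^ 4" using e by (intro power_mono) auto
  also have "\<dots> \<le> 6.7818" by (simp add: power4_eq_xxxx)
  finally have e2: "exp ((1 + 2 * sqrt 2) / 2) \<le> (6.7818::real)" .
  have "0.69314 * 0.41421356 \<le> ln 2 * (sqrt 2 - 1::real)"
    using ln2_ge sqrt2_bounds by (intro mult_mono) auto
  then have "15 / (8 * ln 2 * (sqrt 2 - 1)) \<le> 15 / (8 * (0.69314 * 0.41421356 :: real))"
    using sqrt2_bounds by (intro divide_left_mono) (linarith, simp_all)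
  then have "c_const \<le> 15 / (8 * (0.69314 * 0.41421356)) * 6.7818"
    unfolding c_const_def using e2 by (intro mult_mono) auto
  also have "\<dots> \<le> 44.29" by simp
  finally show ?thesis .
qed

lemma cosh_quarter: "cosh (1/4) \<le> (1.03142::real)"
proof -
  have u: "exp (1/4::real) \<le> 1.284026"
    by (rule order_trans[OF exp_le_taylor8]) (simp_all add: lessThan_nat_numeral fact_numeral power_divide)
  have "(\<Sum>m<6. (1/4) ^ m / fact m) \<le> exp (1/4::real)"
  proof -
    obtain t where "exp (1/4::real) = (\<Sum>m<6. (1/4) ^ m / fact m) + exp t / fact 6 * (1/4) ^ 6"
      using Maclaurin_exp_le[of "1/4" 6] by auto
    then show ?thesis by simp
  qed
  then have l: "1.28402 \<le> exp (1/4::real)" by (simp add: lessThan_nat_numeral fact_numeral power_divide)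
  then have "exp (- (1/4)) \<le> (1 / 1.28402::real)"
    unfolding exp_minus inverse_eq_divide by (intro divide_left_mono) auto
  then show ?thesis using u by (simp add: cosh_def)
qed

lemma numerical_constants:
  "2 * (2 + c_const) * (cosh (1/4))\<^sup>2 \<le> 98.5"
  "1 + cosh (1/4 :: real) \<le> 2.032"
  "(2 + 3 * c_const) / (4 * (2 + c_const)) \<le> 0.73"
  "72 * (2 + c_const) \<le> 36 * 98.5"
proof -
  have "(cosh (1/4::real))\<^sup>2 \<le> 1.03142\<^sup>2" using cosh_quarter by (intro power_mono) auto
  then have "2 * (2 + c_const) * (cosh (1/4))\<^sup>2 \<le> 2 * (2 + 44.29) * 1.03142\<^sup>2"
    using c_const_le c_const_pos by (intro mult_mono) auto
  then show "2 * (2 + c_const) * (cosh (1/4))\<^sup>2 \<le> 98.5" by (simp add: power2_eq_square)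
  show "1 + cosh (1/4 :: real) \<le> 2.032" using cosh_quarter by simp
  show "(2 + 3 * c_const) / (4 * (2 + c_const)) \<le> 0.73"
    using c_const_le c_const_pos by (subst pos_divide_le_eq) auto
  show "72 * (2 + c_const) \<le> 36 * 98.5" using c_const_le by simp
qed

text \<open>Without the factor \<open>exp w\<close> the parameter \<open>b\<close> would make the two terms equal, which is optimal; a logarithmic error of \<open>w\<close>
costs a factor \<open>cosh w\<close>.\<close>

lemma beta_optimisation:
  fixes B n t w :: real
  assumes pos: "0 < B" "0 < n" "0 < t" and w: "0 \<le> w" "w \<le> 1/4"
    and b: "b = sqrt (2 * B * n * t) * exp w"
  shows "B / b + b / (2 * n * t) \<le> sqrt (2 * B * (cosh (1/4))\<^sup>2 / t) / sqrt n"
proof -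
  define R where "R = sqrt (2 * B * n * t)"
  have R: "0 < R" "R * R = 2 * B * n * t" using pos by (auto simp: R_def)
  have "B / b = R / (2 * n * t) * exp (- w)"
    using R pos unfolding b R_def[symmetric] by (simp add: exp_minus field_simps)
  then have "B / b + b / (2 * n * t) = R / (n * t) * cosh w"
    unfolding b R_def[symmetric] using pos by (simp add: cosh_def field_simps)
  also have "\<dots> \<le> R / (n * t) * cosh (1/4)"
    using w R pos by (intro mult_left_mono) (auto simp: cosh_real_nonneg_le_iff)
  also have "\<dots> \<le> sqrt (2 * B * (cosh (1/4))\<^sup>2 / t / n)"
  proof (rule real_le_rsqrt)
    have "(R / (n * t) * cosh (1/4))\<^sup>2 = (R * R) * (cosh (1/4))\<^sup>2 / (n * t)\<^sup>2"
      by (simp add: power2_eq_square)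
    also have "\<dots> = 2 * B * (cosh (1/4))\<^sup>2 / t / n"
      unfolding R using pos by (simp add: power2_eq_square mult_ac)
    finally show "(R / (n * t) * cosh (1/4))\<^sup>2 \<le> 2 * B * (cosh (1/4))\<^sup>2 / t / n" by simp
  qed
  finally show ?thesis by (simp only: real_sqrt_divide)
qed

text \<open>Choosing \<open>l\<close> optimally for \<open>P\<close> while the actual numerator is \<open>Q\<close> costs the factor \<open>(\<rho> + 2 + 1/\<rho>)/4\<close>
with \<open>\<rho> = P/Q\<close> in the squared bound, and this factor is largest at the end of the range, \<open>\<rho> = exp (1/4)\<close>.\<close>

lemma lambda_optimisation:
  fixes P Q R k n l :: real
  assumes pos: "0 < Q" "0 < k" "0 < n" and PQ: "Q \<le> P" "P \<le> exp (1/4) * Q" and QR: "Q \<le> R"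
    and l: "l = sqrt (2 * P / (k * n))"
  shows "l / 2 * k + Q / (n * l) \<le> sqrt ((1 + cosh (1/4)) * k * R) / sqrt n"
proof -
  have P: "0 < P" using pos PQ by simp
  then have l2: "l * l = 2 * P / (k * n)" and lp: "0 < l" using l pos by auto
  have "(l / 2 * k + Q / (n * l))\<^sup>2 \<le> (1 + cosh (1/4)) * k * R / n"
  proof -
    have lk: "l / 2 * k = P / (n * l)"
      using l2 lp pos by (simp add: field_simps)
    have "(l / 2 * k + Q / (n * l))\<^sup>2 = (P + Q)\<^sup>2 / (n\<^sup>2 * (l * l))"
      unfolding lk using lp pos by (simp add: power2_eq_square field_simps)
    also have "\<dots> = k / (2 * n) * ((P + Q)\<^sup>2 / P)"
      unfolding l2 using P pos by (simp add: power2_eq_square mult_ac)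
    also have "\<dots> \<le> k / (2 * n) * (2 * (1 + cosh (1/4)) * Q)"
    proof (rule mult_left_mono)
      define m where "m = exp (1/4 :: real)"
      have m: "0 < m" "1 \<le> m" "2 * cosh (1/4) = m + 1 / m" by (auto simp: m_def cosh_def exp_minus inverse_eq_divide)
      have "0 \<le> (P - Q / m) * (Q * m - P)"
      proof (rule mult_nonneg_nonneg)
        have "Q / m \<le> Q" using pos m by (simp add: divide_le_eq)
        then show "0 \<le> P - Q / m" using PQ by simp
        show "0 \<le> Q * m - P" using PQ by (simp add: m_def mult.commute)
      qed
      then have "P * P + Q * Q \<le> P * Q * (m + 1 / m)" using m by (simp add: field_simps)
      then have "(P + Q)\<^sup>2 \<le> (2 * (1 + cosh (1/4)) * Q) * P"
        using m(3) by (simp add: power2_eq_square algebra_simps)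
      then show "(P + Q)\<^sup>2 / P \<le> 2 * (1 + cosh (1/4)) * Q" using P by (simp add: pos_divide_le_eq)
    qed (use pos in simp)
    also have "\<dots> \<le> k / (2 * n) * (2 * (1 + cosh (1/4)) * R)"
      using QR pos by (intro mult_left_mono) (auto intro: add_nonneg_nonneg)
    also have "\<dots> = (1 + cosh (1/4)) * k * R / n" using pos by (simp add: field_simps)
    finally show ?thesis .
  qed
  then have "l / 2 * k + Q / (n * l) \<le> sqrt ((1 + cosh (1/4)) * k * R / n)" by (rule real_le_rsqrt)
  then show ?thesis by (simp add: real_sqrt_divide)
qed

lemma nearest_grid_index:
  fixes L :: real and K :: int
  assumes "0 \<le> L" and K: "2 * L \<le> real_of_int (K - 1)"
  obtains j :: nat where "int j < K" "\<bar>real j / 2 - L\<bar> \<le> 1/4"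
proof -
  define j where "j = nat (round (2 * L))"
  have r: "0 \<le> round (2 * L)" using assms round_mono[of 0 "2 * L"] by simp
  then have j: "real j = real_of_int (round (2 * L))" by (simp add: j_def)
  have d: "\<bar>real_of_int (round (2 * L)) - 2 * L\<bar> \<le> 1/2"
    by (rule of_int_round_abs_le)
  have "int j < K"
  proof (rule ccontr)
    assume "\<not> int j < K"
    then have "real_of_int K \<le> real j" by (metis not_less of_int_le_iff of_int_of_nat_eq)
    then show False using d K unfolding j by simp
  qed
  moreover have "\<bar>real j / 2 - L\<bar> \<le> 1/4" using d unfolding j abs_le_iff by simp
  ultimately show ?thesis by (rule that)
qed

context gram_sample
begin

lemma finite_Lambda: "finite (Lambda M A n \<epsilon>)"
  and card_Lambda_le: "card (Lambda M A n \<epsilon>) \<le> nat (K_grid M A n)"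
proof -
  let ?f = "\<lambda>j. (lambda_grid M A n \<epsilon> j, beta_grid M A n j)"
  have eq: "Lambda M A n \<epsilon> = ?f ` {..<nat (K_grid M A n)}"
    unfolding Lambda_def by (auto simp: zless_nat_eq_int_zless)
  show "finite (Lambda M A n \<epsilon>)" unfolding eq by simp
  show "card (Lambda M A n \<epsilon>) \<le> nat (K_grid M A n)"
    unfolding eq using card_image_le[of "{..<nat (K_grid M A n)}" ?f] by simp
qed

lemma Lambda_nonempty: "1 \<le> K_grid M A n \<Longrightarrow> Lambda M A n \<epsilon> \<noteq> {}"
  unfolding Lambda_def by (auto intro: exI[of _ "0::nat"])

text \<open>Distinct indices might in principle give the same pair of parameters, so only an inequality is
claimed between the size of the grid and the number of indices.\<close>

lemma ln_card_Lambda_le: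
  assumes "1 \<le> K_grid M A n" "0 < \<epsilon>" "\<epsilon> < 1"
  shows "0 < ln (real (card (Lambda M A n \<epsilon>)) / \<epsilon>)"
    "ln (real (card (Lambda M A n \<epsilon>)) / \<epsilon>) \<le> ln (real_of_int (K_grid M A n) / \<epsilon>)"
proof -
  have c: "1 \<le> card (Lambda M A n \<epsilon>)"
    using Lambda_nonempty[OF assms(1)] finite_Lambda by (simp add: Suc_le_eq card_gt_0_iff)
  have "1 < real (card (Lambda M A n \<epsilon>)) / \<epsilon>" using c assms by (simp add: less_divide_eq)
  then show "0 < ln (real (card (Lambda M A n \<epsilon>)) / \<epsilon>)" by (rule ln_gt_zero)
  have "real (card (Lambda M A n \<epsilon>)) \<le> real_of_int (K_grid M A n)"
    using card_Lambda_le[of \<epsilon>] assms by linarith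
  then show "ln (real (card (Lambda M A n \<epsilon>)) / \<epsilon>) \<le> ln (real_of_int (K_grid M A n) / \<epsilon>)"
    using c assms by (subst ln_le_cancel_iff) (auto intro: divide_right_mono)
qed

text \<open>The index \<open>j\<close> is the nearest to \<open>2 ln (s\<^sub>4\<^sup>2/t)\<close>; the hypothesis on \<open>n\<close> says that it belongs to the grid.
The rounding error \<open>v\<close> lies in \<open>[-1/4, 1/4]\<close>. As \<open>\<beta>\<^sub>j\<close> is tuned to \<open>j - 1/2\<close> instead of \<open>j\<close>, its logarithmic
error lies in \<open>[0, 1/4]\<close>, and the trace term that \<open>\<lambda>\<^sub>j\<close> balances is the actual one multiplied by \<open>exp (1/4)\<close>.\<close>

lemma grid_optimised:
  assumes kappa: "1 < kappa M A" and K: "1 \<le> K_grid M A n" and \<epsilon>: "0 < \<epsilon>" "\<epsilon> < 1"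
    and t: "0 < t" "t \<le> (s4 M A)\<^sup>2"
    and n: "72 * (2 + c_const) * sqrt (kappa M A) * (s4 M A)\<^sup>2 / t \<le> n"
  obtains l b where "(l, b) \<in> Lambda M A n \<epsilon>" "0 < l" "0 < b"
    "gam M A n \<epsilon> l b + l * delta n l b / t \<le> zeta_star M A n \<epsilon> t / sqrt n"
proof -
  define S where "S = (s4 M A)\<^sup>2"
  define k where "k = sqrt (kappa M A)"
  have S: "0 < S" using t unfolding S_def by linarith
  have ES: "E_op2 M A = S\<^sup>2" "sqrt (E_op2 M A) = S"
    using E_op2_nonneg s4_sq by (auto simp: S_def)
  have k: "0 < k" using kappa by (simp add: k_def)
  have c: "0 < 2 + c_const" using c_const_pos by simp
  have n0: "0 < real n" using n_pos by simp
  define L where "L = ln (S / t)"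
  have L: "0 \<le> L" "exp L = S / t" using t S by (auto simp: L_def S_def)
  have "2 * L \<le> real_of_int (K_grid M A n - 1)"
  proof -
    have "72 * (2 + c_const) * k * (S / t) \<le> n" using n by (simp add: S_def k_def)
    then have "S / t \<le> n / (72 * (2 + c_const) * k)"
      using c k by (subst pos_le_divide_eq) (auto simp: mult_ac)
    then have "L \<le> ln (n / (72 * (2 + c_const) * k))" unfolding L_def using t S by (intro ln_mono) auto
    then have "2 * L \<le> (1 / a_step) * ln (n / (72 * (2 + c_const) * k))" by (simp add: a_step_def)
    also have "\<dots> \<le> real_of_int (K_grid M A n - 1)"
      unfolding K_grid_def k_def using le_of_int_ceiling by simp
    finally show ?thesis .
  qed
  then obtain j :: nat where j: "int j < K_grid M A n" "\<bar>real j / 2 - L\<bar> \<le> 1/4"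
    using nearest_grid_index[OF L(1)] by metis
  define v where "v = real j / 2 - L"
  have v: "-1/4 \<le> v" "v \<le> 1/4" using j(2) unfolding v_def by linarith+
  have ej: "exp (real j * a_step) = exp v * (S / t)"
  proof -
    have "real j * a_step = v + L" by (simp add: v_def a_step_def)
    then show ?thesis by (simp add: exp_add L)
  qed
  define l where "l = lambda_grid M A n \<epsilon> j"
  define b where "b = beta_grid M A n j"
  have mem: "(l, b) \<in> Lambda M A n \<epsilon>" using j by (auto simp: Lambda_def l_def b_def)
  define B where "B = (2 + c_const) * k * S"
  have B: "0 < B" using c k S by (simp add: B_def)
  define w where "w = (1/4 - v) / 2"
  have w: "0 \<le> w" "w \<le> 1/4" using v by (auto simp: w_def)
  have ew: "exp (- ((real j - 1 / 2) * a_step)) = t / S * exp (2 * w)"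
  proof -
    have "- ((real j - 1 / 2) * a_step) = - L + 2 * w" by (simp add: v_def a_step_def w_def algebra_simps)
    then show ?thesis using L by (simp add: exp_diff)
  qed
  have b_eq: "b = sqrt (2 * B * n * t) * exp w"
  proof -
    have "2 * (2 + c_const) * sqrt (kappa M A) * E_op2 M A * real n * (t / S * exp (2 * w)) = (2 * B * n * t) * (exp w)\<^sup>2"
      using S by (simp add: ES B_def k_def power2_eq_square flip: exp_add)
    then show ?thesis unfolding b_def beta_grid_def ew by (simp add: real_sqrt_mult)
  qed
  have b: "0 < b" unfolding b_eq using B n0 t by simp
  have b2: "b\<^sup>2 = 2 * B * n * t * exp (2 * w)"
    unfolding b_eq using B n0 t by (simp add: power_mult_distrib exp_double)
  define Lg where "Lg = ln (real_of_int (K_grid M A n) / \<epsilon>)"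
  note lc = ln_card_Lambda_le[OF K \<epsilon>, folded Lg_def]
  have Lg: "0 < Lg" using lc by simp
  define T0 where "T0 = (2 + 3 * c_const) * E_tr2 M A / (4 * (2 + c_const) * k * S * t)"
  have T0: "0 \<le> T0" unfolding T0_def using c_const_pos E_tr2_nonneg k S t by simp
  define P where "P = T0 * exp v + Lg"
  define Q where "Q = T0 * exp (v - 1/4) + Lg"
  have l_eq: "l = sqrt (2 * P / ((kappa M A - 1) * n))"
  proof -
    have "(2 + 3 * c_const) * E_tr2 M A / (4 * (2 + c_const) * sqrt (kappa M A) * E_op2 M A) * (exp v * (S / t)) = T0 * exp v"
      using S t k by (simp add: T0_def ES k_def power2_eq_square)
    then show ?thesis unfolding l_def lambda_grid_def ej by (simp add: P_def Lg_def)
  qed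
  have PQ: "0 < Q" "Q \<le> P" "P \<le> exp (1/4) * Q" "Q \<le> T0 + Lg"
  proof -
    show "0 < Q" unfolding Q_def using T0 Lg by (intro add_nonneg_pos) auto
    show "Q \<le> P" unfolding P_def Q_def using T0 by (simp add: mult_left_mono)
    have "exp (1/4) * Q = T0 * exp v + exp (1/4) * Lg"
      unfolding Q_def by (simp add: exp_diff algebra_simps)
    moreover have "Lg \<le> exp (1/4) * Lg" using Lg by simp
    ultimately show "P \<le> exp (1/4) * Q" unfolding P_def by simp
    have "T0 * exp (v - 1/4) \<le> T0 * 1" using T0 v by (intro mult_left_mono) auto
    then show "Q \<le> T0 + Lg" unfolding Q_def by simp
  qed
  have l: "0 < l" unfolding l_eq using PQ kappa n0 by simp
  have lam: "l / 2 * (kappa M A - 1) + Q / (n * l) \<le> sqrt ((1 + cosh (1/4)) * (kappa M A - 1) * (T0 + Lg)) / sqrt n"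
    by (rule lambda_optimisation[OF PQ(1) _ n0 PQ(2,3,4) l_eq]) (use kappa in simp)
  have bet: "B / b + b / (2 * real n * t) \<le> sqrt (2 * B * (cosh (1/4))\<^sup>2 / t) / sqrt n"
    by (rule beta_optimisation[OF B n0 t(1) w b_eq])
  have tr: "(2 + 3 * c_const) * E_tr2 M A / (2 * b\<^sup>2 * l) = T0 * exp (v - 1/4) / (n * l)"
  proof -
    have "exp (v - 1/4) * exp (2 * w) = 1" by (simp add: w_def field_simps flip: exp_add)
    then have inv: "exp (v - 1/4) = 1 / exp (2 * w)" by (simp add: eq_divide_eq)
    show ?thesis unfolding b2 T0_def B_def inv by (simp add: mult_ac)
  qed
  have "gam M A n \<epsilon> l b + l * delta n l b / t =
      (l / 2 * (kappa M A - 1) + (T0 * exp (v - 1/4) / (n * l) + ln (real (card (Lambda M A n \<epsilon>)) / \<epsilon>) / (n * l)))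
      + (B / b + b / (2 * real n * t))"
    unfolding gam_def delta_def tr using l by (simp add: B_def S_def k_def)
  also have "T0 * exp (v - 1/4) / (n * l) + ln (real (card (Lambda M A n \<epsilon>)) / \<epsilon>) / (n * l) \<le> Q / (n * l)"
    unfolding Q_def add_divide_distrib using lc l n0 by (intro add_left_mono divide_right_mono) auto
  finally have "gam M A n \<epsilon> l b + l * delta n l b / t
      \<le> sqrt ((1 + cosh (1/4)) * (kappa M A - 1) * (T0 + Lg)) / sqrt n + sqrt (2 * B * (cosh (1/4))\<^sup>2 / t) / sqrt n"
    using lam bet by simp
  also have "\<dots> \<le> zeta_star M A n \<epsilon> t / sqrt n"
  proof -
    have "T0 + Lg \<le> 0.73 * E_tr2 M A / (k * S * t) + ln (real_of_int (K_grid M A n)) + ln (1 / \<epsilon>)"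
    proof -
      have "T0 = (2 + 3 * c_const) / (4 * (2 + c_const)) * (E_tr2 M A / (k * S * t))"
        unfolding T0_def by simp
      also have "\<dots> \<le> 0.73 * (E_tr2 M A / (k * S * t))"
        using numerical_constants(3) E_tr2_nonneg k S t by (intro mult_right_mono) auto
      finally show ?thesis unfolding Lg_def using K \<epsilon> by (simp add: ln_div)
    qed
    then have f1: "(1 + cosh (1/4)) * (kappa M A - 1) * (T0 + Lg) \<le>
       2.032 * (kappa M A - 1) * (0.73 * E_tr2 M A / (k * S * t) + ln (real_of_int (K_grid M A n)) + ln (1 / \<epsilon>))"
      using numerical_constants(2) kappa T0 Lg by (intro mult_mono mult_right_mono) auto
    have f2: "2 * B * (cosh (1/4))\<^sup>2 / t \<le> 98.5 * k * S / t"
    proof -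
      have "2 * B * (cosh (1/4))\<^sup>2 = (2 * (2 + c_const) * (cosh (1/4))\<^sup>2) * (k * S)" by (simp add: B_def)
      also have "\<dots> \<le> 98.5 * (k * S)" using numerical_constants(1) k S by (intro mult_right_mono) auto
      finally have "2 * B * (cosh (1/4))\<^sup>2 / t \<le> 98.5 * (k * S) / t"
        using t(1) by (intro divide_right_mono) auto
      then show ?thesis by (simp only: mult.assoc)
    qed
    show ?thesis
      unfolding zeta_star_def ES(2) k_def[symmetric] add_divide_distrib[symmetric]
      by (rule divide_right_mono[OF add_mono[OF real_sqrt_le_mono[OF f1] real_sqrt_le_mono[OF f2]]]) simp
  qed
  finally show ?thesis using that mem l b by blast
qed

end

section \<open>Comparing the estimator with the energy\<close>

context gram_sample
begin

text \<open>The deviation inequality in the normalised variable \<open>N(\<theta>)/l\<close>, expanded around 1.\<close>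

definition concentrated :: "'w \<Rightarrow> real \<Rightarrow> real \<Rightarrow> real \<Rightarrow> real \<Rightarrow> bool" where
  "concentrated \<omega> \<epsilon> l b s \<longleftrightarrow> (\<forall>\<theta>. s * r_crit n (\<lambda>i. As i \<omega>) l \<theta> \<le>
    l * (s * (N M A \<theta> / l - 1) + gam M A n \<epsilon> l b + mu M A l b * (N M A \<theta> / l - 1)
      + xi M A l * (N M A \<theta> / l - 1)\<^sup>2 + delta n l b * (norm \<theta>)\<^sup>2))"

text \<open>With \<open>x = N(\<theta>)/l - 1\<close> the term \<open>(\<kappa> N\<^sup>2 - 2 l N + l\<^sup>2)/2\<close> of \<open>drift_bound\<close> is \<open>l\<^sup>2/2\<close> times
\<open>(\<kappa> - 1) + 2 (\<kappa> - 1) x + \<kappa> x\<^sup>2\<close>; this is how \<open>\<gamma>\<close>, \<open>\<mu>\<close> and \<open>\<xi>\<close> arise.\<close>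

lemma concentrated_event:
  assumes l: "0 < l" and b: "0 < b" and \<epsilon>: "0 < \<epsilon>" and K: "1 \<le> K_grid M A n" and s: "s = 1 \<or> s = -1"
  defines "k \<equiv> real (card (Lambda M A n \<epsilon>))"
  shows "\<exists>E\<in>sets M. 1 - \<epsilon> / k \<le> prob E \<and> (\<forall>\<omega>\<in>E. concentrated \<omega> \<epsilon> l b s)"
proof -
  have k: "0 < k" using Lambda_nonempty[OF K] finite_Lambda by (simp add: k_def card_gt_0_iff)
  have n0: "0 < real n" using n_pos by simp
  have eq: "s * (N M A \<theta> - l) + drift_bound b l \<theta> + b * (norm \<theta>)\<^sup>2 / (2 * n) + ln (1 / (\<epsilon> / k)) / n =
     l * (s * (N M A \<theta> / l - 1) + gam M A n \<epsilon> l b + mu M A l b * (N M A \<theta> / l - 1)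
      + xi M A l * (N M A \<theta> / l - 1)\<^sup>2 + delta n l b * (norm \<theta>)\<^sup>2)" for \<theta>
  proof -
    define x where "x = N M A \<theta> / l - 1"
    have N: "N M A \<theta> = l * (1 + x)" using l by (simp add: x_def)
    define C where "C = (2 + c_const) * sqrt (kappa M A) * (s4 M A)\<^sup>2 / b"
    define D where "D = (2 + 3 * c_const) * E_tr2 M A / (2 * b\<^sup>2)"
    define g where "g = ln (k / \<epsilon>) / n"
    have g: "gam M A n \<epsilon> l b = l / 2 * (kappa M A - 1) + C + D / l + g / l"
      unfolding gam_def C_def D_def g_def k_def by simp
    have m: "mu M A l b = l * (kappa M A - 1) + C" unfolding mu_def C_def by simp
    have d: "delta n l b * (norm \<theta>)\<^sup>2 = (b * (norm \<theta>)\<^sup>2 / (2 * n)) / l" unfolding delta_def by simp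
    have dr: "drift_bound b l \<theta> = (kappa M A * (l * (1 + x))\<^sup>2 - 2 * l * (l * (1 + x)) + l\<^sup>2) / 2 + C * (l * (1 + x)) + D"
      unfolding drift_bound_def C_def D_def N by simp
    show ?thesis
      unfolding x_def[symmetric] g m d xi_def dr N using l \<epsilon> k
      by (simp add: g_def field_simps power2_eq_square)
  qed
  show ?thesis
    using deviation_event[OF s b, of "\<epsilon> / k" l] \<epsilon> k unfolding eq concentrated_def by simp
qed

lemma all_concentrated_event:
  assumes K: "1 \<le> K_grid M A n" and \<epsilon>: "0 < \<epsilon>"
    and pos: "\<And>l b. (l, b) \<in> Lambda M A n \<epsilon> \<Longrightarrow> 0 < l \<and> 0 < b"
  shows "\<exists>E\<in>sets M. 1 - 2 * \<epsilon> \<le> prob E \<and> (\<forall>\<omega>\<in>E. \<forall>(l, b)\<in>Lambda M A n \<epsilon>. \<forall>s\<in>{1, -1}. concentrated \<omega> \<epsilon> l b s)"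
proof -
  define k where "k = real (card (Lambda M A n \<epsilon>))"
  have k: "0 < k" using Lambda_nonempty[OF K] finite_Lambda by (simp add: k_def card_gt_0_iff)
  define I where "I = Lambda M A n \<epsilon> \<times> {1, -1 :: real}"
  define dev where "dev \<omega> p \<longleftrightarrow> (case p of ((l, b), s) \<Rightarrow> concentrated \<omega> \<epsilon> l b s)" for \<omega> p
  have fin: "finite I" and card: "real (card I) = 2 * k"
    using finite_Lambda by (auto simp: I_def k_def card_cartesian_product)
  have "\<forall>p\<in>I. \<exists>E. E \<in> sets M \<and> 1 - \<epsilon> / k \<le> prob E \<and> (\<forall>\<omega>\<in>E. dev \<omega> p)"
  proof
    fix p assume "p \<in> I"
    then obtain l b s where p: "p = ((l, b), s)" "(l, b) \<in> Lambda M A n \<epsilon>" "s = 1 \<or> s = -1"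
      by (auto simp: I_def)
    then show "\<exists>E. E \<in> sets M \<and> 1 - \<epsilon> / k \<le> prob E \<and> (\<forall>\<omega>\<in>E. dev \<omega> p)"
      using concentrated_event[of l b \<epsilon> s] pos[of l b] \<epsilon> K unfolding dev_def k_def by auto
  qed
  then obtain E where E: "\<And>p. p \<in> I \<Longrightarrow> E p \<in> sets M" "\<And>p. p \<in> I \<Longrightarrow> 1 - \<epsilon> / k \<le> prob (E p)"
    "\<And>p \<omega>. p \<in> I \<Longrightarrow> \<omega> \<in> E p \<Longrightarrow> dev \<omega> p"
    by metis
  define F where "F = (\<Union>p\<in>I. space M - E p)"
  have F: "F \<in> sets M" unfolding F_def using fin E by (intro sets.finite_UN) auto
  have "prob F \<le> (\<Sum>p\<in>I. prob (space M - E p))"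
    unfolding F_def using fin E by (intro finite_measure_subadditive_finite) auto
  also have "\<dots> \<le> (\<Sum>p\<in>I. \<epsilon> / k)"
  proof (rule sum_mono)
    fix p assume "p \<in> I"
    then show "prob (space M - E p) \<le> \<epsilon> / k" using E(2)[of p] prob_compl[OF E(1)[of p]] by simp
  qed
  also have "\<dots> = 2 * \<epsilon>" using card k by simp
  finally have "1 - 2 * \<epsilon> \<le> prob (space M - F)" using prob_compl[OF F] by simp
  moreover have "concentrated \<omega> \<epsilon> l b s"
    if "\<omega> \<in> space M - F" "(l, b) \<in> Lambda M A n \<epsilon>" "s \<in> {1, -1}" for \<omega> l b s
    using that E(3)[of "((l, b), s)" \<omega>] by (auto simp: F_def I_def dev_def)
  ultimately show ?thesis using F by (intro bexI[of _ "space M - F"]) auto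
qed

lemma N_scale: "N M A (\<alpha> *\<^sub>R \<theta>) = \<alpha>\<^sup>2 * N M A \<theta>"
  unfolding N_def by (simp add: matrix_vector_mult_scaleR power2_eq_square mult.assoc)

lemma Lambda_pos:
  assumes kappa: "1 < kappa M A" and K: "1 \<le> K_grid M A n" and \<epsilon>: "0 < \<epsilon>" "\<epsilon> < 1" and s4: "0 < (s4 M A)\<^sup>2"
    and mem: "(l, b) \<in> Lambda M A n \<epsilon>"
  shows "0 < l" "0 < b"
proof -
  have E: "0 < E_op2 M A" using s4 unfolding s4_sq by simp
  obtain j where j: "l = lambda_grid M A n \<epsilon> j" "b = beta_grid M A n j"
    using mem by (auto simp: Lambda_def)
  have "1 < real_of_int (K_grid M A n) / \<epsilon>" using K \<epsilon> by (simp add: less_divide_eq)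
  then have "0 < ln (real_of_int (K_grid M A n) / \<epsilon>)" by simp
  moreover have "0 \<le> (2 + 3 * c_const) * E_tr2 M A / (4 * (2 + c_const) * sqrt (kappa M A) * E_op2 M A) * exp (real j * a_step)"
    using E E_tr2_nonneg c_const_pos kappa by simp
  ultimately show "0 < l" unfolding j lambda_grid_def using kappa n_pos by simp
  show "0 < b" unfolding j beta_grid_def using E kappa n_pos c_const_pos by simp
qed

context
  fixes \<omega> :: 'w and \<epsilon> l b \<sigma> :: real and \<theta> :: "real^'d"
  assumes conc: "\<forall>s\<in>{1, -1}. concentrated \<omega> \<epsilon> l b s" and l: "0 < l" and b: "0 < b" and \<sigma>: "0 < \<sigma>" and \<theta>: "\<theta> \<noteq> 0"
    and kappa: "1 < kappa M A" and K: "1 \<le> K_grid M A n" and \<epsilon>: "0 < \<epsilon>" "\<epsilon> < 1"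
begin

private abbreviation (input) "energy_est \<equiv> N_tilde n (\<lambda>i. As i \<omega>) l \<theta> / (norm \<theta>)\<^sup>2"
private abbreviation (input) "energy \<equiv> N M A \<theta> / (norm \<theta>)\<^sup>2"
private abbreviation (input) "\<gamma> \<equiv> gam M A n \<epsilon> l b"
private abbreviation (input) "\<mu> \<equiv> mu M A l b"
private abbreviation (input) "\<xi> \<equiv> xi M A l"
private abbreviation (input) "\<delta> \<equiv> delta n l b"

lemma param_signs: "0 < \<gamma>" "0 \<le> \<mu>" "0 \<le> \<xi>" "0 < \<delta>"
  and gam_ge: "l / 2 * (kappa M A - 1) \<le> \<gamma>" "\<mu> \<le> 2 * \<gamma>"
proof -
  have n0: "0 < real n" using n_pos by simp
  define C where "C = (2 + c_const) * sqrt (kappa M A) * (s4 M A)\<^sup>2 / b"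
  define D where "D = (2 + 3 * c_const) * E_tr2 M A / (2 * b\<^sup>2 * l)"
  define G where "G = ln (real (card (Lambda M A n \<epsilon>)) / \<epsilon>) / (real n * l)"
  define L where "L = l / 2 * (kappa M A - 1)"
  have C: "0 \<le> C" using c_const_pos kappa b by (simp add: C_def)
  have D: "0 \<le> D" using c_const_pos E_tr2_nonneg l by (simp add: D_def)
  have G: "0 < G" using ln_card_Lambda_le(1)[OF K \<epsilon>] n0 l by (simp add: G_def)
  have L: "0 < L" using l kappa by (simp add: L_def)
  have g_eq: "\<gamma> = L + C + D + G" and m_eq: "\<mu> = 2 * L + C"
    by (simp_all add: gam_def mu_def C_def D_def G_def L_def)
  show "0 < \<gamma>" unfolding g_eq using C D G L by linarith
  show "\<mu> \<le> 2 * \<gamma>" unfolding g_eq m_eq using C D G by simp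
  show "0 \<le> \<mu>" unfolding m_eq using C L by simp
  show "l / 2 * (kappa M A - 1) \<le> \<gamma>" unfolding g_eq L_def[symmetric] using C D G by linarith
  show "0 \<le> \<xi>" unfolding xi_def using kappa l by simp
  show "0 < \<delta>" unfolding delta_def using b n0 l by simp
qed

text \<open>The deviation inequality from below, at the multiple of \<open>\<theta>\<close> whose normalised energy is \<open>x'\<close>. The condition
on \<open>x'\<close> says that this multiple lies in the range where the criterion is nonpositive.\<close>

lemma upper_inequality:
  assumes x': "0 \<le> x'" and s: "0 < s" "energy_est \<le> s" and energy: "0 < energy" and le: "x' * s \<le> energy"
  shows "(1 - \<mu>) * (x' - 1) - \<xi> * (x' - 1)\<^sup>2 \<le> \<gamma> + \<delta> * l / energy * x'"
proof -
  define \<alpha> where "\<alpha> = sqrt (l * x' / N M A \<theta>)"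
  have t2: "0 < (norm \<theta>)\<^sup>2" using \<theta> by simp
  have N: "0 < N M A \<theta>" using energy t2 by (simp add: zero_less_divide_iff)
  have \<alpha>: "0 \<le> \<alpha>" "\<alpha>\<^sup>2 = l * x' / N M A \<theta>" using l x' N by (auto simp: \<alpha>_def)
  have "r_crit n (\<lambda>i. As i \<omega>) l (\<alpha> *\<^sub>R \<theta>) \<le> 0"
  proof (rule N_tilde_characterisation(1)[OF n_pos l, where s = "s * (norm \<theta>)\<^sup>2"])
    show "N_tilde n (\<lambda>i. As i \<omega>) l \<theta> \<le> s * (norm \<theta>)\<^sup>2" using s t2 by (simp add: pos_divide_le_eq)
    show "0 < s * (norm \<theta>)\<^sup>2" using s t2 by simp
    have "x' * (s * (norm \<theta>)\<^sup>2) \<le> N M A \<theta>" using le t2 by (simp add: pos_le_divide_eq mult.assoc)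
    then have "l * (x' * (s * (norm \<theta>)\<^sup>2)) \<le> l * N M A \<theta>" using l by simp
    then show "\<alpha>\<^sup>2 * (s * (norm \<theta>)\<^sup>2) \<le> l" unfolding \<alpha> using N by (simp add: pos_divide_le_eq mult_ac)
  qed (rule \<alpha>)
  moreover have "N M A (\<alpha> *\<^sub>R \<theta>) / l = x'" using N l by (simp add: N_scale \<alpha>)
  moreover have "(norm (\<alpha> *\<^sub>R \<theta>))\<^sup>2 = l / energy * x'" using t2 by (simp add: power_mult_distrib \<alpha>)
  ultimately have "0 \<le> l * (- (x' - 1) + \<gamma> + \<mu> * (x' - 1) + \<xi> * (x' - 1)\<^sup>2 + \<delta> * (l / energy * x'))"
    using conc[unfolded concentrated_def, rule_format, of "-1" "\<alpha> *\<^sub>R \<theta>"] by simp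
  then have "0 \<le> - (x' - 1) + \<gamma> + \<mu> * (x' - 1) + \<xi> * (x' - 1)\<^sup>2 + \<delta> * (l / energy * x')"
    using l by (simp add: zero_le_mult_iff)
  then show ?thesis by (simp add: left_diff_distrib)
qed

lemma lower_inequality:
  assumes pos: "0 < energy_est"
  shows "0 \<le> (1 + \<mu>) * (energy / energy_est - 1) + \<xi> * (energy / energy_est - 1)\<^sup>2 + \<gamma> + \<delta> * l / energy_est"
proof -
  let ?T = "N_tilde n (\<lambda>i. As i \<omega>) l \<theta>"
  define \<alpha> where "\<alpha> = sqrt (l / ?T)"
  have t2: "0 < (norm \<theta>)\<^sup>2" using \<theta> by simp
  have T: "0 < ?T" using pos t2 by (simp add: zero_less_divide_iff)
  have \<alpha>: "\<alpha>\<^sup>2 = l / ?T" using l T by (simp add: \<alpha>_def)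
  have "0 \<le> r_crit n (\<lambda>i. As i \<omega>) l (\<alpha> *\<^sub>R \<theta>)"
    unfolding \<alpha>_def by (rule N_tilde_characterisation(2)[OF n_pos l T])
  moreover have "N M A (\<alpha> *\<^sub>R \<theta>) / l = energy / energy_est" using T l t2 by (simp add: N_scale \<alpha>)
  moreover have "(norm (\<alpha> *\<^sub>R \<theta>))\<^sup>2 = l / energy_est" using t2 by (simp add: power_mult_distrib \<alpha>)
  ultimately have "0 \<le> l * ((energy / energy_est - 1) + \<gamma> + \<mu> * (energy / energy_est - 1) + \<xi> * (energy / energy_est - 1)\<^sup>2 + \<delta> * (l / energy_est))"
    using conc[unfolded concentrated_def, rule_format, of 1 "\<alpha> *\<^sub>R \<theta>"] by simp
  then have "0 \<le> (energy / energy_est - 1) + \<gamma> + \<mu> * (energy / energy_est - 1) + \<xi> * (energy / energy_est - 1)\<^sup>2 + \<delta> * (l / energy_est)"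
    using l by (simp only: zero_le_mult_iff) auto
  then show ?thesis by (simp add: distrib_right)
qed

lemma energy_nonneg: "0 \<le> energy"
  using N_nonneg[of \<theta>] by simp

lemma B_bound_eq:
  "B_bound M A n \<epsilon> \<sigma> (l, b) energy_est =
    (if \<xi> + \<mu> + \<gamma> + 2 * (\<delta> * l / max energy_est \<sigma>) < 1
     then ereal ((\<gamma> + \<delta> * l / max energy_est \<sigma>) / (1 - \<mu> - \<gamma> - 2 * (\<delta> * l / max energy_est \<sigma>))) else \<infinity>)"
  unfolding B_bound_def by (simp add: mult_ac)

text \<open>The error term at scale \<open>x'\<close> is largest at the end of the segment, where it equals \<open>\<delta> l/s\<close>. If the
estimate is below the threshold \<open>\<sigma>\<close>, only the upper bound for the ratio is at stake.\<close>

lemma ratio_le_B_bound: "ereal \<bar>max energy \<sigma> / max energy_est \<sigma> - 1\<bar> \<le> B_bound M A n \<epsilon> \<sigma> (l, b) energy_est"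
proof (cases "\<xi> + \<mu> + \<gamma> + 2 * (\<delta> * l / max energy_est \<sigma>) < 1")
  case False
  then show ?thesis unfolding B_bound_eq by simp
next
  case True
  define s where "s = max energy_est \<sigma>"
  define e where "e = \<delta> * l / s"
  have s: "0 < s" "energy_est \<le> s" "\<sigma> \<le> s" using \<sigma> by (auto simp: s_def)
  note signs = param_signs
  have e: "0 < e" using signs l s by (simp add: e_def)
  have small: "\<xi> + \<mu> + \<gamma> + 2 * e < 1" using True by (simp add: e_def s_def)
  define y where "y = (\<gamma> + e) / (1 - \<mu> - \<gamma> - 2 * e)"
  have y: "0 \<le> y" unfolding y_def using signs e small by (intro divide_nonneg_nonneg) auto
  have cancel: "r / z * (z / q) = r / q" if "0 < z" for r z q :: real using that by simp
  have up: "energy / s - 1 \<le> y"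
  proof (cases "energy = 0")
    case True
    show ?thesis unfolding True using y by simp
  next
    case False
    then have energy: "0 < energy" using energy_nonneg by linarith
    show ?thesis unfolding y_def
    proof (rule localise_upper[OF _ _ _ _ small])
      fix x' assume x': "1 \<le> x'" "x' \<le> energy / s"
      have le: "x' * s \<le> energy" using x'(2) unfolding pos_le_divide_eq[OF s(1)] .
      have "(1 - \<mu>) * (x' - 1) - \<xi> * (x' - 1)\<^sup>2 \<le> \<gamma> + \<delta> * l / energy * x'"
        using x' by (intro upper_inequality[OF _ s(1,2) energy le]) auto
      also have "\<delta> * l / energy * x' \<le> \<delta> * l / energy * (energy / s)"
        using x' signs l energy by (intro mult_left_mono divide_nonneg_pos) auto
      also have "\<dots> = e" unfolding e_def by (rule cancel[OF energy])
      also have "e \<le> e * x'" using e x' by simp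
      finally show "(1 - \<mu>) * (x' - 1) - \<xi> * (x' - 1)\<^sup>2 \<le> \<gamma> + e * x'" by simp
    qed (use signs e in auto)
  qed
  have "max energy \<sigma> / s - 1 \<le> y"
  proof (cases "\<sigma> \<le> energy")
    case False
    then have "max energy \<sigma> / s \<le> 1" using s by (simp add: divide_le_eq)
    then show ?thesis using y by simp
  qed (use up in \<open>simp add: max_absorb1\<close>)
  moreover have "1 - max energy \<sigma> / s \<le> y"
  proof (cases "\<sigma> \<le> energy_est")
    case False
    then have "s = \<sigma>" by (simp add: s_def)
    then have "1 \<le> max energy \<sigma> / s" using \<sigma> by (simp add: le_divide_eq)
    then show ?thesis using y by simp
  next
    case True
    then have sN: "s = energy_est" and pos: "0 < energy_est" using \<sigma> by (auto simp: s_def)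
    have "1 - energy / s \<le> y"
      unfolding y_def
    proof (rule localise_lower[OF _ _ _ _ _ _ small])
      show "0 \<le> (1 + \<mu>) * (energy / s - 1) + \<xi> * (energy / s - 1)\<^sup>2 + \<gamma> + e"
        using lower_inequality[OF pos] unfolding e_def sN .
      show "0 \<le> energy / s" by (rule divide_nonneg_pos[OF energy_nonneg s(1)])
    qed (use signs e in auto)
    moreover have "energy / s \<le> max energy \<sigma> / s" using s by (intro divide_right_mono) auto
    ultimately show ?thesis by simp
  qed
  ultimately have "\<bar>max energy \<sigma> / s - 1\<bar> \<le> y" by linarith
  then show ?thesis unfolding B_bound_eq using True unfolding s_def[symmetric] e_def[symmetric] y_def by simp
qed

text \<open>The bound at the estimated energy, expressed through the true energy: first the ratio of the two is
bounded, then \<open>plug_in_bound\<close> applies.\<close>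

lemma B_bound_le:
  assumes small: "\<xi> + \<mu> + 2 * \<gamma> + 4 * (l * \<delta> / max energy \<sigma>) < 1"
  shows "B_bound M A n \<epsilon> \<sigma> (l, b) energy_est \<le>
    ereal ((\<gamma> + l * \<delta> / max energy \<sigma>) / (1 - \<mu> - 2 * \<gamma> - 4 * (l * \<delta> / max energy \<sigma>)))"
proof -
  define s where "s = max energy_est \<sigma>"
  define t where "t = max energy \<sigma>"
  define e where "e = \<delta> * l / s"
  define e0 where "e0 = l * \<delta> / t"
  have s: "0 < s" "energy_est \<le> s" "\<sigma> \<le> s" using \<sigma> by (auto simp: s_def)
  have t: "0 < t" using \<sigma> by (auto simp: t_def)
  note signs = param_signs
  have e0: "0 < e0" using signs l t by (simp add: e0_def)
  have small': "\<xi> + \<mu> + 2 * \<gamma> + 4 * e0 < 1" using small by (simp add: e0_def t_def)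
  define u where "u = (\<gamma> + e0) / (1 - \<mu> - \<gamma> - 2 * e0)"
  have u: "0 \<le> u" unfolding u_def using signs e0 small' by (intro divide_nonneg_nonneg) auto
  have "t / s - 1 \<le> u"
  proof (cases "\<sigma> \<le> energy")
    case False
    then have "t / s \<le> 1" using s by (simp add: divide_le_eq t_def)
    then show ?thesis using u by simp
  next
    case True
    then have tN: "t = energy" and energy: "0 < energy" using \<sigma> by (auto simp: t_def)
    show ?thesis unfolding u_def
    proof (rule localise_upper)
      fix x' assume x': "1 \<le> x'" "x' \<le> t / s"
      have le: "x' * s \<le> energy" using x'(2) unfolding tN pos_le_divide_eq[OF s(1)] .
      show "(1 - \<mu>) * (x' - 1) - \<xi> * (x' - 1)\<^sup>2 \<le> \<gamma> + e0 * x'"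
        using upper_inequality[OF _ s(1,2) energy le] x' by (simp add: e0_def tN mult_ac)
    qed (use signs e0 small' in auto)
  qed
  then have "e0 * (t / s) \<le> e0 * (1 + u)" using e0 by (intro mult_left_mono) auto
  moreover have "e0 * (t / s) = e" using t by (simp add: e0_def e_def)
  ultimately have e: "e \<le> e0 * (1 + (\<gamma> + e0) / (1 - \<mu> - \<gamma> - 2 * e0))" by (simp add: u_def)
  have nn: "0 \<le> \<gamma>" "0 \<le> e0" "0 \<le> \<mu>" "0 \<le> \<xi>" "0 < \<gamma> + e0" using signs e0 by auto
  show ?thesis
    unfolding B_bound_eq using plug_in_bound[OF nn small' e]
    unfolding s_def[symmetric] e_def[symmetric] t_def[symmetric] e0_def[symmetric] by simp
qed

end

end

section \<open>The adaptive estimator\<close>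

theorem proposition6p1:
  fixes M :: "'w measure"
    and A :: "'w \<Rightarrow> real^'d^'d"
    and As :: "nat \<Rightarrow> 'w \<Rightarrow> real^'d^'d"
    and n :: nat
    and \<epsilon> \<sigma> :: real
    and sel :: "'w \<Rightarrow> real^'d \<Rightarrow> real \<times> real"
    and N_hat :: "'w \<Rightarrow> real^'d \<Rightarrow> real"
  assumes "prob_space M"
    and "random_psd_matrix M A"
    and "n \<ge> 1"
    and "\<And>i. i < n \<Longrightarrow> random_psd_matrix M (As i)"
    and "\<And>i. i < n \<Longrightarrow> distr M borel (As i) = distr M borel A"
    and "prob_space.indep_vars M (\<lambda>_. borel) As {..<n}"
    and s4_finite: "integrable M (\<lambda>\<omega>. (op_norm (A \<omega>))^2)"
    and kappa_finite: "bdd_above (kappa_ratios M A)"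
    and "kappa M A > 1"
    and "K_grid M A n \<ge> 1"
    and "0 < \<epsilon>" and "\<epsilon> < 1"
    and "0 < \<sigma>" and "\<sigma> \<le> (s4 M A)^2"
    and sel: "\<And>\<omega> \<theta>. \<omega> \<in> space M \<Longrightarrow> \<theta> \<noteq> 0 \<Longrightarrow>
      is_arg_min
        (\<lambda>(l, b). B_bound M A n \<epsilon> \<sigma> (l, b) (N_tilde n (\<lambda>i. As i \<omega>) l \<theta> / (norm \<theta>)^2))
        (\<lambda>p. p \<in> Lambda M A n \<epsilon>)
        (sel \<omega> \<theta>)"
    and N_hat: "\<And>\<omega> \<theta>. \<omega> \<in> space M \<Longrightarrow> \<theta> \<noteq> 0 \<Longrightarrow>
      N_hat \<omega> \<theta> = N_tilde n (\<lambda>i. As i \<omega>) (fst (sel \<omega> \<theta>)) \<theta>"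
  shows "\<exists>E \<in> sets M. measure M E \<ge> 1 - 2 * \<epsilon> \<and>
    (\<forall>\<omega>\<in>E. \<forall>\<theta>::real^'d. \<theta> \<noteq> 0 \<longrightarrow>
      ereal \<bar>max (N M A \<theta>) (\<sigma> * (norm \<theta>)^2) / max (N_hat \<omega> \<theta>) (\<sigma> * (norm \<theta>)^2) - 1\<bar>
        \<le> B_star M A n \<epsilon> \<sigma> (N M A \<theta> / (norm \<theta>)^2))"
proof -
  interpret gram_sample M A As n
    using assms(1-8) unfolding gram_sample_def gram_sample_axioms_def random_gram_def random_gram_axioms_def
    by simp
  note kappa = \<open>kappa M A > 1\<close> and K = \<open>K_grid M A n \<ge> 1\<close> and \<epsilon> = \<open>0 < \<epsilon>\<close> \<open>\<epsilon> < 1\<close> and \<sigma> = \<open>0 < \<sigma>\<close>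
  have s4: "0 < (s4 M A)\<^sup>2" using \<sigma> \<open>\<sigma> \<le> (s4 M A)^2\<close> by linarith
  note Lpos = Lambda_pos[OF kappa K \<epsilon> s4]
  have "\<exists>E\<in>sets M. 1 - 2 * \<epsilon> \<le> prob E \<and> (\<forall>\<omega>\<in>E. \<forall>(l, b)\<in>Lambda M A n \<epsilon>. \<forall>s\<in>{1, -1}. concentrated \<omega> \<epsilon> l b s)"
    by (rule all_concentrated_event[OF K \<epsilon>(1)]) (simp add: Lpos)
  then obtain E where E: "E \<in> sets M" "1 - 2 * \<epsilon> \<le> prob E"
    and all_conc: "\<forall>\<omega>\<in>E. \<forall>(l, b)\<in>Lambda M A n \<epsilon>. \<forall>s\<in>{1, -1}. concentrated \<omega> \<epsilon> l b s"
    by (elim bexE conjE)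
  have conc: "\<forall>s\<in>{1, -1}. concentrated \<omega> \<epsilon> l b s" if "\<omega> \<in> E" "(l, b) \<in> Lambda M A n \<epsilon>" for \<omega> l b
    using bspec[OF bspec[OF all_conc that(1)] that(2)] by simp
  have main: "ereal \<bar>max (N M A \<theta>) (\<sigma> * (norm \<theta>)^2) / max (N_hat \<omega> \<theta>) (\<sigma> * (norm \<theta>)^2) - 1\<bar>
        \<le> B_star M A n \<epsilon> \<sigma> (N M A \<theta> / (norm \<theta>)^2)" if \<omega>: "\<omega> \<in> E" and \<theta>: "\<theta> \<noteq> 0" for \<omega> \<theta>
  proof -
    have sp: "\<omega> \<in> space M" using \<omega> E(1) sets.sets_into_space by blast
    have t2: "0 < (norm \<theta>)\<^sup>2" using \<theta> by simp
    define \<nu> where "\<nu> = N M A \<theta> / (norm \<theta>)\<^sup>2"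
    define t where "t = max \<nu> \<sigma>"
    define \<tau> where "\<tau> l = N_tilde n (\<lambda>i. As i \<omega>) l \<theta> / (norm \<theta>)\<^sup>2" for l
    define B where "B p = B_bound M A n \<epsilon> \<sigma> p (\<tau> (fst p))" for p
    obtain l0 b0 where p0: "sel \<omega> \<theta> = (l0, b0)" by fastforce
    have argmin: "is_arg_min B (\<lambda>p. p \<in> Lambda M A n \<epsilon>) (l0, b0)"
    proof -
      have "(\<lambda>(l, b). B_bound M A n \<epsilon> \<sigma> (l, b) (N_tilde n (\<lambda>i. As i \<omega>) l \<theta> / (norm \<theta>)\<^sup>2)) = B"
        by (auto simp: B_def \<tau>_def)
      then show ?thesis using sel[OF sp \<theta>] unfolding p0 by simp
    qed
    then have mem0: "(l0, b0) \<in> Lambda M A n \<epsilon>" and min: "\<And>p. p \<in> Lambda M A n \<epsilon> \<Longrightarrow> B (l0, b0) \<le> B p"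
      unfolding is_arg_min_def by (auto simp: not_less)
    have "max (N M A \<theta>) (\<sigma> * (norm \<theta>)^2) = t * (norm \<theta>)\<^sup>2"
      unfolding t_def \<nu>_def using t2 by (simp add: max_mult_distrib_right)
    moreover have "max (N_hat \<omega> \<theta>) (\<sigma> * (norm \<theta>)^2) = max (\<tau> l0) \<sigma> * (norm \<theta>)\<^sup>2"
      unfolding \<tau>_def N_hat[OF sp \<theta>] p0 using t2 by (simp add: max_mult_distrib_right)
    ultimately have ratio: "max (N M A \<theta>) (\<sigma> * (norm \<theta>)^2) / max (N_hat \<omega> \<theta>) (\<sigma> * (norm \<theta>)^2) = t / max (\<tau> l0) \<sigma>"
      using t2 by simp
    have sel_bound: "ereal \<bar>t / max (\<tau> l0) \<sigma> - 1\<bar> \<le> B (l0, b0)"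
      using ratio_le_B_bound[OF conc[OF \<omega> mem0] Lpos[OF mem0] \<sigma> \<theta> kappa K \<epsilon>]
      by (simp add: t_def \<nu>_def \<tau>_def B_def)
    have "B (l0, b0) \<le> B_star M A n \<epsilon> \<sigma> \<nu>"
    proof (cases "(6 + 1 / (kappa M A - 1)) * zeta_star M A n \<epsilon> t \<le> sqrt n")
      case False
      then show ?thesis by (simp add: B_star_def t_def)
    next
      case True
      define Z where "Z = zeta_star M A n \<epsilon> t / sqrt n"
      have n0: "0 < sqrt n" using n_pos by simp
      have tpos: "0 < t" using \<sigma> by (simp add: t_def)
      have tle: "t \<le> (s4 M A)\<^sup>2"
        using N_le[of \<theta>] t2 \<open>\<sigma> \<le> (s4 M A)^2\<close> by (simp add: t_def \<nu>_def pos_divide_le_eq)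
      define q where "q = 98.5 * sqrt (kappa M A) * sqrt (E_op2 M A) / t"
      have q: "0 < q" using kappa tpos s4 unfolding q_def s4_sq[symmetric] by simp
      have zq: "sqrt q \<le> zeta_star M A n \<epsilon> t"
        unfolding zeta_star_def q_def using kappa K \<epsilon> E_tr2_nonneg E_op2_nonneg tpos by simp
      have zpos: "0 < zeta_star M A n \<epsilon> t" using zq q by (smt (verit) real_sqrt_gt_zero)
      have Zpos: "0 < Z" using zpos n0 by (simp add: Z_def)
      have cond: "(6 + 1 / (kappa M A - 1)) * Z \<le> 1" using True n0 by (simp add: Z_def pos_divide_le_eq)
      \<comment> \<open>The second summand of \<open>\<zeta>\<^sub>*\<close> alone shows that the optimal index is in the grid.\<close>
      have n_ge: "72 * (2 + c_const) * sqrt (kappa M A) * (s4 M A)\<^sup>2 / t \<le> n"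
      proof -
        have "6 * sqrt q \<le> 6 * zeta_star M A n \<epsilon> t" using zq by simp
        also have "\<dots> \<le> (6 + 1 / (kappa M A - 1)) * zeta_star M A n \<epsilon> t"
          using kappa zpos by (intro mult_right_mono) auto
        also have "\<dots> \<le> sqrt n" by (rule True)
        finally have "(6 * sqrt q)\<^sup>2 \<le> (sqrt n)\<^sup>2" using q by (intro power_mono) auto
        then have "36 * q \<le> n" using q by (simp add: power_mult_distrib)
        moreover have "72 * (2 + c_const) * (sqrt (kappa M A) * (s4 M A)\<^sup>2 / t) \<le> 36 * 98.5 * (sqrt (kappa M A) * (s4 M A)\<^sup>2 / t)"
          using numerical_constants(4) kappa tpos by (intro mult_right_mono) auto
        ultimately show ?thesis by (simp add: q_def s4_sq mult_ac)
      qed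
      obtain l b where mem: "(l, b) \<in> Lambda M A n \<epsilon>"
        and opt: "gam M A n \<epsilon> l b + l * delta n l b / t \<le> Z"
        using grid_optimised[OF kappa K \<epsilon> tpos tle n_ge] unfolding Z_def by metis
      note signs = param_signs[OF conc[OF \<omega> mem] Lpos[OF mem] \<sigma> \<theta> kappa K \<epsilon>]
        and gge = gam_ge[OF conc[OF \<omega> mem] Lpos[OF mem] \<sigma> \<theta> kappa K \<epsilon>]
      define e where "e = l * delta n l b / t"
      have e: "0 < e" using signs Lpos[OF mem] tpos by (simp add: e_def)
      \<comment> \<open>\<open>\<xi>\<close> is \<open>1 + 1/(\<kappa> - 1)\<close> times the first summand of \<open>\<gamma>\<close>.\<close>
      have xi_le: "xi M A l \<le> (1 + 1 / (kappa M A - 1)) * Z"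
      proof -
        have "xi M A l = (1 + 1 / (kappa M A - 1)) * (l / 2 * (kappa M A - 1))"
          using kappa by (simp add: xi_def field_simps)
        also have "\<dots> \<le> (1 + 1 / (kappa M A - 1)) * Z"
          using gge(1) opt e kappa unfolding e_def[symmetric] by (intro mult_left_mono) auto
        finally show ?thesis .
      qed
      have mge: "mu M A l b + 2 * gam M A n \<epsilon> l b + 4 * e \<le> 4 * Z"
        using gge(2) opt unfolding e_def[symmetric] by linarith
      have "xi M A l + mu M A l b + 2 * gam M A n \<epsilon> l b + 4 * e \<le> (1 + 1 / (kappa M A - 1)) * Z + 4 * Z"
        using xi_le mge by linarith
      also have "\<dots> < (6 + 1 / (kappa M A - 1)) * Z" using Zpos by (simp add: algebra_simps)
      also have "\<dots> \<le> 1" by (rule cond)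
      finally have small: "xi M A l + mu M A l b + 2 * gam M A n \<epsilon> l b + 4 * e < 1" .
      have "4 * Z < 1"
      proof -
        have "4 * Z < (6 + 1 / (kappa M A - 1)) * Z" using Zpos kappa by (intro mult_strict_right_mono) (auto intro: add_pos_pos)
        then show ?thesis using cond by linarith
      qed
      have "B (l0, b0) \<le> B (l, b)" by (rule min[OF mem])
      also have "\<dots> \<le> ereal ((gam M A n \<epsilon> l b + e) / (1 - mu M A l b - 2 * gam M A n \<epsilon> l b - 4 * e))"
        using B_bound_le[OF conc[OF \<omega> mem] Lpos[OF mem] \<sigma> \<theta> kappa K \<epsilon>] small
        by (simp add: B_def \<tau>_def e_def t_def \<nu>_def)
      also have "\<dots> \<le> ereal (Z / (1 - 4 * Z))"
        using opt mge signs e \<open>4 * Z < 1\<close> unfolding e_def[symmetric] ereal_less_eq by (intro frac_le) auto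
      also have "\<dots> = B_star M A n \<epsilon> \<sigma> \<nu>" using True by (simp add: B_star_def t_def Z_def)
      finally show ?thesis .
    qed
    then show ?thesis unfolding ratio \<nu>_def[symmetric] using sel_bound by (rule order_trans[rotated])
  qed
  then show ?thesis using E by blast
qed

end
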